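(* Let $n\in\mathbb{N}$ and $f\in L^q(\mathscr{S}'(\mathbb{R}^2),\mu_{\mathfrak{C}})$, $q>1$. Then, for every $1\le r<q$, $f\,e^{-V_n}\in L^r(\mathscr{S}'(\mathbb{R}^2),\mu_{\mathfrak{C}})$ and $$\mathfrak{F}_{r,n}\big((f_m\,e^{-V_{n,m}})_{m\in\mathbb{N}}\big)=f\,e^{-V_n},$$ where $f_m=[\varphi_{m,n}^*]^{-1}(\mathbb{E}_{n,m}(f))$ for each $m\in\mathbb{N}$. Therefore, for every $f\in L^q(\mathscr{S}'(\mathbb{R}^2),\mu_{\mathfrak{C}})$, $q>1$, the following limit holds: $$\int_{\mathscr{S}'(\mathbb{R}^2)}f\,e^{-V_n}\,\mathrm{d}\mu_{\mathfrak{C}}=\lim_{m\to\infty}\int_{H_{m,n}^a}\mathbb{E}_{n,m}(f)\,e^{-V_{n,m}}\,\mathrm{d}\mu_{m,n},$$ where in the last integral $\mathbb{E}_{n,m}(f)$ is regarded as the function $f_m$ on $H_{m,n}^a$.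
   Context: $\mathscr{S}(\mathbb{R}^2)$ is the space of real Schwartz functions, $\mathscr{S}'(\mathbb{R}^2)$ its dual with the $\sigma$-algebra generated by the evaluations. $\mathfrak{C}(f,g)=\int_{\mathbb{R}^2}f(x)(-\Delta+1)^{-1}g(x)\,\mathrm{d}x$ and $\mu_{\mathfrak{C}}$ is the Gaussian measure on $\mathscr{S}'(\mathbb{R}^2)$ with $\int e^{i\phi(f)}\mathrm{d}\mu_{\mathfrak{C}}(\phi)=e^{-\frac12\mathfrak{C}(f,f)}$. Fix $h\in\mathcal{C}_0^\infty(\mathbb{R}^2)$ with $h\ge0$, $\int h=1$ and Fourier transform $\hat h(\xi)\ne0$ for every $\xi\in\mathbb{R}^2$, and put $\delta_{n,x}(y)=n^2h(n(x-y))$. Fix $k\in\mathbb{N}$ and a compactly supported, Riemann integrable cutoff function $g\in L^s(\mathbb{R}^2)$, $s>1$. Wick powers are ${:}\phi^k(f){:}=\sum_{j=0}^{[k/2]}\frac{(-1)^jk!}{(k-2j)!\,j!\,2^j}\mathfrak{C}(f,f)^j\phi(f)^{k-2j}$, $f\in\mathscr{S}(\mathbb{R}^2)$. Put $V_n(\phi)=\int_{\mathbb{R}^2}{:}\phi^k(\delta_{n,x}){:}\,g(x)\,\mathrm{d}x$. In the setting considered, $V=\lim_{n\to\infty}V_n$ in $L^2(\mu_{\mathfrak{C}})$, and it is taken as known from the literature that $e^{-V}\in\bigcap_{p<\infty}L^p(\mathscr{S}'(\mathbb{R}^2),\mu_{\mathfrak{C}})$. For $m\in\mathbb{N}$, $\mathfrak{N}_m=\{x\in\frac1{2^m}\mathbb{Z}^2:|x|\le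 m\}$, $H_{m,n}=\operatorname{span}\{\delta_{n,\ell}:\ell\in\mathfrak{N}_m\}$, $H_{m,n}^a$ is its algebraic dual, whose elements are written $\mathbf{z}=(z_\ell)_{\ell\in\mathfrak{N}_m}$ in the basis dual to $(\delta_{n,\ell})_\ell$. $\varphi_{m,n}:\mathscr{S}'(\mathbb{R}^2)\to H_{m,n}^a$, $\varphi_{m,n}(\phi)=\phi|_{H_{m,n}}=(\phi(\delta_{n,\ell}))_\ell$; $\mu_{m,n}=(\varphi_{m,n})_*\mu_{\mathfrak{C}}$; $\pi_{mm',n}:H_{m',n}^a\to H_{m,n}^a$ is restriction, $m\le m'$. On $H_{m,n}^a$, ${:}z_\ell^k{:}=\sum_{j=0}^{[k/2]}\frac{(-1)^jk!}{(k-2j)!\,j!\,2^j}\mathfrak{C}(\delta_{n,\ell},\delta_{n,\ell})^jz_\ell^{k-2j}$, and $V_{n,m}(\mathbf{z})=\frac1{2^{2m}}\sum_{\ell\in\mathfrak{N}_m}{:}z_\ell^k{:}\,g(\ell)$. $\mathbb{E}_{n,m}(f)$ is the conditional expectation of $f$ with respect to $\{\varphi_{m,n}^{-1}(B):B\subset H_{m,n}^a\text{ Borel}\}$; it lies in the range of $\varphi_{m,n}^*$, where $\varphi_{m,n}^*(u)=u\circ\varphi_{m,n}$. For fixed $n$ and $r\ge1$: $\mathfrak{H}$ is the diagram $(H_{m,n}^a,\mu_{m,n},\pi_{mm',n})$ indexed by $m\in\mathbb{N}$. A sequence $(f_m)_m\in\prod_mL^r(H_{m,n}^a,\mu_{m,n})$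 is co-Cauchy if for every $\varepsilon>0$ there is $M$ with $\|f_m\circ\pi_{mm',n}-f_{m'}\|_{L^r(\mu_{m',n})}<\varepsilon$ whenever $M\le m\le m'$. $\mathscr{L}^r(\mathfrak{H})$ is the space of co-Cauchy sequences modulo $(f_m)\sim(g_m)$ iff $\lim_m\|f_m-g_m\|_{L^r(\mu_{m,n})}=0$, with norm $\lim_m\|f_m\|_{L^r(\mu_{m,n})}$. $\mathfrak{F}_{r,n}:\mathscr{L}^r(\mathfrak{H})\to L^r(\mathscr{S}'(\mathbb{R}^2),\mu_{\mathfrak{C}})$, $(f_m)_m\mapsto\lim_{m\to\infty}\varphi_{m,n}^*(f_m)$ (limit in $L^r$), is an isometric isomorphism.
   Formalization: It is additionally assumed that k ≤ 1, or k is even and g ≥ 0 everywhere, or g = 0 everywhere; without this the claim fails, e.g. for k = 4 and g equal to −1 at the origin and 0 elsewhere. *)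

theory Defs
  imports "HOL-Probability.Probability"
begin

section \<open>Schwartz functions on the plane\<close>

definition pd :: "2 \<Rightarrow> (real^2 \<Rightarrow> real) \<Rightarrow> real^2 \<Rightarrow> real" where
  "pd i f = (\<lambda>x. frechet_derivative f (at x) (axis i 1))"

text \<open>Iterated partial derivatives are indexed by lists of directions rather than by multi-indices;
  for smooth functions the order of the directions is irrelevant.\<close>

abbreviation pds :: "2 list \<Rightarrow> (real^2 \<Rightarrow> real) \<Rightarrow> real^2 \<Rightarrow> real" where
  "pds \<equiv> foldr pd"

definition smooth :: "(real^2 \<Rightarrow> real) \<Rightarrow> bool" where
  "smooth f \<longleftrightarrow> (\<forall>a x. pds a f differentiable (at x))"

definition schwartz_fun :: "(real^2 \<Rightarrow> real) \<Rightarrow> bool" where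
  "schwartz_fun f \<longleftrightarrow> smooth f \<and> (\<forall>N a. \<exists>B. \<forall>x. norm x ^ N * \<bar>pds a f x\<bar> \<le> B)"

lemma smoothD: "smooth f \<Longrightarrow> pds a f differentiable (at x)"
  by (simp add: smooth_def)

lemma pds_zero: "pds a (\<lambda>_. 0) = (\<lambda>_. 0)"
proof (induction a)
  case (Cons i a)
  then show ?case by (simp add: pd_def)
qed simp

lemma pds_add:
  assumes "smooth f" "smooth g"
  shows "pds a (\<lambda>x. f x + g x) = (\<lambda>x. pds a f x + pds a g x)"
proof (induction a)
  case (Cons i a)
  have "frechet_derivative (\<lambda>x. pds a f x + pds a g x) (at x) =
      (\<lambda>h. frechet_derivative (pds a f) (at x) h + frechet_derivative (pds a g) (at x) h)" for x
    by (rule frechet_derivative_at[symmetric], rule has_derivative_add)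
      (use assms smoothD frechet_derivative_works in blast)+
  then have "pd i (\<lambda>x. pds a f x + pds a g x) = (\<lambda>x. pd i (pds a f) x + pd i (pds a g) x)"
    unfolding pd_def by presburger
  then show ?case using Cons by simp
qed simp

lemma pds_cmult:
  assumes "smooth f"
  shows "pds a (\<lambda>x. c * f x) = (\<lambda>x. c * pds a f x)"
proof (induction a)
  case (Cons i a)
  have "frechet_derivative (\<lambda>x. c * pds a f x) (at x) =
      (\<lambda>h. c * frechet_derivative (pds a f) (at x) h)" for x
    by (rule frechet_derivative_at[symmetric], rule has_derivative_mult_right)
      (use assms smoothD frechet_derivative_works in blast)+
  then have "pd i (\<lambda>x. c * pds a f x) = (\<lambda>x. c * pd i (pds a f) x)"
    unfolding pd_def by presburger
  then show ?case using Cons by simp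
qed simp

lemma affine_deriv:
  assumes "F differentiable (at (c *\<^sub>R (x - y)))"
  shows "((\<lambda>y. F (c *\<^sub>R (x - y))) has_derivative
    (\<lambda>h. frechet_derivative F (at (c *\<^sub>R (x - y))) (- c *\<^sub>R h))) (at (y :: real^2))"
proof -
  have 1: "((\<lambda>y. c *\<^sub>R (x - y)) has_derivative (\<lambda>h. - c *\<^sub>R h)) (at y)"
    by (auto intro!: derivative_eq_intros)
  have 2: "(F has_derivative frechet_derivative F (at (c *\<^sub>R (x - y)))) (at (c *\<^sub>R (x - y)))"
    using assms frechet_derivative_works by blast
  show ?thesis using diff_chain_at[OF 1 2] by (simp add: o_def)
qed

lemma pds_affine:
  assumes "smooth f"
  shows "pds a (\<lambda>y. f (c *\<^sub>R (x - y))) = (\<lambda>y. (- c) ^ length a * pds a f (c *\<^sub>R (x - y)))"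
proof (induction a)
  case (Cons i a)
  have D: "((\<lambda>y. (- c) ^ length a * pds a f (c *\<^sub>R (x - y))) has_derivative
    (\<lambda>h. (- c) ^ length a * frechet_derivative (pds a f) (at (c *\<^sub>R (x - y))) (- c *\<^sub>R h))) (at y)" for y
    by (rule has_derivative_mult_right, rule affine_deriv, rule smoothD[OF assms])
  have lin: "frechet_derivative (pds a f) (at z) (- c *\<^sub>R h) = - c * frechet_derivative (pds a f) (at z) h"
    for z h
    using linear_frechet_derivative[OF smoothD[OF assms], of a z]
    by (metis linear_scale real_scaleR_def)
  have "pd i (\<lambda>y. (- c) ^ length a * pds a f (c *\<^sub>R (x - y))) y =
      (- c) ^ length (i # a) * pd i (pds a f) (c *\<^sub>R (x - y))" for y
    unfolding pd_def frechet_derivative_at[OF D, symmetric] lin by simp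
  then show ?case unfolding foldr_Cons o_apply Cons by (rule ext)
qed simp

lemma schwartz_zero: "schwartz_fun (\<lambda>_. 0)"
  by (auto simp: schwartz_fun_def smooth_def pds_zero)

lemma smooth_add: "smooth f \<Longrightarrow> smooth g \<Longrightarrow> smooth (\<lambda>x. f x + g x)"
  unfolding smooth_def[of "\<lambda>x. f x + g x"] by (auto simp: pds_add intro!: derivative_intros smoothD)

lemma smooth_cmult: "smooth f \<Longrightarrow> smooth (\<lambda>x. c * f x)"
  unfolding smooth_def[of "\<lambda>x. c * f x"] by (auto simp: pds_cmult intro!: derivative_intros smoothD)

lemma smooth_affine: "smooth f \<Longrightarrow> smooth (\<lambda>y. f (c *\<^sub>R (x - y)))"
  unfolding smooth_def[of "\<lambda>y. f (c *\<^sub>R (x - y))"]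
  by (auto simp: pds_affine differentiable_def
      intro!: exI has_derivative_mult_right affine_deriv smoothD)

lemma schwartz_add:
  assumes "schwartz_fun f" "schwartz_fun g"
  shows "schwartz_fun (\<lambda>x. f x + g x)"
  unfolding schwartz_fun_def
proof (intro conjI allI)
  have s: "smooth f" "smooth g" using assms by (auto simp: schwartz_fun_def)
  then show "smooth (\<lambda>x. f x + g x)" by (rule smooth_add)
  fix N a
  obtain B C where B: "\<And>x. norm x ^ N * \<bar>pds a f x\<bar> \<le> B" and C: "\<And>x. norm x ^ N * \<bar>pds a g x\<bar> \<le> C"
    using assms unfolding schwartz_fun_def by metis
  show "\<exists>B. \<forall>x. norm x ^ N * \<bar>pds a (\<lambda>x. f x + g x) x\<bar> \<le> B"
  proof (intro exI allI)
    fix x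
    have "norm x ^ N * \<bar>pds a f x + pds a g x\<bar> \<le> norm x ^ N * (\<bar>pds a f x\<bar> + \<bar>pds a g x\<bar>)"
      by (intro mult_left_mono abs_triangle_ineq) auto
    also have "\<dots> \<le> B + C" using B[of x] C[of x] by (simp add: algebra_simps)
    finally show "norm x ^ N * \<bar>pds a (\<lambda>x. f x + g x) x\<bar> \<le> B + C" using s by (simp add: pds_add)
  qed
qed

lemma schwartz_cmult:
  assumes "schwartz_fun f"
  shows "schwartz_fun (\<lambda>x. c * f x)"
  unfolding schwartz_fun_def
proof (intro conjI allI)
  have s: "smooth f" using assms by (auto simp: schwartz_fun_def)
  then show "smooth (\<lambda>x. c * f x)" by (rule smooth_cmult)
  fix N a
  obtain B where B: "\<And>x. norm x ^ N * \<bar>pds a f x\<bar> \<le> B"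
    using assms unfolding schwartz_fun_def by metis
  have "norm x ^ N * \<bar>c * pds a f x\<bar> \<le> \<bar>c\<bar> * B" for x
    using mult_left_mono[OF B[of x], of "\<bar>c\<bar>"] by (simp add: abs_mult mult_ac)
  then show "\<exists>B. \<forall>x. norm x ^ N * \<bar>pds a (\<lambda>x. c * f x) x\<bar> \<le> B" using s by (auto simp: pds_cmult)
qed

lemma schwartz_pd:
  assumes "schwartz_fun f"
  shows "schwartz_fun (pd i f)"
proof -
  have "pds a (pd i f) = pds (a @ [i]) f" for a by simp
  then show ?thesis using assms unfolding schwartz_fun_def smooth_def by metis
qed

lemma schwartz_affine:
  assumes "schwartz_fun f" "c \<noteq> 0"
  shows "schwartz_fun (\<lambda>y. f (c *\<^sub>R (x - y)))"
  unfolding schwartz_fun_def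
proof (intro conjI allI)
  have s: "smooth f" using assms by (auto simp: schwartz_fun_def)
  then show "smooth (\<lambda>y. f (c *\<^sub>R (x - y)))" by (rule smooth_affine)
  fix N a
  obtain B where B: "\<And>x. norm x ^ N * \<bar>pds a f x\<bar> \<le> B"
    using assms unfolding schwartz_fun_def by metis
  obtain C where C: "\<And>x. norm x ^ 0 * \<bar>pds a f x\<bar> \<le> C"
    using assms unfolding schwartz_fun_def by metis
  let ?K = "2 ^ N * (norm x ^ N * C + (1 / \<bar>c\<bar>) ^ N * B)"
  have K: "norm y ^ N * \<bar>pds a f (c *\<^sub>R (x - y))\<bar> \<le> ?K" for y
  proof -
    let ?u = "c *\<^sub>R (x - y)"
    let ?v = "norm ?u / \<bar>c\<bar>"
    have v: "norm (x - y) = ?v" using assms(2) by simp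
    have "norm y \<le> norm x + norm (x - y)"
      using norm_triangle_ineq4[of x "x - y"] by simp
    then have "norm y \<le> norm x + ?v" unfolding v .
    also have "\<dots> \<le> 2 * max (norm x) ?v" by linarith
    finally have "norm y ^ N \<le> (2 * max (norm x) ?v) ^ N" by (rule power_mono) simp
    also have "\<dots> = 2 ^ N * max (norm x) ?v ^ N" by (simp add: power_mult_distrib)
    also have "\<dots> \<le> 2 ^ N * (norm x ^ N + ?v ^ N)"
      by (intro mult_left_mono) (auto simp: max_def)
    finally have "norm y ^ N * \<bar>pds a f ?u\<bar> \<le> 2 ^ N * (norm x ^ N + ?v ^ N) * \<bar>pds a f ?u\<bar>"
      by (intro mult_right_mono) auto
    also have "\<dots> = 2 ^ N * (norm x ^ N * \<bar>pds a f ?u\<bar> + (1 / \<bar>c\<bar>) ^ N * (norm ?u ^ N * \<bar>pds a f ?u\<bar>))"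
      by (simp add: algebra_simps power_divide del: norm_scaleR)
    also have "\<dots> \<le> ?K"
      using C[of ?u] B[of ?u] by (intro mult_left_mono add_mono) auto
    finally show ?thesis .
  qed
  have "norm y ^ N * \<bar>(- c) ^ length a * pds a f (c *\<^sub>R (x - y))\<bar> \<le> \<bar>- c\<bar> ^ length a * ?K" for y
    using mult_left_mono[OF K[of y], of "\<bar>- c\<bar> ^ length a"]
    by (simp add: abs_mult power_abs mult_ac)
  then show "\<exists>B. \<forall>y. norm y ^ N * \<bar>pds a (\<lambda>y. f (c *\<^sub>R (x - y))) y\<bar> \<le> B"
    using s by (auto simp: pds_affine simp del: abs_minus_cancel)
qed

typedef schwartz = "{f. schwartz_fun f}" morphisms sfun Abs_schwartz
  using schwartz_zero by blast

setup_lifting type_definition_schwartz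

instantiation schwartz :: real_vector
begin

lift_definition zero_schwartz :: schwartz is "\<lambda>_. 0" by (rule schwartz_zero)

lift_definition plus_schwartz :: "schwartz \<Rightarrow> schwartz \<Rightarrow> schwartz" is "\<lambda>f g x. f x + g x"
  by (rule schwartz_add)

lift_definition scaleR_schwartz :: "real \<Rightarrow> schwartz \<Rightarrow> schwartz" is "\<lambda>c f x. c * f x"
  by (rule schwartz_cmult)

definition uminus_schwartz :: "schwartz \<Rightarrow> schwartz" where
  "uminus_schwartz f = (- 1) *\<^sub>R f"

definition minus_schwartz :: "schwartz \<Rightarrow> schwartz \<Rightarrow> schwartz" where
  "minus_schwartz f g = f + (- g)"

instance
  by standard
    (simp_all add: sfun_inject[symmetric] fun_eq_iff algebra_simps uminus_schwartz_def
      minus_schwartz_def zero_schwartz.rep_eq plus_schwartz.rep_eq scaleR_schwartz.rep_eq)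

end

lift_definition partial :: "2 \<Rightarrow> schwartz \<Rightarrow> schwartz" is pd
  by (rule schwartz_pd)

definition seminorm :: "nat \<Rightarrow> 2 list \<Rightarrow> schwartz \<Rightarrow> real" where
  "seminorm N a f = (SUP x. norm x ^ N * \<bar>pds a (sfun f) x\<bar>)"

text \<open>The Schwartz topology: the locally convex topology of the above countable family of seminorms.
  The sets with finitely many seminorm constraints are cofinally those with all constraints up to
  some order \<open>K\<close>.\<close>

instantiation schwartz :: topological_space
begin

definition open_schwartz :: "schwartz set \<Rightarrow> bool" where
  "open_schwartz U \<longleftrightarrow> (\<forall>f\<in>U. \<exists>K. \<exists>e>0. \<forall>g.
     (\<forall>N a. N \<le> K \<and> length a \<le> K \<longrightarrow> seminorm N a (g - f) < e) \<longrightarrow> g \<in> U)"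

instance
proof
  show "open (UNIV :: schwartz set)" by (auto simp: open_schwartz_def intro: zero_less_one)
next
  fix S T :: "schwartz set"
  assume ST: "open S" "open T"
  show "open (S \<inter> T)"
    unfolding open_schwartz_def
  proof
    fix f assume f: "f \<in> S \<inter> T"
    obtain K d where 1: "d > 0"
      "\<And>g. (\<forall>N a. N \<le> K \<and> length a \<le> K \<longrightarrow> seminorm N a (g - f) < d) \<Longrightarrow> g \<in> S"
      using ST(1) f unfolding open_schwartz_def by blast
    obtain L e where 2: "e > 0"
      "\<And>g. (\<forall>N a. N \<le> L \<and> length a \<le> L \<longrightarrow> seminorm N a (g - f) < e) \<Longrightarrow> g \<in> T"
      using ST(2) f unfolding open_schwartz_def by blast
    show "\<exists>K. \<exists>e>0. \<forall>g. (\<forall>N a. N \<le> K \<and> length a \<le> K \<longrightarrow> seminorm N a (g - f) < e) \<longrightarrow> g \<in> S \<inter> T"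
    proof (intro exI[of _ "max K L"] exI[of _ "min d e"] conjI allI impI)
      fix g
      assume *: "\<forall>N a. N \<le> max K L \<and> length a \<le> max K L \<longrightarrow> seminorm N a (g - f) < min d e"
      have "g \<in> S" by (rule 1(2)) (use * in \<open>auto simp: le_max_iff_disj\<close>)
      moreover have "g \<in> T" by (rule 2(2)) (use * in \<open>auto simp: le_max_iff_disj\<close>)
      ultimately show "g \<in> S \<inter> T" by simp
    qed (use 1 2 in auto)
  qed
next
  fix \<K> :: "schwartz set set"
  assume "\<forall>S\<in>\<K>. open S"
  then show "open (\<Union>\<K>)" unfolding open_schwartz_def by (meson UnionE UnionI)
qed

end


section \<open>Tempered distributions and the Gaussian measure\<close>

definition tempered :: "(schwartz \<Rightarrow> real) set" where
  "tempered = {\<phi>. linear \<phi> \<and> continuous_on UNIV \<phi>}"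

definition tempered_algebra :: "(schwartz \<Rightarrow> real) measure" where
  "tempered_algebra = sigma tempered {{\<phi> \<in> tempered. \<phi> f \<in> B} |f B. B \<in> sets (borel :: real measure)}"

definition helmholtz :: "schwartz \<Rightarrow> schwartz" where
  "helmholtz u = - (partial 1 (partial 1 u) + partial 2 (partial 2 u)) + u"

text \<open>The operator \<open>-\<Delta> + 1\<close> is a bijection of the Schwartz space onto itself, so that \<open>inv\<close> is its
  genuine inverse.\<close>

definition cov :: "schwartz \<Rightarrow> schwartz \<Rightarrow> real" where
  "cov f g = (\<integral>x. sfun f x * sfun (inv helmholtz g) x \<partial>lborel)"

text \<open>By Bochner-Minlos exactly one measure has the following property.\<close>

definition gaussian_field :: "(schwartz \<Rightarrow> real) measure \<Rightarrow> bool" where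
  "gaussian_field \<mu> \<longleftrightarrow> prob_space \<mu> \<and> sets \<mu> = sets tempered_algebra \<and>
     (\<forall>f. (CLINT \<phi>|\<mu>. exp (\<i> * complex_of_real (\<phi> f))) = complex_of_real (exp (- cov f f / 2)))"


section \<open>Lebesgue spaces\<close>

definition Lp_fun :: "real \<Rightarrow> 'a measure \<Rightarrow> ('a \<Rightarrow> real) set" where
  "Lp_fun p M = {f \<in> borel_measurable M. integrable M (\<lambda>x. \<bar>f x\<bar> powr p)}"

definition Lp_norm :: "real \<Rightarrow> 'a measure \<Rightarrow> ('a \<Rightarrow> real) \<Rightarrow> real" where
  "Lp_norm p M f = (\<integral>x. \<bar>f x\<bar> powr p \<partial>M) powr (1 / p)"

definition Lp_class :: "real \<Rightarrow> 'a measure \<Rightarrow> ('a \<Rightarrow> real) \<Rightarrow> ('a \<Rightarrow> real) set" where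
  "Lp_class p M f = {F \<in> Lp_fun p M. AE x in M. F x = f x}"

definition Lp_tendsto :: "real \<Rightarrow> 'a measure \<Rightarrow> (nat \<Rightarrow> 'a \<Rightarrow> real) \<Rightarrow> ('a \<Rightarrow> real) \<Rightarrow> bool" where
  "Lp_tendsto p M F G \<longleftrightarrow> (\<forall>n. F n \<in> Lp_fun p M) \<and> G \<in> Lp_fun p M \<and>
     (\<lambda>n. Lp_norm p M (\<lambda>x. F n x - G x)) \<longlonglongrightarrow> 0"


section \<open>Cutoff and mollifier\<close>

definition compactly_supported :: "(real^2 \<Rightarrow> real) \<Rightarrow> bool" where
  "compactly_supported f \<longleftrightarrow> compact (closure {x. f x \<noteq> 0})"

text \<open>Convergence of Riemann sums as the mesh tends to zero: the gauge is the constant one, so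
  this is the Riemann and not the Henstock-Kurzweil integral. For a compactly supported function
  it does not matter whether one asks this for all boxes or for one box containing the support.\<close>

definition riemann_integrable :: "(real^2 \<Rightarrow> real) \<Rightarrow> bool" where
  "riemann_integrable f \<longleftrightarrow> (\<forall>a b. \<exists>I. \<forall>e>0. \<exists>d>0. \<forall>p.
     p tagged_division_of cbox a b \<and> (\<lambda>x. ball x d) fine p \<longrightarrow>
     \<bar>(\<Sum>(x, K)\<in>p. measure lborel K * f x) - I\<bar> < e)"

text \<open>A smooth compactly supported function is the same thing as a Schwartz function with compact
  support.\<close>

definition mollifier :: "schwartz \<Rightarrow> bool" where
  "mollifier h \<longleftrightarrow> compactly_supported (sfun h) \<and> (\<forall>x. 0 \<le> sfun h x) \<and>
     (\<integral>x. sfun h x \<partial>lborel) = 1 \<and>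
     (\<forall>\<xi>. (CLINT x|lborel. complex_of_real (sfun h x) * exp (- \<i> * complex_of_real (\<xi> \<bullet> x))) \<noteq> 0)"

lift_definition delta :: "schwartz \<Rightarrow> nat \<Rightarrow> real^2 \<Rightarrow> schwartz" is
  "\<lambda>h n x y. (real n)\<^sup>2 * h (real n *\<^sub>R (x - y))"
  subgoal for h n x
    by (cases "n = 0") (auto simp: schwartz_zero intro!: schwartz_cmult schwartz_affine)
  done


section \<open>Wick powers and interactions\<close>

text \<open>\<open>wick k c z\<close> is the Wick power of order \<open>k\<close> of \<open>z\<close> with variance \<open>c\<close>.\<close>

definition wick :: "nat \<Rightarrow> real \<Rightarrow> real \<Rightarrow> real" where
  "wick k c z = (\<Sum>j = 0..k div 2.
     ((- 1) ^ j * fact k) / (fact (k - 2 * j) * fact j * 2 ^ j) * c ^ j * z ^ (k - 2 * j))"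

definition interaction ::
  "schwartz \<Rightarrow> nat \<Rightarrow> (real^2 \<Rightarrow> real) \<Rightarrow> nat \<Rightarrow> (schwartz \<Rightarrow> real) \<Rightarrow> real" where
  "interaction h k g n \<phi> =
     (\<integral>x. wick k (cov (delta h n x) (delta h n x)) (\<phi> (delta h n x)) * g x \<partial>lebesgue)"


section \<open>The finite-dimensional approximations\<close>

definition grid :: "nat \<Rightarrow> (real^2) set" where
  "grid m = {x. (\<forall>i. \<exists>j::int. x $ i = of_int j / 2 ^ m) \<and> norm x \<le> real m}"

definition Hsp :: "schwartz \<Rightarrow> nat \<Rightarrow> nat \<Rightarrow> schwartz set" where
  "Hsp h m n = span (delta h n ` grid m)"

text \<open>Algebraic dual of a subspace; functionals are extended by \<open>undefined\<close> off the subspace to have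
  unique representatives.\<close>

definition alg_dual :: "schwartz set \<Rightarrow> (schwartz \<Rightarrow> real) set" where
  "alg_dual H = {z \<in> extensional H. (\<forall>u\<in>H. \<forall>v\<in>H. z (u + v) = z u + z v) \<and>
     (\<forall>c. \<forall>u\<in>H. z (c *\<^sub>R u) = c * z u)}"

definition coords :: "schwartz \<Rightarrow> nat \<Rightarrow> nat \<Rightarrow> (schwartz \<Rightarrow> real) \<Rightarrow> real^2 \<Rightarrow> real" where
  "coords h m n z = (\<lambda>l\<in>grid m. z (delta h n l))"

text \<open>The Borel sets of the finite-dimensional space \<open>alg_dual (Hsp h m n)\<close> are the preimages of the
  Borel sets of the coordinate space under the linear coordinate map.\<close>

definition dual_borel :: "schwartz \<Rightarrow> nat \<Rightarrow> nat \<Rightarrow> (schwartz \<Rightarrow> real) measure" where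
  "dual_borel h m n =
     vimage_algebra (alg_dual (Hsp h m n)) (coords h m n) (PiM (grid m) (\<lambda>_. borel))"

definition res :: "schwartz \<Rightarrow> nat \<Rightarrow> nat \<Rightarrow> (schwartz \<Rightarrow> real) \<Rightarrow> schwartz \<Rightarrow> real" where
  "res h m n \<phi> = restrict \<phi> (Hsp h m n)"

text \<open>\<open>res h m n\<close> serves both as the map \<open>\<phi>\<^sub>m\<^sub>,\<^sub>n\<close> on distributions and, applied to elements of
  \<open>alg_dual (Hsp h m' n)\<close>, \<open>m \<le> m'\<close>, as the transition map \<open>\<pi>\<^sub>m\<^sub>m\<^sub>'\<^sub>,\<^sub>n\<close>: both are restriction.\<close>

definition mu_fin ::
  "(schwartz \<Rightarrow> real) measure \<Rightarrow> schwartz \<Rightarrow> nat \<Rightarrow> nat \<Rightarrow> (schwartz \<Rightarrow> real) measure" where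
  "mu_fin \<mu> h m n = distr \<mu> (dual_borel h m n) (res h m n)"

definition interaction_fin ::
  "schwartz \<Rightarrow> nat \<Rightarrow> (real^2 \<Rightarrow> real) \<Rightarrow> nat \<Rightarrow> nat \<Rightarrow> (schwartz \<Rightarrow> real) \<Rightarrow> real" where
  "interaction_fin h k g n m z = 1 / 2 ^ (2 * m) *
     (\<Sum>l\<in>grid m. wick k (cov (delta h n l) (delta h n l)) (coords h m n z l) * g l)"

definition cyl_algebra ::
  "(schwartz \<Rightarrow> real) measure \<Rightarrow> schwartz \<Rightarrow> nat \<Rightarrow> nat \<Rightarrow> (schwartz \<Rightarrow> real) measure" where
  "cyl_algebra \<mu> h m n = vimage_algebra (space \<mu>) (res h m n) (dual_borel h m n)"

definition cond_exp_fin :: "(schwartz \<Rightarrow> real) measure \<Rightarrow> schwartz \<Rightarrow> nat \<Rightarrow> nat \<Rightarrow>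
    ((schwartz \<Rightarrow> real) \<Rightarrow> real) \<Rightarrow> (schwartz \<Rightarrow> real) \<Rightarrow> real" where
  "cond_exp_fin \<mu> h n m f = real_cond_exp \<mu> (cyl_algebra \<mu> h m n) f"

text \<open>The representatives of the inverse image of \<open>F\<close> under the pullback \<open>u \<mapsto> u \<circ> res h m n\<close>, a map
  between almost-everywhere classes.\<close>

definition pullback_inv :: "(schwartz \<Rightarrow> real) measure \<Rightarrow> schwartz \<Rightarrow> nat \<Rightarrow> nat \<Rightarrow>
    ((schwartz \<Rightarrow> real) \<Rightarrow> real) \<Rightarrow> ((schwartz \<Rightarrow> real) \<Rightarrow> real) set" where
  "pullback_inv \<mu> h m n F =
     {u \<in> borel_measurable (mu_fin \<mu> h m n). AE \<phi> in \<mu>. u (res h m n \<phi>) = F \<phi>}"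


section \<open>Co-Cauchy sequences\<close>

definition co_cauchy :: "real \<Rightarrow> (schwartz \<Rightarrow> real) measure \<Rightarrow> schwartz \<Rightarrow> nat \<Rightarrow>
    (nat \<Rightarrow> (schwartz \<Rightarrow> real) \<Rightarrow> real) set" where
  "co_cauchy r \<mu> h n = {u. (\<forall>m. u m \<in> Lp_fun r (mu_fin \<mu> h m n)) \<and>
     (\<forall>e>0. \<exists>M. \<forall>m m'. M \<le> m \<and> m \<le> m' \<longrightarrow>
        Lp_norm r (mu_fin \<mu> h m' n) (\<lambda>z. u m (res h m n z) - u m' z) < e)}"

definition co_rel :: "real \<Rightarrow> (schwartz \<Rightarrow> real) measure \<Rightarrow> schwartz \<Rightarrow> nat \<Rightarrow>
    (nat \<Rightarrow> (schwartz \<Rightarrow> real) \<Rightarrow> real) rel" where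
  "co_rel r \<mu> h n = {(u, v). u \<in> co_cauchy r \<mu> h n \<and> v \<in> co_cauchy r \<mu> h n \<and>
     (\<lambda>m. Lp_norm r (mu_fin \<mu> h m n) (\<lambda>z. u m z - v m z)) \<longlonglongrightarrow> 0}"

definition co_space :: "real \<Rightarrow> (schwartz \<Rightarrow> real) measure \<Rightarrow> schwartz \<Rightarrow> nat \<Rightarrow>
    (nat \<Rightarrow> (schwartz \<Rightarrow> real) \<Rightarrow> real) set set" where
  "co_space r \<mu> h n = co_cauchy r \<mu> h n // co_rel r \<mu> h n"

definition co_class :: "real \<Rightarrow> (schwartz \<Rightarrow> real) measure \<Rightarrow> schwartz \<Rightarrow> nat \<Rightarrow>
    (nat \<Rightarrow> (schwartz \<Rightarrow> real) \<Rightarrow> real) \<Rightarrow> (nat \<Rightarrow> (schwartz \<Rightarrow> real) \<Rightarrow> real) set" where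
  "co_class r \<mu> h n u = co_rel r \<mu> h n `` {u}"

text \<open>The map from co-Cauchy classes to almost-everywhere classes of functions on the tempered
  distributions; the class of the limit is the set of all \<open>L\<^sup>r\<close> limits of the pulled back
  representatives.\<close>

definition co_lim :: "real \<Rightarrow> (schwartz \<Rightarrow> real) measure \<Rightarrow> schwartz \<Rightarrow> nat \<Rightarrow>
    (nat \<Rightarrow> (schwartz \<Rightarrow> real) \<Rightarrow> real) set \<Rightarrow> ((schwartz \<Rightarrow> real) \<Rightarrow> real) set" where
  "co_lim r \<mu> h n X = {F. \<exists>u\<in>X. Lp_tendsto r \<mu> (\<lambda>m \<phi>. u m (res h m n \<phi>)) F}"

end

theory Submission
  imports Defs
begin

text \<open>
The conditional expectations of \<open>f\<close> on the cylinder algebras of the grids converge to \<open>f\<close>, the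
exponentials of the Riemann sums \<open>V\<^sub>n\<^sub>,\<^sub>m\<close> converge to the exponential of \<open>V\<^sub>n\<close>, and the gap between \<open>r\<close>
and \<open>q\<close> leaves enough room for the product to converge in \<open>L\<^sup>r\<close>.

\<^emph>\<open>The exponentials.\<close> For a fixed tempered distribution \<open>\<phi>\<close> the number \<open>\<phi>(\<delta>\<^sub>n\<^sub>,\<^sub>x)\<close> depends continuously on
\<open>x\<close> (\<open>continuous_tempered_delta\<close>), and so does the covariance of \<open>\<delta>\<^sub>n\<^sub>,\<^sub>x\<close>, which is read off from a
characteristic function (\<open>continuous_cov_delta\<close>). So \<open>V\<^sub>n\<^sub>,\<^sub>m\<close> is a Riemann sum of a continuous function
times \<open>g\<close>, and it converges for every \<open>\<phi>\<close> (\<open>grid_sum_tendsto\<close>, \<open>interaction_fin_tendsto\<close>). The moments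
of \<open>exp (- V\<^sub>n\<^sub>,\<^sub>m)\<close> are bounded uniformly in \<open>m\<close> (\<open>exp_interaction_fin_moments\<close>). If \<open>k\<close> is even and
\<open>g \<ge> 0\<close>, this holds because a Wick power of even order with bounded variance is bounded below. If
\<open>k = 1\<close>, then \<open>V\<^sub>n\<^sub>,\<^sub>m\<close> is a centred Gaussian variable, and centred Gaussian variables that converge
pointwise have bounded variances. If \<open>k = 0\<close> or \<open>g = 0\<close>, then \<open>V\<^sub>n\<^sub>,\<^sub>m\<close> is a bounded sequence of constants.

\<^emph>\<open>The conditional expectations.\<close> The cylinder algebras increase with the grid. What has to be
shown is that they exhaust all events up to null sets (\<open>all_sets_approximable\<close>), and this is where the
zero-free Fourier transform of \<open>h\<close> enters. The \<open>L\<^sup>2(\<mu>)\<close> norm of an evaluation \<open>\<phi>(u)\<close> is at most the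
\<open>L\<^sup>2\<close> norm of \<open>u\<close> in the plane, by coercivity of \<open>-\<Delta> + 1\<close> (\<open>cov_le_L2\<close>). In the latter norm the
combinations of the \<open>\<delta>\<^sub>n\<^sub>,\<^sub>l\<close> with dyadic \<open>l\<close> are dense (\<open>delta_span_L2_dense\<close>, Wiener's theorem on
translates): by Plancherel's identity one has to approximate the transform of \<open>u\<close> by trigonometric
polynomials times the transform \<open>H\<close> of \<open>\<delta>\<^sub>n\<^sub>,\<^sub>0\<close>, and since \<open>H\<close> has no zeros the quotient of the two
transforms is a continuous function, which trigonometric polynomials approximate by the
Stone-Weierstrass theorem. Hence every evaluation is an almost sure limit of cylindrical ones, and
Levy's upward theorem gives convergence in \<open>L\<^sup>1\<close> (\<open>levy_upward_L1\<close>), while Jensen's inequality bounds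
the \<open>L\<^sup>q\<close> norms (\<open>cond_exp_Lq_contraction\<close>).

\<^emph>\<open>The product.\<close> With \<open>r < p < q\<close>, the products are bounded in \<open>L\<^sup>p\<close> and converge in probability, hence
they converge in \<open>L\<^sup>r\<close> (\<open>product_Lr_tendsto\<close>). Convergence of the pullbacks in \<open>L\<^sup>r\<close> is then restated in
terms of classes of co-Cauchy sequences (\<open>co_limit_of_pullbacks\<close>).

The covariance is defined with the inverse of \<open>-\<Delta> + 1\<close> on the Schwartz space. Integration by parts
shows that this operator is injective. If some \<open>f\<close> were outside its range, the inverse would return
the same default value for all nonzero multiples of \<open>f\<close>, so the covariance would scale linearly
instead of quadratically; as a characteristic function is bounded by one, the covariance of such an
\<open>f\<close> can only be zero (\<open>cov_off_range\<close>). In either case it scales quadratically, and evaluations have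
centred normal distributions.
\<close>

section \<open>Schwartz functions and the Helmholtz operator\<close>

lemma sfun_bounds:
  obtains B where "0 \<le> B" "\<And>x. \<bar>sfun u x\<bar> * (1 + norm x ^ 4) \<le> B"
proof -
  have "schwartz_fun (sfun u)" using sfun by blast
  then have *: "\<exists>B. \<forall>x. norm x ^ N * \<bar>pds [] (sfun u) x\<bar> \<le> B" for N
    unfolding schwartz_fun_def by blast
  obtain B0 where B0: "\<And>x. norm x ^ 0 * \<bar>sfun u x\<bar> \<le> B0" using *[of 0] by auto
  obtain B4 where B4: "\<And>x. norm x ^ 4 * \<bar>sfun u x\<bar> \<le> B4" using *[of 4] by auto
  have "\<bar>sfun u x\<bar> * (1 + norm x ^ 4) \<le> B0 + B4" for x
    using B0[of x] B4[of x] by (simp add: algebra_simps)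
  moreover have "0 \<le> B0 + B4" using calculation[of 0] by (smt (verit) mult_nonneg_nonneg abs_ge_zero norm_ge_zero zero_le_power)
  ultimately show ?thesis using that by blast
qed

lemma sfun_bounded: obtains B where "0 \<le> B" "\<And>x. \<bar>sfun u x\<bar> \<le> B"
proof -
  obtain B where B: "0 \<le> B" "\<And>x. \<bar>sfun u x\<bar> * (1 + norm x ^ 4) \<le> B" using sfun_bounds[of u] by blast
  have "\<bar>sfun u x\<bar> * 1 \<le> \<bar>sfun u x\<bar> * (1 + norm x ^ 4)" for x
    by (intro mult_left_mono) auto
  then have "\<bar>sfun u x\<bar> \<le> B" for x using B(2)[of x] by (metis mult.right_neutral order.trans)
  with B(1) show ?thesis by (rule that)
qed

lemma sfun_has_derivative:
  "(sfun u has_derivative frechet_derivative (sfun u) (at x)) (at x)"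
proof -
  have "smooth (sfun u)" using sfun[of u] by (auto simp: schwartz_fun_def)
  from smoothD[OF this, of "[]" x] show ?thesis using frechet_derivative_works by auto
qed

lemma sfun_partial: "sfun (partial i u) x = frechet_derivative (sfun u) (at x) (axis i 1)"
  by (simp add: partial.rep_eq pd_def)

lemma continuous_sfun: "continuous_on A (sfun u)"
  by (intro continuous_at_imp_continuous_on ballI has_derivative_continuous[OF sfun_has_derivative])

lemma borel_measurable_sfun [measurable]: "sfun u \<in> borel_measurable borel"
  using continuous_sfun borel_measurable_continuous_onI by blast

text \<open>The weight \<open>1 / (1 + \<bar>x\<bar>\<^sup>4)\<close> is integrable over the plane, being at most twice the product of the
  one-dimensional weights \<open>1 / (1 + t\<^sup>2)\<close>.\<close>

lemma integrable_decay:
  fixes F :: "real^2 \<Rightarrow> 'b::{banach,second_countable_topology}"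
  assumes [measurable]: "F \<in> borel_measurable borel" and b: "\<And>x. norm (F x) * (1 + norm x ^ 4) \<le> B"
  shows "integrable lborel F"
proof -
  define G where "G x = (\<Prod>b\<in>Basis. inverse (1 + (x \<bullet> b)^2))" for x :: "real^2"
  have one: "(\<integral>\<^sup>+x. ennreal (inverse (1 + x^2)) \<partial>lborel) < \<infinity>"
  proof -
    have "integrable lborel (\<lambda>x::real. inverse (1 + x^2))"
      using integrable_inverse_1_plus_square by (simp add: set_integrable_def)
    then show ?thesis by (simp add: integrable_iff_bounded)
  qed
  have G: "integrable lborel G"
  proof (rule integrableI_bounded)
    show "G \<in> borel_measurable lborel" unfolding G_def by measurable
    have "(\<integral>\<^sup>+x. ennreal (norm (G x)) \<partial>lborel) = (\<integral>\<^sup>+x. (\<Prod>b\<in>Basis. ennreal (inverse (1 + ((x::real^2) \<bullet> b)^2))) \<partial>lborel)"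
      unfolding G_def by (intro nn_integral_cong) (simp add: prod_ennreal abs_prod prod_nonneg)
    also have "\<dots> = (\<Prod>b\<in>(Basis :: (real^2) set). (\<integral>\<^sup>+x. ennreal (inverse (1 + x^2)) \<partial>lborel))"
      by (rule nn_integral_lborel_prod) auto
    also have "\<dots> < \<infinity>" using one by (simp add: power_less_top_ennreal)
    finally show "(\<integral>\<^sup>+x. ennreal (norm (G x)) \<partial>lborel) < \<infinity>" .
  qed
  have Gb: "1 \<le> 2 * G x * (1 + norm x ^ 4)" for x
  proof -
    have sq: "(x \<bullet> b)^2 \<le> norm x ^ 2" if "b \<in> Basis" for b
      using Basis_le_norm[OF that, of x] by (simp add: abs_le_square_iff[symmetric])
    have "(\<Prod>b\<in>(Basis :: (real^2) set). (1 + (x \<bullet> b)^2)) \<le> (\<Prod>b\<in>(Basis :: (real^2) set). (1 + norm x^2))"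
      by (rule prod_mono) (use sq in auto)
    also have "\<dots> = (1 + norm x^2)^2" by simp
    also have "\<dots> \<le> 2 * (1 + norm x ^ 4)"
      using sum_squares_ge_zero[of "1 - norm x^2" 0] by (simp add: power2_eq_square power4_eq_xxxx algebra_simps)
    finally have le: "(\<Prod>b\<in>(Basis :: (real^2) set). (1 + (x \<bullet> b)^2)) \<le> 2 * (1 + norm x ^ 4)" .
    have pos: "0 < (\<Prod>b\<in>(Basis :: (real^2) set). (1 + (x \<bullet> b)^2))"
      by (rule prod_pos) (simp add: add_pos_nonneg)
    have "G x = 1 / (\<Prod>b\<in>(Basis :: (real^2) set). (1 + (x \<bullet> b)^2))"
      by (simp add: G_def prod_dividef inverse_eq_divide)
    with le pos show ?thesis by (simp add: field_simps)
  qed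
  have Gpos: "0 \<le> G x" for x unfolding G_def by (rule prod_nonneg) auto
  show ?thesis
  proof (rule Bochner_Integration.integrable_bound)
    show "integrable lborel (\<lambda>x. B * 2 * G x)" using G by simp
    show "AE x in lborel. norm (F x) \<le> norm (B * 2 * G x)"
    proof (rule AE_I2)
      fix x
      have "norm (F x) * 1 \<le> norm (F x) * (2 * G x * (1 + norm x ^ 4))"
        using Gb[of x] by (intro mult_left_mono) auto
      also have "\<dots> = (norm (F x) * (1 + norm x ^ 4)) * (2 * G x)" by simp
      also have "\<dots> \<le> B * (2 * G x)" using b[of x] Gpos[of x] by (intro mult_right_mono) auto
      finally show "norm (F x) \<le> norm (B * 2 * G x)" by simp
    qed
  qed simp
qed

lemma integrable_sfun: "integrable lborel (sfun u)"
proof -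
  obtain B where B: "\<And>x. \<bar>sfun u x\<bar> * (1 + norm x ^ 4) \<le> B" using sfun_bounds[of u] by blast
  show ?thesis by (rule integrable_decay[of _ B]) (use B in auto)
qed

lemma sfun_mult_decay:
  obtains B where "\<And>x. \<bar>sfun u x * sfun v x\<bar> * (1 + norm x ^ 4) \<le> B"
proof -
  obtain B where B: "0 \<le> B" "\<And>x. \<bar>sfun u x\<bar> * (1 + norm x ^ 4) \<le> B" using sfun_bounds[of u] by blast
  obtain C where C: "0 \<le> C" "\<And>x. \<bar>sfun v x\<bar> \<le> C" using sfun_bounded[of v] by blast
  have "\<bar>sfun u x * sfun v x\<bar> * (1 + norm x ^ 4) \<le> C * B" for x
  proof -
    have "\<bar>sfun u x * sfun v x\<bar> * (1 + norm x ^ 4) = \<bar>sfun v x\<bar> * (\<bar>sfun u x\<bar> * (1 + norm x ^ 4))"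
      by (simp add: abs_mult)
    also have "\<dots> \<le> C * B" by (intro mult_mono B C) auto
    finally show ?thesis .
  qed
  then show ?thesis using that by blast
qed

lemma integrable_sfun_mult: "integrable lborel (\<lambda>x. sfun u x * sfun v x)"
proof -
  obtain B where "\<And>x. \<bar>sfun u x * sfun v x\<bar> * (1 + norm x ^ 4) \<le> B" using sfun_mult_decay by blast
  then show ?thesis by (intro integrable_decay[of _ B]) auto
qed

lemma
  fixes F :: "'a::euclidean_space \<Rightarrow> 'b::{banach,second_countable_topology}"
  shows lborel_integrable_translation_iff: "integrable lborel (\<lambda>x. F (x + a)) \<longleftrightarrow> integrable lborel F"
    and lborel_integral_translation: "(\<integral>x. F (x + a) \<partial>lborel) = (\<integral>x. F x \<partial>lborel)"
proof -
  have *: "(\<lambda>x. F (x + a)) \<in> borel_measurable borel \<longleftrightarrow> F \<in> borel_measurable borel"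
  proof
    assume [measurable]: "(\<lambda>x. F (x + a)) \<in> borel_measurable borel"
    have "(\<lambda>x. F ((x - a) + a)) \<in> borel_measurable borel" by measurable
    then show "F \<in> borel_measurable borel" by simp
  qed simp
  have eq: "distr lborel borel (\<lambda>x. x + a) = lborel"
    using lborel_distr_plus[of a] by (metis (no_types, lifting) ext add.commute)
  show "integrable lborel (\<lambda>x. F (x + a)) \<longleftrightarrow> integrable lborel F"
  proof (cases "F \<in> borel_measurable borel")
    case True
    then show ?thesis using integrable_distr_eq[of "\<lambda>x. x + a" lborel borel F] eq by simp
  next
    case False
    then show ?thesis using * borel_measurable_integrable by (metis measurable_lborel2)
  qed
  show "(\<integral>x. F (x + a) \<partial>lborel) = (\<integral>x. F x \<partial>lborel)"
  proof (cases "F \<in> borel_measurable borel")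
    case True
    then show ?thesis using integral_distr[of "\<lambda>x. x + a" lborel borel F] eq by simp
  next
    case False
    then show ?thesis using * borel_measurable_integrable
      by (metis measurable_lborel2 not_integrable_integral_eq)
  qed
qed

text \<open>Difference quotients integrate to zero because Lebesgue measure is translation invariant, and the
  mean value theorem bounds them by a multiple of the decay weight, so that they may be replaced by
  their limit.\<close>

lemma integral_directional_derivative:
  fixes F :: "real^2 \<Rightarrow> real"
  assumes D: "\<And>x. (F has_derivative F' x) (at x)" and F: "integrable lborel F"
    and b: "\<And>x. \<bar>F' x e\<bar> * (1 + norm x ^ 4) \<le> C" and e: "norm e \<le> 1"
  shows "(\<integral>x. F' x e \<partial>lborel) = 0"
proof -
  define t where "t k = 1 / real (Suc k)" for k
  have t: "0 < t k" "t k \<le> 1" for k by (auto simp: t_def)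
  have t0: "t \<longlonglongrightarrow> 0" unfolding t_def using LIMSEQ_inverse_real_of_nat by (simp add: inverse_eq_divide)
  have cont: "continuous_on UNIV F"
    by (intro continuous_at_imp_continuous_on ballI has_derivative_continuous[OF D])
  have [measurable]: "F \<in> borel_measurable borel" using cont borel_measurable_continuous_onI by blast
  have path: "((\<lambda>s. F (x + s *\<^sub>R e)) has_derivative (\<lambda>r. r * F' (x + s *\<^sub>R e) e)) (at s within S)" for x s S
  proof -
    have "((\<lambda>s. x + s *\<^sub>R e) has_derivative (\<lambda>r. r *\<^sub>R e)) (at s within S)"
      by (auto intro!: derivative_eq_intros)
    from has_derivative_compose[OF this D]
    have "((\<lambda>s. F (x + s *\<^sub>R e)) has_derivative (\<lambda>r. F' (x + s *\<^sub>R e) (r *\<^sub>R e))) (at s within S)" .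
    moreover have "F' (x + s *\<^sub>R e) (r *\<^sub>R e) = r * F' (x + s *\<^sub>R e) e" for r
      using linear_scale[OF has_derivative_linear[OF D], of "x + s *\<^sub>R e" r e] by simp
    ultimately show ?thesis by simp
  qed
  let ?Q = "\<lambda>k x. (F (x + t k *\<^sub>R e) - F x) / t k"
  have lim: "(\<lambda>k. ?Q k x) \<longlonglongrightarrow> F' x e" for x
  proof -
    have "((\<lambda>s. F (x + s *\<^sub>R e)) has_real_derivative F' x e) (at 0)"
      using path[of x 0 UNIV] by (simp add: has_field_derivative_def mult.commute[of _ "F' x e"])
    then have "((\<lambda>s. (F (x + s *\<^sub>R e) - F x) / s) \<longlongrightarrow> F' x e) (at 0)"
      by (simp add: DERIV_def)
    moreover have "filterlim t (at 0) sequentially"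
      using t0 t(1) by (auto simp: filterlim_at intro!: always_eventually less_imp_neq[symmetric])
    ultimately show ?thesis by (rule filterlim_compose)
  qed
  have meas [measurable]: "(\<lambda>x. F' x e) \<in> borel_measurable borel"
    by (rule borel_measurable_LIMSEQ_real[OF lim]) auto
  have bound: "\<bar>?Q k x\<bar> * (1 + norm x ^ 4) \<le> 9 * C" for k x
  proof -
    have "continuous_on {0..t k} (\<lambda>s. F (x + s *\<^sub>R e))"
      by (intro continuous_on_compose2[OF cont] continuous_intros) auto
    then obtain s where s: "0 < s" "s < t k" and eq: "F (x + t k *\<^sub>R e) - F x = t k * F' (x + s *\<^sub>R e) e"
      using mvt[OF t(1)[of k], of "\<lambda>s. F (x + s *\<^sub>R e)" "\<lambda>s r. r * F' (x + s *\<^sub>R e) e"] path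
      by (auto simp: algebra_simps)
    let ?y = "x + s *\<^sub>R e"
    \<comment> \<open>Moving the base point by at most one costs a factor 9 in the weight.\<close>
    have "norm x \<le> norm ?y + norm (s *\<^sub>R e)" using norm_triangle_ineq4[of ?y "s *\<^sub>R e"] by simp
    also have "norm (s *\<^sub>R e) \<le> 1" using s t(2)[of k] e by (simp add: mult_le_one)
    finally have "norm x ^ 4 \<le> (norm ?y + 1) ^ 4" by (intro power_mono) auto
    also have "\<dots> \<le> 8 * (norm ?y ^ 4 + 1)"
    proof -
      let ?a = "norm ?y"
      have "(?a + 1)^2 \<le> 2 * (?a^2 + 1)" using zero_le_power2[of "?a - 1"] by (simp add: power2_eq_square algebra_simps)
      then have "((?a + 1)^2)^2 \<le> (2 * (?a^2 + 1))^2" by (intro power_mono) auto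
      also have "\<dots> \<le> 8 * (?a^4 + 1)"
        using zero_le_power2[of "?a^2 - 1"] by (simp add: power2_eq_square power4_eq_xxxx algebra_simps)
      finally show ?thesis by simp
    qed
    finally have "1 + norm x ^ 4 \<le> 9 * (1 + norm ?y ^ 4)" using zero_le_power[of "norm ?y" 4] by (smt (verit) norm_ge_zero)
    then have "\<bar>F' ?y e\<bar> * (1 + norm x ^ 4) \<le> \<bar>F' ?y e\<bar> * (9 * (1 + norm ?y ^ 4))"
      by (intro mult_left_mono) auto
    also have "\<dots> \<le> 9 * C" using b[of ?y] by (simp only: mult.left_commute[of _ 9])
    finally show ?thesis unfolding eq using t(1)[of k] by simp
  qed
  let ?W = "\<lambda>x::real^2. 9 * C / (1 + norm x ^ 4)"
  have pos: "0 < 1 + norm x ^ 4" for x :: "real^2" by (simp add: add_pos_nonneg)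
  have C: "0 \<le> C" using b[of 0] by (smt (verit) mult_nonneg_nonneg abs_ge_zero norm_ge_zero zero_le_power)
  have "(\<lambda>k. \<integral>x. ?Q k x \<partial>lborel) \<longlonglongrightarrow> (\<integral>x. F' x e \<partial>lborel)"
  proof (rule integral_dominated_convergence[of _ _ _ ?W])
    show "integrable lborel ?W"
    proof (rule integrable_decay)
      show "norm (?W x) * (1 + norm x ^ 4) \<le> 9 * C" for x
      proof -
        have "norm (?W x) = 9 * C / (1 + norm x ^ 4)"
          using C less_imp_le[OF pos[of x]] by (simp only: real_norm_def) (rule abs_of_nonneg, simp)
        also have "\<dots> * (1 + norm x ^ 4) = 9 * C"
          using pos[of x] by (simp only: times_divide_eq_left nonzero_mult_div_cancel_right less_imp_neq[symmetric] not_False_eq_True)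
        finally show ?thesis by simp
      qed
    qed measurable
    show "AE x in lborel. norm (?Q k x) \<le> ?W x" for k
      using bound[of _ k] pos by (intro AE_I2) (simp add: pos_le_divide_eq del: abs_divide)
  qed (use lim in auto)
  moreover have "(\<integral>x. ?Q k x \<partial>lborel) = 0" for k
  proof -
    have "integrable lborel (\<lambda>x. F (x + t k *\<^sub>R e))"
      "(\<integral>x. F (x + t k *\<^sub>R e) \<partial>lborel) = (\<integral>x. F x \<partial>lborel)"
      using F by (simp_all add: lborel_integrable_translation_iff lborel_integral_translation)
    then show ?thesis using F by simp
  qed
  ultimately show ?thesis by (simp only: LIMSEQ_const_iff)
qed

lemma integrable_sfun_sq: "integrable lborel (\<lambda>x. (sfun u x)\<^sup>2)"
  unfolding power2_eq_square by (rule integrable_sfun_mult)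

lemma integral_partial_by_parts:
  "(\<integral>x. sfun v x * sfun (partial i (partial i v)) x \<partial>lborel) = - (\<integral>x. (sfun (partial i v) x)\<^sup>2 \<partial>lborel)"
proof -
  let ?w = "partial i v" and ?e = "axis i (1::real)"
  let ?D = "\<lambda>x. \<lambda>h. sfun v x * frechet_derivative (sfun ?w) (at x) h + frechet_derivative (sfun v) (at x) h * sfun ?w x"
  have D: "((\<lambda>x. sfun v x * sfun ?w x) has_derivative ?D x) (at x)" for x
    by (rule has_derivative_mult[OF sfun_has_derivative sfun_has_derivative])
  have De: "?D x ?e = sfun v x * sfun (partial i ?w) x + sfun ?w x * sfun ?w x" for x
    by (simp add: sfun_partial)
  obtain B where B: "\<And>x. \<bar>sfun v x * sfun (partial i ?w) x\<bar> * (1 + norm x ^ 4) \<le> B" using sfun_mult_decay by blast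
  obtain C where C: "\<And>x. \<bar>sfun ?w x * sfun ?w x\<bar> * (1 + norm x ^ 4) \<le> C" using sfun_mult_decay by blast
  have "(\<integral>x. ?D x ?e \<partial>lborel) = 0"
  proof (rule integral_directional_derivative[OF D integrable_sfun_mult])
    show "\<bar>?D x ?e\<bar> * (1 + norm x ^ 4) \<le> B + C" for x
    proof -
      have "\<bar>?D x ?e\<bar> * (1 + norm x ^ 4) \<le>
          (\<bar>sfun v x * sfun (partial i ?w) x\<bar> + \<bar>sfun ?w x * sfun ?w x\<bar>) * (1 + norm x ^ 4)"
        unfolding De by (intro mult_right_mono abs_triangle_ineq) auto
      also have "\<dots> \<le> B + C" using B[of x] C[of x] by (simp add: distrib_right)
      finally show ?thesis .
    qed
  qed simp
  then show ?thesis
    by (simp add: De integrable_sfun_mult power2_eq_square)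
qed

lemma sfun_uminus: "sfun (- u) x = - sfun u x"
  unfolding uminus_schwartz_def scaleR_schwartz.rep_eq by simp

lemma sfun_diff: "sfun (u - v) x = sfun u x - sfun v x"
  unfolding minus_schwartz_def plus_schwartz.rep_eq sfun_uminus by simp

lemma sfun_helmholtz:
  "sfun (helmholtz v) x = sfun v x - sfun (partial 1 (partial 1 v)) x - sfun (partial 2 (partial 2 v)) x"
  by (simp add: helmholtz_def plus_schwartz.rep_eq sfun_uminus sfun_diff)

text \<open>Integration by parts turns the right-hand side into the square of the first order Sobolev norm,
  of which only the term without derivatives is kept.\<close>

lemma helmholtz_coercive:
  "(\<integral>x. (sfun v x)\<^sup>2 \<partial>lborel) \<le> (\<integral>x. sfun (helmholtz v) x * sfun v x \<partial>lborel)"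
proof -
  have "(\<integral>x. sfun (helmholtz v) x * sfun v x \<partial>lborel) =
      (\<integral>x. (sfun v x)\<^sup>2 \<partial>lborel) + (\<integral>x. (sfun (partial 1 v) x)\<^sup>2 \<partial>lborel)
        + (\<integral>x. (sfun (partial 2 v) x)\<^sup>2 \<partial>lborel)"
  proof -
    have "sfun (helmholtz v) x * sfun v x = (sfun v x)\<^sup>2
        - sfun v x * sfun (partial 1 (partial 1 v)) x - sfun v x * sfun (partial 2 (partial 2 v)) x" for x
      by (simp add: sfun_helmholtz power2_eq_square left_diff_distrib)
    then show ?thesis
      using integral_partial_by_parts[of v 1] integral_partial_by_parts[of v 2]
      by (simp add: integrable_sfun_mult integrable_sfun_sq)
  qed
  also have "\<dots> \<ge> (\<integral>x. (sfun v x)\<^sup>2 \<partial>lborel)" by (simp add: add_nonneg_nonneg)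
  finally show ?thesis .
qed

lemma helmholtz_scaleR: "helmholtz (c *\<^sub>R v) = c *\<^sub>R helmholtz v"
  and helmholtz_diff: "helmholtz (v - w) = helmholtz v - helmholtz w"
proof -
  have lin: "partial i (a *\<^sub>R u + u') = a *\<^sub>R partial i u + partial i u'" for i a u u'
  proof -
    have "smooth (sfun u)" "smooth (sfun u')" using sfun[of u] sfun[of u'] by (auto simp: schwartz_fun_def)
    then have "pds [i] (\<lambda>x. a * sfun u x + sfun u' x) = (\<lambda>x. a * pds [i] (sfun u) x + pds [i] (sfun u') x)"
      by (simp only: pds_add pds_cmult smooth_cmult)
    then show ?thesis
      by (simp add: sfun_inject[symmetric] partial.rep_eq plus_schwartz.rep_eq scaleR_schwartz.rep_eq)
  qed
  have z: "partial i 0 = 0" for i using lin[of i 0 0 0] lin[of i 1 0 0] by simp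
  have s: "partial i (a *\<^sub>R u) = a *\<^sub>R partial i u" for i a u using lin[of i a u 0] z by simp
  have d: "partial i (u - u') = partial i u - partial i u'" for i u u'
    using lin[of i "-1" u' u] by simp
  show "helmholtz (c *\<^sub>R v) = c *\<^sub>R helmholtz v" by (simp add: helmholtz_def s algebra_simps)
  show "helmholtz (v - w) = helmholtz v - helmholtz w" by (simp add: helmholtz_def d)
qed

lemma continuous_integral_zero_imp_zero:
  fixes F :: "'a::euclidean_space \<Rightarrow> real"
  assumes "continuous_on UNIV F" "integrable lborel F" "\<And>x. 0 \<le> F x" "(\<integral>x. F x \<partial>lborel) = 0"
  shows "F x = 0"
proof -
  have "AE x in lborel. F x = 0"
    using integral_nonneg_eq_0_iff_AE[OF assms(2)] assms by auto
  then have "{x. F x \<noteq> 0} \<in> null_sets lebesgue"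
    unfolding eventually_ae_filter
    by (auto intro: null_sets_completion_subset null_sets_completionI)
  then have "negligible {x. F x \<noteq> 0}" by (simp add: negligible_iff_null_sets)
  moreover have "open {x. F x \<noteq> 0}" using assms(1) by (intro open_Collect_neq) auto
  ultimately show ?thesis using open_not_negligible by blast
qed

lemma inj_helmholtz: "inj helmholtz"
proof (rule injI)
  fix v w assume "helmholtz v = helmholtz w"
  then have "helmholtz (v - w) = 0" by (simp add: helmholtz_diff)
  then have "(\<integral>x. (sfun (v - w) x)\<^sup>2 \<partial>lborel) \<le> 0"
    using helmholtz_coercive[of "v - w"] by (simp add: zero_schwartz.rep_eq)
  moreover have "0 \<le> (\<integral>x. (sfun (v - w) x)\<^sup>2 \<partial>lborel)" by simp
  ultimately have "(\<integral>x. (sfun (v - w) x)\<^sup>2 \<partial>lborel) = 0" by linarith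
  then have "(sfun (v - w) x)\<^sup>2 = 0" for x
    by (intro continuous_integral_zero_imp_zero[where F = "\<lambda>x. (sfun (v - w) x)\<^sup>2"])
      (auto intro!: continuous_intros continuous_sfun simp: power2_eq_square integrable_sfun_mult)
  then have "v - w = 0" by (simp add: sfun_inject[symmetric] zero_schwartz.rep_eq fun_eq_iff)
  then show "v = w" by simp
qed

lemma cov_helmholtz: "cov (helmholtz v) (helmholtz v) = (\<integral>x. sfun (helmholtz v) x * sfun v x \<partial>lborel)"
  by (simp add: cov_def inj_helmholtz)

lemma cov_scaleR_range: "f \<in> range helmholtz \<Longrightarrow> cov (c *\<^sub>R f) (c *\<^sub>R f) = c\<^sup>2 * cov f f"
proof (elim rangeE)
  fix v assume f: "f = helmholtz v"
  have "cov (c *\<^sub>R f) (c *\<^sub>R f) = (\<integral>x. c\<^sup>2 * (sfun f x * sfun v x) \<partial>lborel)"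
    unfolding f helmholtz_scaleR[symmetric] cov_helmholtz
    by (simp add: helmholtz_scaleR scaleR_schwartz.rep_eq power2_eq_square mult_ac)
  then show "cov (c *\<^sub>R f) (c *\<^sub>R f) = c\<^sup>2 * cov f f" by (simp add: f cov_helmholtz)
qed

text \<open>For \<open>f = (-\<Delta> + 1) v\<close> integrate \<open>2 f v \<le> f\<^sup>2 + v\<^sup>2\<close>; the integral of \<open>v\<^sup>2\<close> is absorbed by coercivity.\<close>

lemma cov_le_L2_range:
  assumes "f \<in> range helmholtz"
  shows "cov f f \<le> (\<integral>x. (sfun f x)\<^sup>2 \<partial>lborel)"
proof -
  from assms obtain v where f: "f = helmholtz v" by blast
  have "2 * cov f f = (\<integral>x. 2 * (sfun f x * sfun v x) \<partial>lborel)" by (simp add: f cov_helmholtz)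
  also have "\<dots> \<le> (\<integral>x. (sfun f x)\<^sup>2 + (sfun v x)\<^sup>2 \<partial>lborel)"
    by (rule integral_mono)
      (use sum_squares_bound in \<open>auto simp: power2_eq_square integrable_sfun_mult mult.assoc\<close>)
  also have "\<dots> = (\<integral>x. (sfun f x)\<^sup>2 \<partial>lborel) + (\<integral>x. (sfun v x)\<^sup>2 \<partial>lborel)"
    by (simp add: power2_eq_square integrable_sfun_mult)
  also have "(\<integral>x. (sfun v x)\<^sup>2 \<partial>lborel) \<le> cov f f"
    using helmholtz_coercive[of v] by (simp add: f cov_helmholtz)
  finally show ?thesis by simp
qed

text \<open>The inverse is a choice from the preimage, and the choice from an empty preimage is always the same.\<close>

lemma inv_helmholtz_off_range:
  "f \<notin> range helmholtz \<Longrightarrow> inv helmholtz f = (SOME v. False)"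
  unfolding inv_into_def by (rule arg_cong[where f = Eps]) auto

lemma cov_scaleR_off_range:
  assumes f: "f \<notin> range helmholtz" and c: "c \<noteq> 0"
  shows "cov (c *\<^sub>R f) (c *\<^sub>R f) = c * cov f f"
proof -
  have "c *\<^sub>R f \<notin> range helmholtz"
  proof
    assume "c *\<^sub>R f \<in> range helmholtz"
    then obtain v where "c *\<^sub>R f = helmholtz v" by blast
    then have "f = helmholtz (inverse c *\<^sub>R v)" using c by (metis helmholtz_scaleR scaleR_scaleR scaleR_one left_inverse)
    with f show False by blast
  qed
  with f show ?thesis
    by (simp add: cov_def inv_helmholtz_off_range scaleR_schwartz.rep_eq mult.assoc)
qed

section \<open>Evaluations are Gaussian\<close>

locale gaussian_field_measure =
  fixes \<mu> :: "(schwartz \<Rightarrow> real) measure"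
  assumes gaussian: "gaussian_field \<mu>"
begin

lemma prob_space_mu: "prob_space \<mu>"
  using gaussian by (simp add: gaussian_field_def)

sublocale prob_space \<mu>
  by (rule prob_space_mu)

lemma sets_mu: "sets \<mu> = sets tempered_algebra"
  using gaussian by (simp add: gaussian_field_def)

lemma sets_mu_generated:
  "sets \<mu> = sigma_sets tempered {{\<phi> \<in> tempered. \<phi> f \<in> B} |f B. B \<in> sets borel}"
  unfolding sets_mu tempered_algebra_def by (rule sets_measure_of) auto

lemma space_mu: "space \<mu> = tempered"
proof -
  have "space \<mu> = space tempered_algebra" by (rule sets_eq_imp_space_eq[OF sets_mu])
  then show ?thesis unfolding tempered_algebra_def by (subst (asm) space_measure_of) auto
qed

lemma linear_mu: "\<phi> \<in> space \<mu> \<Longrightarrow> linear \<phi>"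
  by (simp add: space_mu tempered_def)

lemma measurable_evaluation [measurable]: "(\<lambda>\<phi>. \<phi> f) \<in> borel_measurable \<mu>"
proof (rule measurableI)
  fix B :: "real set" assume "B \<in> sets borel"
  then have "{\<phi> \<in> tempered. \<phi> f \<in> B} \<in> sets \<mu>" unfolding sets_mu_generated by (intro sigma_sets.Basic) blast
  moreover have "(\<lambda>\<phi>. \<phi> f) -` B \<inter> space \<mu> = {\<phi> \<in> tempered. \<phi> f \<in> B}" by (auto simp: space_mu)
  ultimately show "(\<lambda>\<phi>. \<phi> f) -` B \<inter> space \<mu> \<in> sets \<mu>" by simp
qed simp

lemma characteristic_function:
  "(CLINT \<phi>|\<mu>. iexp (\<phi> f)) = complex_of_real (exp (- cov f f / 2))"
  using gaussian by (simp add: gaussian_field_def)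

text \<open>A characteristic function is bounded by one.\<close>

lemma cov_nonneg: "0 \<le> cov f f"
proof -
  have "norm (CLINT \<phi>|\<mu>. iexp (\<phi> f)) \<le> (\<integral>\<phi>. norm (iexp (\<phi> f)) \<partial>\<mu>)"
    by (rule integral_norm_bound)
  also have "\<dots> = 1" by (simp add: prob_space)
  finally have "exp (- cov f f / 2) \<le> 1" unfolding characteristic_function by simp
  then show ?thesis by simp
qed

text \<open>Replacing \<open>f\<close> by \<open>- f\<close> reverses the sign of the covariance, but neither sign can be negative.\<close>

lemma cov_off_range: "f \<notin> range helmholtz \<Longrightarrow> cov f f = 0"
  using cov_scaleR_off_range[of f "-1"] cov_nonneg[of f] cov_nonneg[of "-1 *\<^sub>R f"] by simp

lemma cov_scaleR: "cov (c *\<^sub>R f) (c *\<^sub>R f) = c\<^sup>2 * cov f f"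
proof (cases "f \<in> range helmholtz")
  case True
  then show ?thesis by (rule cov_scaleR_range)
next
  case False
  show ?thesis
  proof (cases "c = 0")
    case True
    then show ?thesis by (simp add: cov_def zero_schwartz.rep_eq)
  next
    case c: False
    then show ?thesis using cov_scaleR_off_range[OF False c] cov_off_range[OF False] by simp
  qed
qed

lemma cov_le_L2: "cov f f \<le> (\<integral>x. (sfun f x)\<^sup>2 \<partial>lborel)"
  by (cases "f \<in> range helmholtz") (simp_all add: cov_le_L2_range cov_off_range)

text \<open>The characterisation of the Gaussian measure gives the characteristic function of \<open>\<phi>(f)\<close> at the
  argument \<open>1\<close> only; at \<open>t\<close> it is obtained from \<open>t f\<close> and the quadratic scaling of the covariance. Using
  a multiple of a standard normal variable includes the degenerate case of variance zero.\<close>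

lemma distr_evaluation:
  "distr \<mu> borel (\<lambda>\<phi>. \<phi> f) = distr std_normal_distribution borel (\<lambda>x. sqrt (cov f f) * x)"
proof (rule Levy_uniqueness)
  interpret N: real_distribution std_normal_distribution by (rule real_dist_normal_dist)
  show "real_distribution (distr \<mu> borel (\<lambda>\<phi>. \<phi> f))" by (intro real_distribution_distr) simp
  show "real_distribution (distr std_normal_distribution borel (\<lambda>x. sqrt (cov f f) * x))"
    by (intro N.real_distribution_distr) simp
  show "char (distr \<mu> borel (\<lambda>\<phi>. \<phi> f)) = char (distr std_normal_distribution borel (\<lambda>x. sqrt (cov f f) * x))"
  proof
    fix t
    have "char (distr \<mu> borel (\<lambda>\<phi>. \<phi> f)) t = (CLINT \<phi>|\<mu>. iexp (t * \<phi> f))"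
      unfolding char_def by (subst integral_distr) auto
    also have "\<dots> = (CLINT \<phi>|\<mu>. iexp (\<phi> (t *\<^sub>R f)))"
      by (rule Bochner_Integration.integral_cong) (auto simp: linear_scale[OF linear_mu])
    also have "\<dots> = complex_of_real (exp (- (t * sqrt (cov f f))\<^sup>2 / 2))"
      by (simp add: characteristic_function cov_scaleR power_mult_distrib cov_nonneg)
    also have "\<dots> = char std_normal_distribution (t * sqrt (cov f f))"
      by (simp add: char_std_normal_distribution exp_of_real)
    also have "\<dots> = char (distr std_normal_distribution borel (\<lambda>x. sqrt (cov f f) * x)) t"
      unfolding char_def by (subst integral_distr) (auto simp: mult.assoc)
    finally show "char (distr \<mu> borel (\<lambda>\<phi>. \<phi> f)) t =
      char (distr std_normal_distribution borel (\<lambda>x. sqrt (cov f f) * x)) t" .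
  qed
qed

lemma
  fixes F :: "real \<Rightarrow> real"
  assumes [measurable]: "F \<in> borel_measurable borel"
  shows integrable_evaluation: "integrable \<mu> (\<lambda>\<phi>. F (\<phi> f)) \<longleftrightarrow>
      integrable lborel (\<lambda>x. std_normal_density x * F (sqrt (cov f f) * x))"
    and integral_evaluation: "(\<integral>\<phi>. F (\<phi> f) \<partial>\<mu>) =
      (\<integral>x. std_normal_density x * F (sqrt (cov f f) * x) \<partial>lborel)"
proof -
  have "integrable \<mu> (\<lambda>\<phi>. F (\<phi> f)) \<longleftrightarrow> integrable (distr \<mu> borel (\<lambda>\<phi>. \<phi> f)) F"
    by (subst integrable_distr_eq) auto
  also have "\<dots> \<longleftrightarrow> integrable std_normal_distribution (\<lambda>x. F (sqrt (cov f f) * x))"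
    unfolding distr_evaluation by (subst integrable_distr_eq) auto
  also have "\<dots> \<longleftrightarrow> integrable lborel (\<lambda>x. std_normal_density x * F (sqrt (cov f f) * x))"
    by (subst integrable_density) auto
  finally show "integrable \<mu> (\<lambda>\<phi>. F (\<phi> f)) \<longleftrightarrow>
      integrable lborel (\<lambda>x. std_normal_density x * F (sqrt (cov f f) * x))" .
  have "(\<integral>\<phi>. F (\<phi> f) \<partial>\<mu>) = (\<integral>x. F x \<partial>distr \<mu> borel (\<lambda>\<phi>. \<phi> f))"
    by (subst integral_distr) auto
  also have "\<dots> = (\<integral>x. F (sqrt (cov f f) * x) \<partial>std_normal_distribution)"
    unfolding distr_evaluation by (subst integral_distr) auto
  also have "\<dots> = (\<integral>x. std_normal_density x * F (sqrt (cov f f) * x) \<partial>lborel)"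
    by (subst integral_density) auto
  finally show "(\<integral>\<phi>. F (\<phi> f) \<partial>\<mu>) =
      (\<integral>x. std_normal_density x * F (sqrt (cov f f) * x) \<partial>lborel)" .
qed

lemma
  shows integrable_evaluation_sq: "integrable \<mu> (\<lambda>\<phi>. (\<phi> f)\<^sup>2)"
    and integral_evaluation_sq: "(\<integral>\<phi>. (\<phi> f)\<^sup>2 \<partial>\<mu>) = cov f f"
proof -
  have "(\<lambda>x. std_normal_density x * (sqrt (cov f f) * x)\<^sup>2) = (\<lambda>x. cov f f * (std_normal_density x * x^2))"
    by (simp add: power_mult_distrib cov_nonneg mult_ac)
  moreover have "integrable lborel (\<lambda>x. std_normal_density x * x^2)"
    by (rule integrable_std_normal_moment)
  moreover have "(\<integral>x. std_normal_density x * x^2 \<partial>lborel) = 1"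
    using integral_std_normal_moment_even[of 1] by simp
  ultimately show "integrable \<mu> (\<lambda>\<phi>. (\<phi> f)\<^sup>2)" "(\<integral>\<phi>. (\<phi> f)\<^sup>2 \<partial>\<mu>) = cov f f"
    by (simp_all add: integrable_evaluation[of "\<lambda>x. x\<^sup>2"] integral_evaluation[of "\<lambda>x. x\<^sup>2"])
qed

text \<open>Completing the square makes the integrand a multiple of a shifted normal density.\<close>

lemma
  shows integrable_exp_evaluation: "integrable \<mu> (\<lambda>\<phi>. exp (\<phi> f))"
    and integral_exp_evaluation: "(\<integral>\<phi>. exp (\<phi> f) \<partial>\<mu>) = exp (cov f f / 2)"
proof -
  let ?s = "sqrt (cov f f)"
  have eq: "std_normal_density x * exp (?s * x) = exp (cov f f / 2) * normal_density ?s 1 x" for x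
  proof -
    have "- x\<^sup>2 / 2 + ?s * x = cov f f / 2 - (x - ?s)\<^sup>2 / 2"
      using cov_nonneg[of f] by (simp add: power2_diff field_simps)
    then show ?thesis
      by (simp add: normal_density_def std_normal_density_def exp_add[symmetric] mult.left_commute)
  qed
  show "integrable \<mu> (\<lambda>\<phi>. exp (\<phi> f))"
    by (subst integrable_evaluation) (simp_all add: eq)
  show "(\<integral>\<phi>. exp (\<phi> f) \<partial>\<mu>) = exp (cov f f / 2)"
    by (subst integral_evaluation) (simp_all add: eq integral_normal_density)
qed

end

section \<open>Fourier transform and Plancherel's identity\<close>

lemma cis_measurable [measurable]: "cis \<in> borel_measurable borel"
  unfolding cis_conv_exp[abs_def] by (intro borel_measurable_continuous_onI continuous_intros)

lemma cnj_measurable [measurable]: "cnj \<in> borel_measurable borel"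
  by (intro borel_measurable_continuous_onI continuous_intros)

lemma
  fixes f :: "'a::euclidean_space \<Rightarrow> real \<Rightarrow> 'b::{real_normed_field,banach,second_countable_topology}"
  assumes f: "\<And>b. b \<in> Basis \<Longrightarrow> integrable lborel (f b)"
  shows lborel_integrable_prod: "integrable lborel (\<lambda>x. \<Prod>b\<in>Basis. f b (x \<bullet> b))"
    and lborel_integral_prod: "(\<integral>x. (\<Prod>b\<in>Basis. f b (x \<bullet> b)) \<partial>lborel) = (\<Prod>b\<in>Basis. \<integral>t. f b t \<partial>lborel)"
proof -
  interpret product_sigma_finite "\<lambda>_::'a. lborel :: real measure" ..
  have [measurable]: "f b \<in> borel_measurable borel" if "b \<in> Basis" for b
    using borel_measurable_integrable[OF f[OF that]] by simp
  let ?T = "\<lambda>g. \<Sum>b\<in>Basis. g b *\<^sub>R (b::'a)"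
  have T: "?T \<in> measurable (\<Pi>\<^sub>M b\<in>Basis. lborel) borel" by measurable
  have coord: "(\<Prod>b\<in>Basis. f b (?T g \<bullet> b)) = (\<Prod>b\<in>Basis. f b (g b))" for g
    by (rule prod.cong) auto
  have P: "(\<lambda>x. \<Prod>b\<in>Basis. f b (x \<bullet> b)) \<in> borel_measurable borel" by measurable
  show "integrable lborel (\<lambda>x. \<Prod>b\<in>Basis. f b (x \<bullet> b))"
    unfolding lborel_eq[where ?'a = 'a] integrable_distr_eq[OF T P] coord by (rule product_integrable_prod) (use f in auto)
  show "(\<integral>x. (\<Prod>b\<in>Basis. f b (x \<bullet> b)) \<partial>lborel) = (\<Prod>b\<in>Basis. \<integral>t. f b t \<partial>lborel)"
    unfolding lborel_eq[where ?'a = 'a] integral_distr[OF T P] coord by (rule product_integral_prod) (use f in auto)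
qed

lemma
  fixes F :: "'a::euclidean_space \<Rightarrow> 'b::{banach,second_countable_topology}"
  assumes [measurable]: "F \<in> borel_measurable borel" and s: "s \<noteq> 0"
  shows lborel_integrable_scale: "integrable lborel (\<lambda>x. F (s *\<^sub>R x)) \<longleftrightarrow> integrable lborel F"
    and lborel_integral_scale: "(\<integral>x. F x \<partial>lborel) = \<bar>s\<bar> ^ DIM('a) *\<^sub>R (\<integral>x. F (s *\<^sub>R x) \<partial>lborel)"
proof -
  have eq: "lborel = density (distr lborel borel (\<lambda>x::'a. s *\<^sub>R x)) (\<lambda>_. ennreal (\<bar>s\<bar> ^ DIM('a)))"
    using lborel_affine[OF s, of 0] by (simp add: ennreal_power)
  have "integrable lborel F \<longleftrightarrow> integrable lborel (\<lambda>x. \<bar>s\<bar> ^ DIM('a) *\<^sub>R F (s *\<^sub>R x))"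
    by (subst eq) (simp add: integrable_density integrable_distr_eq)
  also have "\<dots> \<longleftrightarrow> integrable lborel (\<lambda>x. F (s *\<^sub>R x))"
  proof
    assume "integrable lborel (\<lambda>x. \<bar>s\<bar> ^ DIM('a) *\<^sub>R F (s *\<^sub>R x))"
    from integrable_scaleR_right[OF this, of "inverse (\<bar>s\<bar> ^ DIM('a))"] s
    show "integrable lborel (\<lambda>x. F (s *\<^sub>R x))" by simp
  qed simp
  finally show "integrable lborel (\<lambda>x. F (s *\<^sub>R x)) \<longleftrightarrow> integrable lborel F" ..
  have "(\<integral>x. F x \<partial>lborel) = (\<integral>x. \<bar>s\<bar> ^ DIM('a) *\<^sub>R F (s *\<^sub>R x) \<partial>lborel)"
    by (subst eq) (simp add: integral_density integral_distr)
  then show "(\<integral>x. F x \<partial>lborel) = \<bar>s\<bar> ^ DIM('a) *\<^sub>R (\<integral>x. F (s *\<^sub>R x) \<partial>lborel)" using s by simp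
qed

definition gauss :: "'a::euclidean_space \<Rightarrow> real" where
  "gauss x = exp (- (norm x)\<^sup>2 / 2)"

lemma gauss_measurable [measurable]: "gauss \<in> borel_measurable borel"
  unfolding gauss_def by measurable

lemma gauss_bounds: "0 \<le> gauss x" "gauss x \<le> 1"
  by (auto simp: gauss_def)

lemma gauss_prod: "gauss x = (\<Prod>b\<in>Basis. exp (- (x \<bullet> b)\<^sup>2 / 2))"
proof -
  have "(norm x)\<^sup>2 = (\<Sum>b\<in>Basis. (x \<bullet> b)\<^sup>2)"
    unfolding power2_norm_eq_inner by (subst euclidean_inner) (simp add: power2_eq_square)
  then show ?thesis
    by (simp only: gauss_def) (simp add: exp_sum[symmetric] sum_negf sum_divide_distrib)
qed

text \<open>Both the Gaussian and the characters factor over the coordinates, and each factor is the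
  characteristic function of the standard normal distribution.\<close>

lemma
  fixes y :: "'a::euclidean_space"
  shows integrable_gauss: "integrable lborel (gauss :: 'a \<Rightarrow> real)"
    and fourier_gauss: "(\<integral>x. complex_of_real (gauss x) * cis (- (y \<bullet> x)) \<partial>lborel) =
      complex_of_real (sqrt (2 * pi) ^ DIM('a) * gauss y)"
proof -
  let ?f = "\<lambda>b t. complex_of_real (sqrt (2 * pi) * std_normal_density t) * cis (- (y \<bullet> b) * t)"
  have prod: "complex_of_real (gauss x) * cis (- (y \<bullet> x)) = (\<Prod>b\<in>Basis. ?f b (x \<bullet> b))" for x :: 'a
  proof -
    have "exp (- (norm x)\<^sup>2 / 2) = (\<Prod>b\<in>Basis. exp (- (x \<bullet> b)\<^sup>2 / 2))"
      using gauss_prod[of x] by (simp add: gauss_def)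
    moreover have "(\<Prod>b\<in>Basis. cis (- (y \<bullet> b) * (x \<bullet> b))) = cis (- (y \<bullet> x))"
      by (simp add: cis_conv_exp exp_sum[symmetric] euclidean_inner[of y x] sum_negf sum_distrib_left)
    moreover have "sqrt (2 * pi) * std_normal_density r = exp (- r\<^sup>2 / 2)" for r
      by (simp add: std_normal_density_def)
    ultimately show ?thesis
      by (simp only: gauss_def prod.distrib of_real_prod[symmetric])
  qed
  have int: "integrable lborel (?f b)" for b
  proof -
    have "integrable std_normal_distribution (\<lambda>t. cis (- (y \<bullet> b) * t))"
    proof -
      interpret N: real_distribution std_normal_distribution by (rule real_dist_normal_dist)
      show ?thesis by (rule N.integrable_const_bound[of _ 1]) auto
    qed
    then have "integrable lborel (\<lambda>t. std_normal_density t *\<^sub>R cis (- (y \<bullet> b) * t))"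
      by (subst (asm) integrable_density) auto
    from integrable_mult_right[OF this, of "complex_of_real (sqrt (2 * pi))"]
    show ?thesis by (simp add: scaleR_conv_of_real mult.assoc)
  qed
  have val: "(\<integral>t. ?f b t \<partial>lborel) = complex_of_real (sqrt (2 * pi) * exp (- (y \<bullet> b)\<^sup>2 / 2))" for b
  proof -
    have "(\<integral>t. ?f b t \<partial>lborel) = complex_of_real (sqrt (2 * pi)) * (\<integral>t. std_normal_density t *\<^sub>R cis (- (y \<bullet> b) * t) \<partial>lborel)"
      by (subst integral_mult_right_zero[symmetric]) (simp add: scaleR_conv_of_real mult.assoc)
    also have "(\<integral>t. std_normal_density t *\<^sub>R cis (- (y \<bullet> b) * t) \<partial>lborel) = char std_normal_distribution (- (y \<bullet> b))"
      unfolding char_def by (subst integral_density) (auto simp: cis_conv_exp)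
    finally show ?thesis by (simp add: char_std_normal_distribution)
  qed
  have "(\<integral>x. complex_of_real (gauss x) * cis (- (y \<bullet> x)) \<partial>lborel) =
      (\<Prod>b\<in>(Basis::'a set). complex_of_real (sqrt (2 * pi) * exp (- (y \<bullet> b)\<^sup>2 / 2)))"
    unfolding prod by (subst lborel_integral_prod[OF int]) (simp only: val)
  also have "\<dots> = complex_of_real (sqrt (2 * pi) ^ DIM('a) * (\<Prod>b\<in>(Basis::'a set). exp (- (y \<bullet> b)\<^sup>2 / 2)))"
    by (simp add: prod.distrib)
  also have "(\<Prod>b\<in>(Basis::'a set). exp (- (y \<bullet> b)\<^sup>2 / 2)) = gauss y"
    by (rule gauss_prod[symmetric])
  finally show "(\<integral>x. complex_of_real (gauss x) * cis (- (y \<bullet> x)) \<partial>lborel) =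
      complex_of_real (sqrt (2 * pi) ^ DIM('a) * gauss y)" .
  have "integrable lborel (\<lambda>x::'a. complex_of_real (gauss x) * cis (- (y \<bullet> x)))"
    unfolding prod by (rule lborel_integrable_prod[OF int])
  then have "integrable lborel (\<lambda>x::'a. norm (complex_of_real (gauss x) * cis (- (y \<bullet> x))))"
    by (rule integrable_norm)
  then show "integrable lborel (gauss :: 'a \<Rightarrow> real)"
    by (simp add: norm_mult gauss_bounds)
qed

lemma integral_gauss: "(\<integral>x. gauss (x::'a::euclidean_space) \<partial>lborel) = sqrt (2 * pi) ^ DIM('a)"
proof -
  have "complex_of_real (\<integral>x. gauss (x::'a) \<partial>lborel) = complex_of_real (sqrt (2 * pi) ^ DIM('a))"
    using fourier_gauss[of "0::'a"] by (simp add: gauss_def)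
  then show ?thesis by (simp only: of_real_eq_iff)
qed

definition fourier :: "('a::euclidean_space \<Rightarrow> complex) \<Rightarrow> 'a \<Rightarrow> complex" where
  "fourier v \<xi> = (\<integral>x. v x * cis (- (\<xi> \<bullet> x)) \<partial>lborel)"

lemma integrable_fourier:
  assumes v: "integrable lborel v"
  shows "integrable lborel (\<lambda>x. v x * cis (- (\<xi> \<bullet> x)))"
proof -
  have [measurable]: "v \<in> borel_measurable borel" using borel_measurable_integrable[OF v] by simp
  show ?thesis by (rule Bochner_Integration.integrable_bound[OF v]) (auto simp: norm_mult)
qed

lemma isCont_fourier:
  assumes v: "integrable lborel v"
  shows "isCont (fourier v) \<xi>"
  unfolding continuous_at_sequentially o_def
proof (intro allI impI)
  fix X assume X: "X \<longlonglongrightarrow> \<xi>"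
  have [measurable]: "v \<in> borel_measurable borel" using borel_measurable_integrable[OF v] by simp
  show "(\<lambda>n. fourier v (X n)) \<longlonglongrightarrow> fourier v \<xi>"
    unfolding fourier_def
  proof (rule integral_dominated_convergence[where w = "\<lambda>x. norm (v x)"])
    have "(\<lambda>n. v x * cis (- (X n \<bullet> x))) \<longlonglongrightarrow> v x * cis (- (\<xi> \<bullet> x))" for x
      unfolding cis_conv_exp by (intro tendsto_intros X)
    then show "AE x in lborel. (\<lambda>n. v x * cis (- (X n \<bullet> x))) \<longlonglongrightarrow> v x * cis (- (\<xi> \<bullet> x))" by simp
  qed (use v in \<open>auto simp: norm_mult\<close>)
qed

lemma continuous_fourier: "integrable lborel v \<Longrightarrow> continuous_on A (fourier v)"
  using isCont_fourier continuous_at_imp_continuous_on by blast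

text \<open>Its Fourier transform is \<open>\<bar>fourier v\<bar>\<^sup>2\<close> and its value at \<open>0\<close> is the squared \<open>L\<^sup>2\<close> norm of \<open>v\<close>, so that
  Plancherel's identity is Fourier inversion for this one function at the single point \<open>0\<close>.\<close>

definition autocorrelation :: "('a::euclidean_space \<Rightarrow> complex) \<Rightarrow> 'a \<Rightarrow> complex" where
  "autocorrelation v z = (\<integral>y. v (y + z) * cnj (v y) \<partial>lborel)"

lemma integrable_autocorrelation_pair:
  fixes v :: "'a::euclidean_space \<Rightarrow> complex"
  assumes v: "integrable lborel v"
  shows "integrable (lborel \<Otimes>\<^sub>M lborel) (\<lambda>(y, z). v (y + z) * cnj (v y))"
proof (rule lborel_pair.Fubini_integrable)
  have [measurable]: "v \<in> borel_measurable borel" using borel_measurable_integrable[OF v] by simp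
  show "(\<lambda>(y, z). v (y + z) * cnj (v y)) \<in> borel_measurable (lborel \<Otimes>\<^sub>M lborel)" by measurable
  have sh: "integrable lborel (\<lambda>z. v (y + z))" "(\<integral>z. norm (v (y + z)) \<partial>lborel) = (\<integral>z. norm (v z) \<partial>lborel)" for y
    using lborel_integrable_translation_iff[of v y] lborel_integral_translation[of "\<lambda>z. norm (v z)" y] v
    by (simp_all add: add.commute)
  show "integrable lborel (\<lambda>y. \<integral>z. norm (case (y, z) of (y, z) \<Rightarrow> v (y + z) * cnj (v y)) \<partial>lborel)"
    using v by (simp add: norm_mult sh)
  show "AE y in lborel. integrable lborel (\<lambda>z. case (y, z) of (y, z) \<Rightarrow> v (y + z) * cnj (v y))"
    using sh by simp
qed

lemma integrable_autocorrelation: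
  assumes v: "integrable lborel v"
  shows "integrable lborel (autocorrelation v)"
proof -
  have "integrable (lborel \<Otimes>\<^sub>M lborel) (\<lambda>(z, y). v (y + z) * cnj (v y))"
    using lborel_pair.integrable_product_swap[OF integrable_autocorrelation_pair[OF v]] by (simp add: case_prod_unfold)
  from lborel_pair.integrable_fst'[OF this] show ?thesis
    by (simp add: autocorrelation_def[abs_def])
qed

lemma fourier_autocorrelation:
  fixes v :: "'a::euclidean_space \<Rightarrow> complex"
  assumes v: "integrable lborel v"
  shows "fourier (autocorrelation v) \<xi> = complex_of_real ((norm (fourier v \<xi>))\<^sup>2)"
proof -
  let ?F = "\<lambda>y z. v (y + z) * cnj (v y) * cis (- (\<xi> \<bullet> z))"
  have [measurable]: "v \<in> borel_measurable borel" using borel_measurable_integrable[OF v] by simp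
  have int: "integrable (lborel \<Otimes>\<^sub>M lborel) (\<lambda>(y, z). ?F y z)"
    by (rule Bochner_Integration.integrable_bound[OF integrable_autocorrelation_pair[OF v]])
      (auto simp: norm_mult)
  have "fourier (autocorrelation v) \<xi> = (\<integral>z. (\<integral>y. ?F y z \<partial>lborel) \<partial>lborel)"
    by (simp add: fourier_def autocorrelation_def)
  also have "\<dots> = (\<integral>y. (\<integral>z. ?F y z \<partial>lborel) \<partial>lborel)"
    by (rule lborel_pair.Fubini_integral[OF int])
  also have "\<dots> = (\<integral>y. fourier v \<xi> * cnj (v y * cis (- (\<xi> \<bullet> y))) \<partial>lborel)"
  proof (rule Bochner_Integration.integral_cong[OF refl])
    fix y
    have "(\<integral>z. ?F y z \<partial>lborel) = (\<integral>z. (v (z + y) * cis (- (\<xi> \<bullet> (z + y)))) * cnj (v y * cis (- (\<xi> \<bullet> y))) \<partial>lborel)"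
      by (rule Bochner_Integration.integral_cong)
        (auto simp: inner_add_right cis_cnj cis_mult add.commute mult_ac)
    also have "\<dots> = fourier v \<xi> * cnj (v y * cis (- (\<xi> \<bullet> y)))"
      unfolding fourier_def integral_mult_left_zero
      by (subst lborel_integral_translation[of "\<lambda>z. v z * cis (- (\<xi> \<bullet> z))"]) (rule refl)
    finally show "(\<integral>z. ?F y z \<partial>lborel) = fourier v \<xi> * cnj (v y * cis (- (\<xi> \<bullet> y)))" .
  qed
  also have "\<dots> = fourier v \<xi> * cnj (fourier v \<xi>)"
    unfolding fourier_def integral_mult_right_zero
    by (subst Bochner_Integration.integral_cnj[symmetric]) (rule refl)
  finally show ?thesis by (simp only: complex_norm_square)
qed

lemma integral_character_gauss_scaled:
  fixes y :: "'a::euclidean_space"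
  assumes t: "0 < t"
  shows "(\<integral>\<xi>. cis (- (\<xi> \<bullet> (t *\<^sub>R y))) * complex_of_real (gauss (t *\<^sub>R \<xi>)) \<partial>lborel) =
    complex_of_real (sqrt (2 * pi) ^ DIM('a) * gauss y / t ^ DIM('a))"
proof -
  have "complex_of_real (sqrt (2 * pi) ^ DIM('a) * gauss y) =
      (\<integral>x. complex_of_real (gauss x) * cis (- (y \<bullet> x)) \<partial>lborel)"
    by (rule fourier_gauss[symmetric])
  also have "\<dots> = \<bar>t\<bar> ^ DIM('a) *\<^sub>R (\<integral>x. complex_of_real (gauss (t *\<^sub>R x)) * cis (- (y \<bullet> (t *\<^sub>R x))) \<partial>lborel)"
    by (rule lborel_integral_scale) (use t in auto)
  also have "(\<integral>x. complex_of_real (gauss (t *\<^sub>R x)) * cis (- (y \<bullet> (t *\<^sub>R x))) \<partial>lborel) =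
      (\<integral>\<xi>. cis (- (\<xi> \<bullet> (t *\<^sub>R y))) * complex_of_real (gauss (t *\<^sub>R \<xi>)) \<partial>lborel)"
    by (rule Bochner_Integration.integral_cong) (auto simp: inner_commute mult.commute)
  finally show ?thesis using t by (simp add: scaleR_conv_of_real field_simps)
qed

text \<open>Fubini's theorem moves the transform from the autocorrelation to the wide Gaussian. What remains
  is an average of the autocorrelation over a region that shrinks to \<open>0\<close> with \<open>t\<close>.\<close>

lemma
  fixes v :: "'a::euclidean_space \<Rightarrow> complex"
  assumes v: "integrable lborel v" and t: "0 < t"
  shows integrable_fourier_sq_gauss: "integrable lborel (\<lambda>\<xi>. (norm (fourier v \<xi>))\<^sup>2 * gauss (t *\<^sub>R \<xi>))"
    and integral_fourier_sq_gauss: "complex_of_real (\<integral>\<xi>. (norm (fourier v \<xi>))\<^sup>2 * gauss (t *\<^sub>R \<xi>) \<partial>lborel) =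
      complex_of_real (sqrt (2 * pi) ^ DIM('a)) *
        (\<integral>y. autocorrelation v (t *\<^sub>R y) * complex_of_real (gauss y) \<partial>lborel)"
proof -
  let ?A = "autocorrelation v" and ?c = "complex_of_real (sqrt (2 * pi) ^ DIM('a))"
  let ?G = "\<lambda>\<xi>. (norm (fourier v \<xi>))\<^sup>2 * gauss (t *\<^sub>R \<xi>)"
  let ?F = "\<lambda>\<xi> z. ?A z * cis (- (\<xi> \<bullet> z)) * complex_of_real (gauss (t *\<^sub>R \<xi>))"
  have intA: "integrable lborel ?A" by (rule integrable_autocorrelation[OF v])
  have [measurable]: "?A \<in> borel_measurable borel" using borel_measurable_integrable[OF intA] by simp
  have intg: "integrable lborel (\<lambda>\<xi>::'a. gauss (t *\<^sub>R \<xi>))"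
    using lborel_integrable_scale[of "gauss :: 'a \<Rightarrow> real" t] t integrable_gauss by simp
  have int: "integrable (lborel \<Otimes>\<^sub>M lborel) (\<lambda>(\<xi>, z). ?F \<xi> z)"
  proof (rule lborel_pair.Fubini_integrable)
    show "integrable lborel (\<lambda>\<xi>. \<integral>z. norm (case (\<xi>, z) of (\<xi>, z) \<Rightarrow> ?F \<xi> z) \<partial>lborel)"
      using intg by (simp add: norm_mult gauss_bounds)
    show "AE \<xi> in lborel. integrable lborel (\<lambda>z. case (\<xi>, z) of (\<xi>, z) \<Rightarrow> ?F \<xi> z)"
      using integrable_fourier[OF intA] by simp
  qed measurable
  have inner: "(\<integral>z. ?F \<xi> z \<partial>lborel) = complex_of_real (?G \<xi>)" for \<xi>
    using fourier_autocorrelation[OF v, of \<xi>] by (simp add: fourier_def)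
  from lborel_pair.integrable_fst'[OF int] have "integrable lborel (\<lambda>\<xi>. complex_of_real (?G \<xi>))"
    by (simp only: inner prod.case)
  then show "integrable lborel ?G" by (simp only: complex_of_real_integrable_eq)
  have "complex_of_real (\<integral>\<xi>. ?G \<xi> \<partial>lborel) = (\<integral>\<xi>. (\<integral>z. ?F \<xi> z \<partial>lborel) \<partial>lborel)"
    unfolding inner by (rule integral_complex_of_real[symmetric])
  also have "\<dots> = (\<integral>z. (\<integral>\<xi>. ?F \<xi> z \<partial>lborel) \<partial>lborel)"
    by (rule lborel_pair.Fubini_integral[OF int, symmetric])
  also have "\<dots> = (\<integral>z. ?A z * (\<integral>\<xi>. cis (- (\<xi> \<bullet> z)) * complex_of_real (gauss (t *\<^sub>R \<xi>)) \<partial>lborel) \<partial>lborel)"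
    unfolding mult.assoc integral_mult_right_zero ..
  also have "\<dots> = \<bar>t\<bar> ^ DIM('a) *\<^sub>R (\<integral>y. ?A (t *\<^sub>R y) *
      (\<integral>\<xi>. cis (- (\<xi> \<bullet> (t *\<^sub>R y))) * complex_of_real (gauss (t *\<^sub>R \<xi>)) \<partial>lborel) \<partial>lborel)"
    by (rule lborel_integral_scale) (use t in auto)
  also have "\<dots> = \<bar>t\<bar> ^ DIM('a) *\<^sub>R (\<integral>y. (?c / t ^ DIM('a)) * (?A (t *\<^sub>R y) * complex_of_real (gauss y)) \<partial>lborel)"
    unfolding integral_character_gauss_scaled[OF t] by (simp add: mult_ac)
  also have "\<dots> = ?c * (\<integral>y. ?A (t *\<^sub>R y) * complex_of_real (gauss y) \<partial>lborel)"
    using t unfolding integral_mult_right_zero by (simp add: scaleR_conv_of_real)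
  finally show "complex_of_real (\<integral>\<xi>. ?G \<xi> \<partial>lborel) =
    ?c * (\<integral>y. ?A (t *\<^sub>R y) * complex_of_real (gauss y) \<partial>lborel)" .
qed

lemma norm_autocorrelation_le:
  fixes v :: "'a::euclidean_space \<Rightarrow> complex"
  assumes v: "integrable lborel v" and bnd: "\<And>x. norm (v x) \<le> C"
  shows "norm (autocorrelation v z) \<le> C * (\<integral>y. norm (v y) \<partial>lborel)"
proof -
  have [measurable]: "v \<in> borel_measurable borel" using borel_measurable_integrable[OF v] by simp
  have le: "norm (v (y + z) * cnj (v y)) \<le> C * norm (v y)" for y
    using mult_right_mono[OF bnd[of "y + z"], of "norm (v y)"] by (simp add: norm_mult)
  have C: "0 \<le> C" using bnd[of 0] norm_ge_zero order_trans by blast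
  have int: "integrable lborel (\<lambda>y. C * norm (v y))" using v by simp
  have "norm (autocorrelation v z) \<le> (\<integral>y. norm (v (y + z) * cnj (v y)) \<partial>lborel)"
    unfolding autocorrelation_def by (rule integral_norm_bound)
  also have "\<dots> \<le> (\<integral>y. C * norm (v y) \<partial>lborel)"
  proof (rule integral_mono[OF _ int le])
    show "integrable lborel (\<lambda>y. norm (v (y + z) * cnj (v y)))"
      by (rule Bochner_Integration.integrable_bound[OF int])
        (use le C in \<open>auto simp: abs_mult\<close>)
  qed
  finally show ?thesis by simp
qed

lemma autocorrelation_tendsto:
  fixes v :: "'a::euclidean_space \<Rightarrow> complex"
  assumes cont: "continuous_on UNIV v" and v: "integrable lborel v" and bnd: "\<And>x. norm (v x) \<le> C"
    and z: "z \<longlonglongrightarrow> 0"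
  shows "(\<lambda>k. autocorrelation v (z k)) \<longlonglongrightarrow> autocorrelation v 0"
  unfolding autocorrelation_def
proof (rule integral_dominated_convergence[where w = "\<lambda>y. C * norm (v y)"])
  have [measurable]: "v \<in> borel_measurable borel" using borel_measurable_integrable[OF v] by simp
  show "(\<lambda>y. v (y + 0) * cnj (v y)) \<in> borel_measurable lborel"
    "\<And>k. (\<lambda>y. v (y + z k) * cnj (v y)) \<in> borel_measurable lborel" by measurable
  show "integrable lborel (\<lambda>y. C * norm (v y))" using v by simp
  have "(\<lambda>k. v (y + z k)) \<longlonglongrightarrow> v (y + 0)" for y
    by (rule continuous_on_tendsto_compose[OF cont]) (use tendsto_add[OF tendsto_const z] in auto)
  then show "AE y in lborel. (\<lambda>k. v (y + z k) * cnj (v y)) \<longlonglongrightarrow> v (y + 0) * cnj (v y)"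
    by (intro AE_I2 tendsto_mult tendsto_const)
  have "norm (v (y + z k) * cnj (v y)) \<le> C * norm (v y)" for y k
    using mult_right_mono[OF bnd[of "y + z k"], of "norm (v y)"] by (simp add: norm_mult)
  then show "AE y in lborel. norm (v (y + z k) * cnj (v y)) \<le> C * norm (v y)" for k by simp
qed

text \<open>As \<open>t\<close> decreases to \<open>0\<close> the Gaussian weights increase to \<open>1\<close>, so monotone convergence gives
  integrability together with the value.\<close>

lemma
  fixes v :: "'a::euclidean_space \<Rightarrow> complex"
  assumes cont: "continuous_on UNIV v" and v: "integrable lborel v" and bnd: "\<And>x. norm (v x) \<le> C"
  shows plancherel_integrable: "integrable lborel (\<lambda>\<xi>. (norm (fourier v \<xi>))\<^sup>2)"
    and plancherel: "(\<integral>\<xi>. (norm (fourier v \<xi>))\<^sup>2 \<partial>lborel) = (2 * pi) ^ DIM('a) * (\<integral>x. (norm (v x))\<^sup>2 \<partial>lborel)"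
proof -
  let ?A = "autocorrelation v" and ?c = "sqrt (2 * pi) ^ DIM('a)"
  let ?B = "C * (\<integral>y. norm (v y) \<partial>lborel)"
  define t where "t k = 1 / real (Suc k)" for k
  have t: "0 < t k" for k by (simp add: t_def)
  have t0: "t \<longlonglongrightarrow> 0" unfolding t_def using LIMSEQ_inverse_real_of_nat by (simp add: inverse_eq_divide)
  have tz: "(\<lambda>k. t k *\<^sub>R y) \<longlonglongrightarrow> 0" for y :: 'a using tendsto_scaleR[OF t0 tendsto_const[of y]] by simp
  have [measurable]: "?A \<in> borel_measurable borel"
    using borel_measurable_integrable[OF integrable_autocorrelation[OF v]] by simp
  have [measurable]: "fourier v \<in> borel_measurable borel"
    using continuous_fourier[OF v] by (rule borel_measurable_continuous_onI)
  let ?G = "\<lambda>k \<xi>. (norm (fourier v \<xi>))\<^sup>2 * gauss (t k *\<^sub>R \<xi>)"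
  have A0: "?A 0 = complex_of_real (\<integral>x. (norm (v x))\<^sup>2 \<partial>lborel)"
    unfolding autocorrelation_def integral_complex_of_real[symmetric]
    by (simp only: complex_norm_square add_0_right)
  have "(\<lambda>k. \<integral>y. ?A (t k *\<^sub>R y) * complex_of_real (gauss y) \<partial>lborel) \<longlonglongrightarrow> (\<integral>y. ?A 0 * complex_of_real (gauss (y::'a)) \<partial>lborel)"
  proof (rule integral_dominated_convergence[where w = "\<lambda>y. ?B * gauss y"])
    show "AE y in lborel. (\<lambda>k. ?A (t k *\<^sub>R y) * complex_of_real (gauss y)) \<longlonglongrightarrow> ?A 0 * complex_of_real (gauss y)"
      by (intro AE_I2 tendsto_mult tendsto_const autocorrelation_tendsto[OF cont v bnd] tz)
    show "AE y in lborel. norm (?A (t k *\<^sub>R y) * complex_of_real (gauss y)) \<le> ?B * gauss y" for k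
      using norm_autocorrelation_le[OF v bnd]
      by (intro AE_I2) (simp add: norm_mult gauss_bounds mult_right_mono)
    show "integrable lborel (\<lambda>y::'a. ?B * gauss y)" by (rule integrable_mult_right) (rule integrable_gauss)
  qed measurable
  also have "(\<integral>y. ?A 0 * complex_of_real (gauss (y::'a)) \<partial>lborel) = ?A 0 * complex_of_real ?c"
    unfolding integral_mult_right_zero integral_complex_of_real integral_gauss ..
  finally have "(\<lambda>k. complex_of_real (\<integral>\<xi>. ?G k \<xi> \<partial>lborel)) \<longlonglongrightarrow> complex_of_real ?c * (?A 0 * complex_of_real ?c)"
    unfolding integral_fourier_sq_gauss[OF v t] by (rule tendsto_mult_left)
  also have "complex_of_real ?c * (?A 0 * complex_of_real ?c) = complex_of_real ((2 * pi) ^ DIM('a) * (\<integral>x. (norm (v x))\<^sup>2 \<partial>lborel))"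
  proof -
    have "?c * ?c = (2 * pi) ^ DIM('a)" by (subst power_mult_distrib[symmetric]) simp
    then have "complex_of_real ?c * complex_of_real ?c = complex_of_real ((2 * pi) ^ DIM('a))"
      by (simp only: of_real_mult[symmetric])
    moreover have "complex_of_real ?c * (z * complex_of_real ?c) = (complex_of_real ?c * complex_of_real ?c) * z" for z
      by (simp only: mult_ac)
    ultimately show ?thesis unfolding A0 by (simp only: of_real_mult)
  qed
  finally have lim: "(\<lambda>k. \<integral>\<xi>. ?G k \<xi> \<partial>lborel) \<longlonglongrightarrow> (2 * pi) ^ DIM('a) * (\<integral>x. (norm (v x))\<^sup>2 \<partial>lborel)"
    by (simp only: tendsto_of_real_iff)
  have mono: "AE \<xi> in lborel. mono (\<lambda>k. ?G k \<xi>)"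
  proof -
    have "gauss (t k *\<^sub>R \<xi>) \<le> gauss (t l *\<^sub>R \<xi>)" if "k \<le> l" for k l and \<xi> :: 'a
    proof -
      have "t l \<le> t k" using that by (simp add: t_def frac_le)
      then have "(norm (t l *\<^sub>R \<xi>))\<^sup>2 \<le> (norm (t k *\<^sub>R \<xi>))\<^sup>2"
        using t[of l] t[of k] by (intro power_mono) (auto intro: mult_right_mono)
      then show ?thesis by (simp add: gauss_def)
    qed
    then show ?thesis by (intro AE_I2 monoI mult_left_mono) auto
  qed
  have ptw: "AE \<xi> in lborel. (\<lambda>k. ?G k \<xi>) \<longlonglongrightarrow> (norm (fourier v \<xi>))\<^sup>2"
  proof -
    have "(\<lambda>k. gauss (t k *\<^sub>R \<xi>)) \<longlonglongrightarrow> exp (- (norm (0::'a))\<^sup>2 / 2)" for \<xi> :: 'a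
      unfolding gauss_def by (intro tendsto_intros tz) auto
    then have "(\<lambda>k. gauss (t k *\<^sub>R \<xi>)) \<longlonglongrightarrow> 1" for \<xi> :: 'a by simp
    from tendsto_mult_left[OF this] show ?thesis by simp
  qed
  show "integrable lborel (\<lambda>\<xi>. (norm (fourier v \<xi>))\<^sup>2)"
    by (rule integral_monotone_convergence_nonneg(1)[OF integrable_fourier_sq_gauss[OF v t] mono _ ptw lim])
      (auto simp: gauss_bounds)
  show "(\<integral>\<xi>. (norm (fourier v \<xi>))\<^sup>2 \<partial>lborel) = (2 * pi) ^ DIM('a) * (\<integral>x. (norm (v x))\<^sup>2 \<partial>lborel)"
    by (rule integral_monotone_convergence_nonneg(2)[OF integrable_fourier_sq_gauss[OF v t] mono _ ptw lim])
      (auto simp: gauss_bounds)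
qed

section \<open>Density of the translates of the mollifier\<close>

definition lattice :: "nat \<Rightarrow> (real^2) set" where
  "lattice m = {x. \<forall>i. \<exists>j::int. x $ i = of_int j / 2 ^ m}"

lemma lattice_mono: "m \<le> m' \<Longrightarrow> lattice m \<subseteq> lattice m'"
proof
  fix x assume m: "m \<le> m'" and x: "x \<in> lattice m"
  show "x \<in> lattice m'" unfolding lattice_def
  proof (intro CollectI allI)
    fix i
    from x obtain j :: int where "x $ i = of_int j / 2 ^ m" by (auto simp: lattice_def)
    also have "\<dots> = of_int (j * 2 ^ (m' - m)) / 2 ^ m'"
      using m by (simp add: field_simps flip: power_add)
    finally show "\<exists>j::int. x $ i = of_int j / 2 ^ m'" ..
  qed
qed

lemma grid_lattice: "grid m = {x \<in> lattice m. norm x \<le> real m}"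
  by (auto simp: grid_def lattice_def)

lemma grid_mono: "m \<le> m' \<Longrightarrow> grid m \<subseteq> grid m'"
  using lattice_mono[of m m'] by (auto simp: grid_lattice)

definition dyadic :: "(real^2) set" where
  "dyadic = (\<Union>m. lattice m)"

lemma dyadic_grid: "dyadic = (\<Union>m. grid m)"
proof
  show "dyadic \<subseteq> (\<Union>m. grid m)"
  proof
    fix x assume "x \<in> dyadic"
    then obtain m where m: "x \<in> lattice m" by (auto simp: dyadic_def)
    obtain k :: nat where k: "norm x \<le> real k" using real_arch_simple by blast
    have "x \<in> grid (max m k)"
      using lattice_mono[of m "max m k"] m k by (auto simp: grid_lattice)
    then show "x \<in> (\<Union>m. grid m)" by blast
  qed
qed (auto simp: dyadic_def grid_lattice)

lemma dyadic_add: "x \<in> dyadic \<Longrightarrow> y \<in> dyadic \<Longrightarrow> x + y \<in> dyadic"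
proof -
  assume "x \<in> dyadic" "y \<in> dyadic"
  then obtain m m' where "x \<in> lattice m" "y \<in> lattice m'" by (auto simp: dyadic_def)
  then have *: "x \<in> lattice (max m m')" "y \<in> lattice (max m m')"
    using lattice_mono[of m "max m m'"] lattice_mono[of m' "max m m'"] by auto
  have "x + y \<in> lattice (max m m')" unfolding lattice_def
  proof (intro CollectI allI)
    fix i
    from * obtain j j' :: int where "x $ i = of_int j / 2 ^ max m m'" "y $ i = of_int j' / 2 ^ max m m'"
      unfolding lattice_def by blast
    then have "(x + y) $ i = of_int (j + j') / 2 ^ max m m'" by (simp add: add_divide_distrib)
    then show "\<exists>j::int. (x + y) $ i = of_int j / 2 ^ max m m'" ..
  qed
  then show ?thesis by (auto simp: dyadic_def)
qed

lemma dyadic_uminus: "x \<in> dyadic \<Longrightarrow> - x \<in> dyadic"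
proof -
  assume "x \<in> dyadic"
  then obtain m where m: "x \<in> lattice m" by (auto simp: dyadic_def)
  have "- x \<in> lattice m" unfolding lattice_def
  proof (intro CollectI allI)
    fix i
    from m obtain j :: int where "x $ i = of_int j / 2 ^ m" unfolding lattice_def by blast
    then have "(- x) $ i = of_int (- j) / 2 ^ m" by simp
    then show "\<exists>j::int. (- x) $ i = of_int j / 2 ^ m" ..
  qed
  then show ?thesis by (auto simp: dyadic_def)
qed

lemma dyadic_zero: "0 \<in> dyadic"
  unfolding dyadic_def lattice_def by (auto intro!: exI[of _ "0::int"])

lemma dyadic_axis: "(1 / 2 ^ m) *\<^sub>R axis i (1::real) \<in> dyadic"
proof -
  have "(1 / 2 ^ m) *\<^sub>R axis i (1::real) \<in> lattice m" unfolding lattice_def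
  proof (intro CollectI allI)
    fix k
    have "((1 / 2 ^ m) *\<^sub>R axis i (1::real)) $ k = of_int (if k = i then 1 else 0) / 2 ^ m"
      by (simp add: axis_def)
    then show "\<exists>j::int. ((1 / 2 ^ m) *\<^sub>R axis i (1::real)) $ k = of_int j / 2 ^ m" ..
  qed
  then show ?thesis by (auto simp: dyadic_def)
qed

text \<open>Only dyadic frequencies are admitted: multiplying the transform of \<open>\<delta>\<^sub>n\<^sub>,\<^sub>0\<close> by such a polynomial gives
  the transform of a combination of \<open>\<delta>\<^sub>n\<^sub>,\<^sub>l\<close> whose base points \<open>l\<close> all lie in one grid.\<close>

inductive trig_poly :: "(real^2 \<Rightarrow> complex) \<Rightarrow> bool" where
  monomial: "x \<in> dyadic \<Longrightarrow> trig_poly (\<lambda>\<xi>. c * cis (- (\<xi> \<bullet> x)))"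
| add: "trig_poly P \<Longrightarrow> trig_poly Q \<Longrightarrow> trig_poly (\<lambda>\<xi>. P \<xi> + Q \<xi>)"

lemma trig_poly_const: "trig_poly (\<lambda>_. c)"
  using trig_poly.monomial[OF dyadic_zero, of c] by simp

lemma trig_poly_mult:
  assumes "trig_poly P" "trig_poly Q"
  shows "trig_poly (\<lambda>\<xi>. P \<xi> * Q \<xi>)"
  using assms
proof (induction P)
  case (monomial x c)
  from monomial.prems show ?case
  proof (induction Q)
    case (monomial y d)
    have "trig_poly (\<lambda>\<xi>. (c * d) * cis (- (\<xi> \<bullet> (x + y))))"
      by (intro trig_poly.monomial dyadic_add \<open>x \<in> dyadic\<close> monomial)
    moreover have "(c * d) * cis (- (\<xi> \<bullet> (x + y))) = c * cis (- (\<xi> \<bullet> x)) * (d * cis (- (\<xi> \<bullet> y)))" for \<xi>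
      by (simp add: inner_add_right cis_mult mult_ac)
    ultimately show ?case by simp
  next
    case (add P Q)
    then show ?case using trig_poly.add by (simp add: distrib_left)
  qed
next
  case (add P R)
  then show ?case using trig_poly.add by (simp add: distrib_right)
qed

lemma trig_poly_bounded: "trig_poly P \<Longrightarrow> \<exists>B. \<forall>\<xi>. norm (P \<xi>) \<le> B"
proof (induction P rule: trig_poly.induct)
  case (monomial x c)
  then show ?case by (auto simp: norm_mult)
next
  case (add P Q)
  then obtain B C where "\<forall>\<xi>. norm (P \<xi>) \<le> B" "\<forall>\<xi>. norm (Q \<xi>) \<le> C" by blast
  then have "\<forall>\<xi>. norm (P \<xi> + Q \<xi>) \<le> B + C" using norm_triangle_mono by blast
  then show ?case by blast
qed

lemma trig_poly_continuous: "trig_poly P \<Longrightarrow> continuous_on A P"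
  by (induction P rule: trig_poly.induct) (auto simp: cis_conv_exp intro!: continuous_intros)

definition real_trig_poly :: "(real^2 \<Rightarrow> real) \<Rightarrow> bool" where
  "real_trig_poly P \<longleftrightarrow> trig_poly (\<lambda>\<xi>. complex_of_real (P \<xi>))"

lemma real_trig_poly_const: "real_trig_poly (\<lambda>_. c)"
  by (simp add: real_trig_poly_def trig_poly_const)

lemma real_trig_poly_add: "real_trig_poly P \<Longrightarrow> real_trig_poly Q \<Longrightarrow> real_trig_poly (\<lambda>\<xi>. P \<xi> + Q \<xi>)"
  using trig_poly.add by (simp add: real_trig_poly_def)

lemma real_trig_poly_mult: "real_trig_poly P \<Longrightarrow> real_trig_poly Q \<Longrightarrow> real_trig_poly (\<lambda>\<xi>. P \<xi> * Q \<xi>)"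
  using trig_poly_mult by (simp add: real_trig_poly_def)

lemma real_trig_poly_sin:
  assumes "x \<in> dyadic"
  shows "real_trig_poly (\<lambda>\<xi>. sin (\<xi> \<bullet> x - a))"
proof -
  have "complex_of_real (sin (\<xi> \<bullet> x - a)) =
      (cis (- a) / (2 * \<i>)) * cis (- (\<xi> \<bullet> (- x))) + (- cis a / (2 * \<i>)) * cis (- (\<xi> \<bullet> x))" for \<xi>
  proof -
    have "(cis (- a) / (2 * \<i>)) * cis (- (\<xi> \<bullet> (- x))) + (- cis a / (2 * \<i>)) * cis (- (\<xi> \<bullet> x)) =
        (cis (\<xi> \<bullet> x - a) - cis (- (\<xi> \<bullet> x - a))) / (2 * \<i>)"
      by (simp add: diff_divide_distrib cis_mult algebra_simps)
    also have "(cis t - cis (- t)) / (2 * \<i>) = complex_of_real (sin t)" for t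
      by (simp add: complex_eq_iff)
    finally show ?thesis ..
  qed
  then show ?thesis
    unfolding real_trig_poly_def
    using trig_poly.add[OF trig_poly.monomial[OF dyadic_uminus[OF assms], of "cis (- a) / (2 * \<i>)"]
        trig_poly.monomial[OF assms, of "- cis a / (2 * \<i>)"]] by simp
qed

text \<open>Stone-Weierstrass. Two points that differ in some coordinate are separated by a sine function of
  that coordinate whose frequency is so small that the points are less than half a period apart.\<close>

lemma real_trig_poly_approx_compact:
  assumes "compact S" "continuous_on S f" "0 < e"
  shows "\<exists>P. real_trig_poly P \<and> (\<forall>\<xi>\<in>S. \<bar>f \<xi> - P \<xi>\<bar> < e)"
proof (rule Stone_Weierstrass_HOL[OF assms(1) _ _ _ _ _ assms(2,3)])
  show "\<exists>P. real_trig_poly P \<and> P \<xi> \<noteq> P \<eta>" if *: "\<xi> \<in> S \<and> \<eta> \<in> S \<and> \<xi> \<noteq> \<eta>" for \<xi> \<eta>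
  proof -
    from * obtain i where i: "\<xi> $ i \<noteq> \<eta> $ i" by (auto simp: vec_eq_iff)
    define d where "d = \<xi> $ i - \<eta> $ i"
    obtain m where m: "\<bar>d\<bar> < 2 ^ m" using real_arch_pow[of 2 "\<bar>d\<bar>"] by auto
    define x where "x = (1 / 2 ^ m) *\<^sub>R axis i (1::real)"
    have ix: "\<zeta> \<bullet> x = \<zeta> $ i / 2 ^ m" for \<zeta> :: "real^2" by (simp add: x_def inner_axis)
    have "sin (d / 2 ^ m) \<noteq> 0"
    proof
      assume "sin (d / 2 ^ m) = 0"
      moreover have "\<bar>d / 2 ^ m\<bar> < pi" 
      proof -
        have "\<bar>d / 2 ^ m\<bar> < 1" using m by (simp add: abs_divide divide_less_eq)
        with pi_gt3 show ?thesis by linarith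
      qed
      ultimately have "d / 2 ^ m = 0" using sin_eq_0_pi[of "d / 2 ^ m"] by linarith
      then show False using i by (simp add: d_def)
    qed
    then have "sin (\<xi> \<bullet> x - \<eta> \<bullet> x) \<noteq> sin (\<eta> \<bullet> x - \<eta> \<bullet> x)"
      by (simp add: ix d_def diff_divide_distrib)
    moreover have "real_trig_poly (\<lambda>\<zeta>. sin (\<zeta> \<bullet> x - \<eta> \<bullet> x))"
      unfolding x_def by (rule real_trig_poly_sin[OF dyadic_axis])
    ultimately show ?thesis by blast
  qed
  show "continuous_on S P" if "real_trig_poly P" for P
    using continuous_on_Re[OF trig_poly_continuous[of "\<lambda>\<xi>. complex_of_real (P \<xi>)" S]] that
    by (simp add: real_trig_poly_def)
qed (auto intro: real_trig_poly_const real_trig_poly_add real_trig_poly_mult)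

lemma real_trig_poly_compose_polynomial:
  assumes "real_polynomial_function q" "real_trig_poly P"
  shows "real_trig_poly (\<lambda>\<xi>. q (P \<xi>))"
  using assms(1)
proof (induction q)
  case (linear h)
  have lin: "h t = h 1 * t" for t using linear_scale[OF bounded_linear.linear[OF linear], of t 1] by (simp add: mult.commute)
  have "(\<lambda>\<xi>. h (P \<xi>)) = (\<lambda>\<xi>. h 1 * P \<xi>)" by (rule ext) (rule lin)
  then show ?case by (simp only: real_trig_poly_mult[OF real_trig_poly_const assms(2)])
qed (auto intro: real_trig_poly_const real_trig_poly_add real_trig_poly_mult)

text \<open>Uniform approximation on a ball leaves the values outside uncontrolled. Composition with an
  ordinary polynomial that is close to the truncation at height \<open>K\<close> keeps the function a trigonometric
  polynomial and bounds it on the whole plane.\<close>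

lemma real_trig_poly_approx_bounded:
  assumes G: "continuous_on (cball 0 r) G" and K: "\<And>\<xi>. \<bar>G \<xi>\<bar> \<le> K" and e: "0 < e"
  shows "\<exists>P. real_trig_poly P \<and> (\<forall>\<xi>\<in>cball 0 r. \<bar>G \<xi> - P \<xi>\<bar> < e) \<and> (\<forall>\<xi>. \<bar>P \<xi>\<bar> \<le> K + e)"
proof -
  obtain Q where Q: "real_trig_poly Q" "\<And>\<xi>. \<xi> \<in> cball 0 r \<Longrightarrow> \<bar>G \<xi> - Q \<xi>\<bar> < e / 2"
    using real_trig_poly_approx_compact[OF compact_cball G, of "e / 2"] e by auto
  obtain M where M: "\<And>\<xi>. \<bar>Q \<xi>\<bar> \<le> M"
    using trig_poly_bounded[of "\<lambda>\<xi>. complex_of_real (Q \<xi>)"] Q(1) unfolding real_trig_poly_def norm_of_real by blast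
  let ?clip = "\<lambda>t. max (- K) (min K t)"
  have "continuous_on {- M..M} ?clip" by (intro continuous_intros)
  then obtain q where q: "real_polynomial_function q" "\<And>t. t \<in> {- M..M} \<Longrightarrow> \<bar>?clip t - q t\<bar> < e / 2"
    using Stone_Weierstrass_real_polynomial_function[of "{- M..M}" ?clip "e / 2"] e by auto
  have qQ: "\<bar>?clip (Q \<xi>) - q (Q \<xi>)\<bar> < e / 2" for \<xi> using M[of \<xi>] by (intro q(2)) auto
  have "0 \<le> K" using K[of 0] by linarith
  then have "\<bar>?clip t\<bar> \<le> K" for t by auto
  then have 1: "\<bar>q (Q \<xi>)\<bar> \<le> K + e" for \<xi> using qQ[of \<xi>] e by (smt (verit) field_sum_of_halves)
  have 2: "\<bar>G \<xi> - q (Q \<xi>)\<bar> < e" if "\<xi> \<in> cball 0 r" for \<xi>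
  proof -
    have "\<bar>G \<xi> - ?clip (Q \<xi>)\<bar> \<le> \<bar>G \<xi> - Q \<xi>\<bar>" using K[of \<xi>] by auto
    also have "\<dots> < e / 2" by (rule Q(2)[OF that])
    finally show ?thesis using qQ[of \<xi>] by linarith
  qed
  from 1 2 real_trig_poly_compose_polynomial[OF q(1) Q(1)] show ?thesis by blast
qed

lemma integrable_tail_small:
  fixes F :: "'a::euclidean_space \<Rightarrow> real"
  assumes F: "integrable lborel F" and "0 < e"
  shows "\<exists>R::nat. (\<integral>x. F x * indicator (- cball 0 (real R)) x \<partial>lborel) < e"
proof -
  have [measurable]: "F \<in> borel_measurable borel" using borel_measurable_integrable[OF F] by simp
  have "(\<lambda>R. \<integral>x. F x * indicator (- cball 0 (real R)) x \<partial>lborel) \<longlonglongrightarrow> (\<integral>x. 0 \<partial>(lborel :: 'a measure))"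
  proof (rule integral_dominated_convergence[where w = "\<lambda>x. norm (F x)"])
    show "AE x in lborel. (\<lambda>R. F x * indicator (- cball 0 (real R)) x) \<longlonglongrightarrow> 0"
    proof (rule AE_I2)
      fix x :: 'a
      obtain k :: nat where k: "norm x \<le> real k" using real_arch_simple by blast
      have "\<forall>\<^sub>F R in sequentially. F x * indicator (- cball 0 (real R)) x = 0"
        using eventually_ge_at_top[of k] by eventually_elim (use k in \<open>auto simp: indicator_def\<close>)
      then show "(\<lambda>R. F x * indicator (- cball 0 (real R)) x) \<longlonglongrightarrow> 0" by (rule tendsto_eventually)
    qed
    show "AE x in lborel. norm (F x * indicator (- cball 0 (real R)) x) \<le> norm (F x)" for R
      by (auto simp: indicator_def)
  qed (use F in auto)
  then have "\<forall>\<^sub>F R in sequentially. (\<integral>x. F x * indicator (- cball 0 (real R)) x \<partial>lborel) < e"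
    using \<open>0 < e\<close> by (intro order_tendstoD) auto
  then show ?thesis by (auto simp: eventually_sequentially)
qed

text \<open>The quotient \<open>U / H\<close> is continuous because \<open>H\<close> has no zeros. Cut off to a bounded continuous
  function \<open>G\<close>, at the cost of the tail of \<open>U\<close>, it is approximated uniformly on a large ball; outside
  this ball a bound on the approximation suffices, because the weight \<open>\<bar>H\<bar>\<^sup>2\<close> has little mass there.\<close>

lemma trig_poly_weighted_dense:
  fixes U H :: "real^2 \<Rightarrow> complex"
  assumes U: "continuous_on UNIV U" "integrable lborel (\<lambda>\<xi>. (norm (U \<xi>))\<^sup>2)"
    and H: "continuous_on UNIV H" "integrable lborel (\<lambda>\<xi>. (norm (H \<xi>))\<^sup>2)" "\<And>\<xi>. H \<xi> \<noteq> 0"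
    and eps: "0 < \<epsilon>"
  shows "\<exists>P. trig_poly P \<and> (\<integral>\<xi>. (norm (U \<xi> - P \<xi> * H \<xi>))\<^sup>2 \<partial>lborel) < \<epsilon>"
proof -
  have [measurable]: "U \<in> borel_measurable borel" "H \<in> borel_measurable borel"
    using U(1) H(1) borel_measurable_continuous_onI by blast+
  let ?u = "\<lambda>\<xi>. (norm (U \<xi>))\<^sup>2" and ?w = "\<lambda>\<xi>. (norm (H \<xi>))\<^sup>2"
  obtain R :: nat where R: "(\<integral>\<xi>. ?u \<xi> * indicator (- cball 0 (real R)) \<xi> \<partial>lborel) < \<epsilon> / 6"
    using integrable_tail_small[OF U(2), of "\<epsilon> / 6"] eps by auto
  define ct where "ct \<xi> = max 0 (min 1 (real R + 1 - norm \<xi>))" for \<xi> :: "real^2"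
  have ct: "0 \<le> ct \<xi>" "ct \<xi> \<le> 1" "norm \<xi> \<le> real R \<Longrightarrow> ct \<xi> = 1" "norm \<xi> \<ge> real R + 1 \<Longrightarrow> ct \<xi> = 0" for \<xi>
    by (auto simp: ct_def)
  have [continuous_intros]: "continuous_on A ct" for A unfolding ct_def by (intro continuous_intros)
  have [measurable]: "ct \<in> borel_measurable borel" unfolding ct_def by measurable
  define G where "G \<xi> = complex_of_real (ct \<xi>) * U \<xi> / H \<xi>" for \<xi>
  have Gc: "continuous_on A G" for A
    unfolding G_def by (intro continuous_intros continuous_on_subset[OF U(1)] continuous_on_subset[OF H(1)])
      (use H(3) in auto)
  have "bounded (G ` cball 0 (real R + 1))"
    by (rule compact_imp_bounded[OF compact_continuous_image[OF Gc compact_cball]])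
  then obtain K0 where K0: "\<And>\<xi>. \<xi> \<in> cball 0 (real R + 1) \<Longrightarrow> norm (G \<xi>) \<le> K0"
    unfolding bounded_iff by blast
  define K where "K = max 0 K0"
  have K: "norm (G \<xi>) \<le> K" "0 \<le> K" for \<xi>
    using K0[of \<xi>] ct(4)[of \<xi>] by (cases "norm \<xi> \<le> real R + 1"; auto simp: K_def G_def)+
  define I where "I = (\<integral>\<xi>. ?w \<xi> \<partial>lborel)"
  have I: "0 \<le> I" by (simp add: I_def)
  define C where "C = (3 * K + 2)\<^sup>2"
  have C: "0 < C" using K(2) by (simp add: C_def)
  obtain r :: nat where r: "(\<integral>\<xi>. ?w \<xi> * indicator (- cball 0 (real r)) \<xi> \<partial>lborel) < \<epsilon> / (6 * C)"
    using integrable_tail_small[OF H(2), of "\<epsilon> / (6 * C)"] eps C by auto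
  \<comment> \<open>The tail of \<open>U\<close>, the uniform error and the tail of \<open>\<bar>H\<bar>\<^sup>2\<close> contribute at most
    \<open>\<epsilon>/3\<close>, \<open>\<epsilon>/6\<close> and \<open>\<epsilon>/3\<close>.\<close>
  define e where "e = min 1 (\<epsilon> / (48 * (I + 1)))"
  have e: "0 < e" "e \<le> 1" using eps I by (auto simp: e_def)
  have e2: "8 * e\<^sup>2 * I \<le> \<epsilon> / 6"
  proof -
    have "e\<^sup>2 \<le> e * 1" unfolding power2_eq_square by (intro mult_left_mono) (use e in auto)
    then have "8 * e\<^sup>2 * I \<le> 8 * e * (I + 1)" using e I by (intro mult_mono) auto
    also have "\<dots> \<le> 8 * (\<epsilon> / (48 * (I + 1))) * (I + 1)" using I by (intro mult_right_mono mult_left_mono) (auto simp: e_def)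
    also have "\<dots> = \<epsilon> / 6" using I by (simp add: field_simps)
    finally show ?thesis .
  qed
  obtain P1 where P1: "real_trig_poly P1" "\<And>\<xi>. \<xi> \<in> cball 0 (real r) \<Longrightarrow> \<bar>Re (G \<xi>) - P1 \<xi>\<bar> < e" "\<And>\<xi>. \<bar>P1 \<xi>\<bar> \<le> K + e"
    using real_trig_poly_approx_bounded[OF continuous_on_Re[OF Gc] order_trans[OF abs_Re_le_cmod K(1)] e(1), of "real r"]
    by blast
  obtain P2 where P2: "real_trig_poly P2" "\<And>\<xi>. \<xi> \<in> cball 0 (real r) \<Longrightarrow> \<bar>Im (G \<xi>) - P2 \<xi>\<bar> < e" "\<And>\<xi>. \<bar>P2 \<xi>\<bar> \<le> K + e"
    using real_trig_poly_approx_bounded[OF continuous_on_Im[OF Gc] order_trans[OF abs_Im_le_cmod K(1)] e(1), of "real r"]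
    by blast
  define P where "P \<xi> = complex_of_real (P1 \<xi>) + \<i> * complex_of_real (P2 \<xi>)" for \<xi>
  have P: "trig_poly P"
    unfolding P_def using P1(1) P2(1) unfolding real_trig_poly_def
    by (intro trig_poly.add trig_poly_mult trig_poly_const)
  have [measurable]: "P \<in> borel_measurable borel"
    using trig_poly_continuous[OF P] by (rule borel_measurable_continuous_onI)
  have near: "(norm (G \<xi> - P \<xi>))\<^sup>2 \<le> 4 * e\<^sup>2" if "\<xi> \<in> cball 0 (real r)" for \<xi>
  proof -
    have "norm (G \<xi> - P \<xi>) \<le> \<bar>Re (G \<xi>) - P1 \<xi>\<bar> + \<bar>Im (G \<xi>) - P2 \<xi>\<bar>"
      using cmod_le[of "G \<xi> - P \<xi>"] by (simp add: P_def)
    also have "\<dots> \<le> 2 * e" using P1(2)[OF that] P2(2)[OF that] by linarith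
    finally have "(norm (G \<xi> - P \<xi>))\<^sup>2 \<le> (2 * e)\<^sup>2" by (intro power_mono) auto
    then show ?thesis by (simp add: power_mult_distrib)
  qed
  have far: "(norm (G \<xi> - P \<xi>))\<^sup>2 \<le> C" for \<xi>
  proof -
    have "norm (G \<xi> - P \<xi>) \<le> norm (G \<xi>) + norm (P \<xi>)" by (rule norm_triangle_ineq4)
    also have "norm (P \<xi>) \<le> \<bar>P1 \<xi>\<bar> + \<bar>P2 \<xi>\<bar>"
      using norm_triangle_ineq[of "complex_of_real (P1 \<xi>)" "\<i> * complex_of_real (P2 \<xi>)"] by (simp add: P_def norm_mult)
    finally have "norm (G \<xi> - P \<xi>) \<le> 3 * K + 2" using K(1)[of \<xi>] P1(3)[of \<xi>] P2(3)[of \<xi>] e(2) by linarith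
    then show ?thesis unfolding C_def by (intro power_mono) auto
  qed
  let ?b = "\<lambda>\<xi>. 2 * (?u \<xi> * indicator (- cball 0 (real R)) \<xi>)
      + (8 * e\<^sup>2 * ?w \<xi> + 2 * C * (?w \<xi> * indicator (- cball 0 (real r)) \<xi>))"
  have bound: "(norm (U \<xi> - P \<xi> * H \<xi>))\<^sup>2 \<le> ?b \<xi>" for \<xi>
  proof -
    have split: "U \<xi> - P \<xi> * H \<xi> = complex_of_real (1 - ct \<xi>) * U \<xi> + H \<xi> * (G \<xi> - P \<xi>)"
      using H(3)[of \<xi>] by (simp add: G_def field_simps)
    have "norm (U \<xi> - P \<xi> * H \<xi>) \<le> norm (complex_of_real (1 - ct \<xi>) * U \<xi>) + norm (H \<xi> * (G \<xi> - P \<xi>))"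
      unfolding split by (rule norm_triangle_ineq)
    then have "(norm (U \<xi> - P \<xi> * H \<xi>))\<^sup>2 \<le> (norm (complex_of_real (1 - ct \<xi>) * U \<xi>) + norm (H \<xi> * (G \<xi> - P \<xi>)))\<^sup>2"
      by (intro power_mono) auto
    also have "\<dots> \<le> 2 * (norm (complex_of_real (1 - ct \<xi>) * U \<xi>))\<^sup>2 + 2 * (norm (H \<xi> * (G \<xi> - P \<xi>)))\<^sup>2"
      using sum_squares_bound[of "norm (complex_of_real (1 - ct \<xi>) * U \<xi>)" "norm (H \<xi> * (G \<xi> - P \<xi>))"]
      by (simp add: power2_sum)
    also have "(norm (complex_of_real (1 - ct \<xi>) * U \<xi>))\<^sup>2 \<le> ?u \<xi> * indicator (- cball 0 (real R)) \<xi>"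
    proof (cases "norm \<xi> \<le> real R")
      case True
      then show ?thesis using ct(3) by simp
    next
      case False
      have "norm (complex_of_real (1 - ct \<xi>) * U \<xi>) \<le> 1 * norm (U \<xi>)"
        unfolding norm_mult norm_of_real using ct(1,2)[of \<xi>] by (intro mult_right_mono) auto
      then have "(norm (complex_of_real (1 - ct \<xi>) * U \<xi>))\<^sup>2 \<le> ?u \<xi>" by (intro power_mono) auto
      then show ?thesis using False by simp
    qed
    also have "(norm (H \<xi> * (G \<xi> - P \<xi>)))\<^sup>2 = ?w \<xi> * (norm (G \<xi> - P \<xi>))\<^sup>2"
      by (simp add: norm_mult power_mult_distrib)
    also have "\<dots> \<le> ?w \<xi> * (4 * e\<^sup>2 + C * indicator (- cball 0 (real r)) \<xi>)"
    proof (rule mult_left_mono)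
      show "(norm (G \<xi> - P \<xi>))\<^sup>2 \<le> 4 * e\<^sup>2 + C * indicator (- cball 0 (real r)) \<xi>"
      proof (cases "\<xi> \<in> cball 0 (real r)")
        case True
        then show ?thesis using near[OF True] by simp
      next
        case False
        then have "indicator (- cball 0 (real r)) \<xi> = (1::real)" by simp
        then show ?thesis using far[of \<xi>] by (simp add: add_increasing)
      qed
    qed simp
    finally show ?thesis by (simp add: algebra_simps)
  qed
  have ind: "integrable lborel (\<lambda>\<xi>. F \<xi> * indicator (- cball 0 \<rho>) \<xi>)"
    if "integrable lborel F" for F :: "real^2 \<Rightarrow> real" and \<rho>
    using that by (intro integrable_real_mult_indicator) auto
  have "(\<integral>\<xi>. (norm (U \<xi> - P \<xi> * H \<xi>))\<^sup>2 \<partial>lborel) \<le> (\<integral>\<xi>. ?b \<xi> \<partial>lborel)"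
  proof (rule integral_mono_AE')
    show "integrable lborel ?b" using ind[OF U(2)] ind[OF H(2)] H(2) by (intro Bochner_Integration.integrable_add integrable_mult_right) auto
    show "AE \<xi> in lborel. (norm (U \<xi> - P \<xi> * H \<xi>))\<^sup>2 \<le> ?b \<xi>" by (intro AE_I2 bound)
    show "AE \<xi> in lborel. 0 \<le> ?b \<xi>" by (intro AE_I2 order_trans[OF zero_le_power2 bound])
  qed
  also have "\<dots> = 2 * (\<integral>\<xi>. ?u \<xi> * indicator (- cball 0 (real R)) \<xi> \<partial>lborel)
      + (8 * e\<^sup>2 * I + 2 * C * (\<integral>\<xi>. ?w \<xi> * indicator (- cball 0 (real r)) \<xi> \<partial>lborel))"
    using ind[OF U(2)] ind[OF H(2)] H(2) unfolding I_def
    by (subst Bochner_Integration.integral_add Bochner_Integration.integral_add, simp, simp)+ simp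
  also have "2 * C * (\<integral>\<xi>. ?w \<xi> * indicator (- cball 0 (real r)) \<xi> \<partial>lborel) < 2 * C * (\<epsilon> / (6 * C))"
    using r C by (intro mult_strict_left_mono) auto
  also have "2 * C * (\<epsilon> / (6 * C)) = \<epsilon> / 3" using C by simp
  finally have "(\<integral>\<xi>. (norm (U \<xi> - P \<xi> * H \<xi>))\<^sup>2 \<partial>lborel) < \<epsilon>" using R e2 eps by linarith
  with P show ?thesis by blast
qed

lemma fourier_translate:
  fixes v :: "'a::euclidean_space \<Rightarrow> complex"
  shows "fourier (\<lambda>y. v (y - x)) \<xi> = cis (- (\<xi> \<bullet> x)) * fourier v \<xi>"
proof -
  have "fourier (\<lambda>y. v (y - x)) \<xi> = (\<integral>y. v (y + x - x) * cis (- (\<xi> \<bullet> (y + x))) \<partial>lborel)"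
    unfolding fourier_def by (rule lborel_integral_translation[symmetric])
  also have "\<dots> = (\<integral>y. cis (- (\<xi> \<bullet> x)) * (v y * cis (- (\<xi> \<bullet> y))) \<partial>lborel)"
    by (rule Bochner_Integration.integral_cong) (auto simp: inner_add_right cis_mult mult_ac)
  finally show ?thesis by (simp add: fourier_def)
qed

definition schwartz_fourier :: "schwartz \<Rightarrow> real^2 \<Rightarrow> complex" where
  "schwartz_fourier u = fourier (\<lambda>x. complex_of_real (sfun u x))"

lemma integrable_sfun_complex: "integrable lborel (\<lambda>x. complex_of_real (sfun u x))"
  using integrable_sfun complex_of_real_integrable_eq by blast

lemma schwartz_fourier_add: "schwartz_fourier (u + v) \<xi> = schwartz_fourier u \<xi> + schwartz_fourier v \<xi>"
  using integrable_fourier[OF integrable_sfun_complex]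
  by (simp add: schwartz_fourier_def fourier_def plus_schwartz.rep_eq distrib_right)

lemma schwartz_fourier_scaleR: "schwartz_fourier (c *\<^sub>R u) \<xi> = complex_of_real c * schwartz_fourier u \<xi>"
  by (simp add: schwartz_fourier_def fourier_def scaleR_schwartz.rep_eq mult.assoc)

lemma continuous_schwartz_fourier: "continuous_on A (schwartz_fourier u)"
  unfolding schwartz_fourier_def by (rule continuous_fourier[OF integrable_sfun_complex])

lemma integrable_schwartz_fourier_sq: "integrable lborel (\<lambda>\<xi>. (norm (schwartz_fourier u \<xi>))\<^sup>2)"
proof -
  obtain B where B: "\<And>x. \<bar>sfun u x\<bar> \<le> B" using sfun_bounded[of u] by blast
  show ?thesis unfolding schwartz_fourier_def
    by (rule plancherel_integrable[OF _ integrable_sfun_complex, of _ B])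
      (use B in \<open>auto intro!: continuous_intros continuous_sfun\<close>)
qed

lemma schwartz_fourier_delta:
  "schwartz_fourier (delta h n x) \<xi> = cis (- (\<xi> \<bullet> x)) * schwartz_fourier (delta h n 0) \<xi>"
proof -
  have "(\<lambda>y. complex_of_real (sfun (delta h n x) y)) = (\<lambda>y. complex_of_real (sfun (delta h n 0) (y - x)))"
    by (simp add: delta.rep_eq scaleR_right_diff_distrib)
  then show ?thesis
    using fourier_translate[of "\<lambda>y. complex_of_real (sfun (delta h n 0) y)" x \<xi>]
    by (simp add: schwartz_fourier_def)
qed

text \<open>The value in question is that of the transform of \<open>h\<close> at \<open>- \<xi> / n\<close>.\<close>

lemma schwartz_fourier_delta_nonzero:
  assumes h: "mollifier h" and n: "1 \<le> n"
  shows "schwartz_fourier (delta h n 0) \<xi> \<noteq> 0"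
proof -
  let ?F = "\<lambda>x. complex_of_real (sfun h x) * cis (\<xi> \<bullet> x / real n)"
  have n0: "- real n \<noteq> 0" using n by simp
  have "(\<integral>x. ?F x \<partial>lborel) = \<bar>- real n\<bar> ^ DIM(real^2) *\<^sub>R (\<integral>y. ?F ((- real n) *\<^sub>R y) \<partial>lborel)"
    by (rule lborel_integral_scale[OF _ n0]) measurable
  also have "\<dots> = (\<integral>y. (real n)\<^sup>2 *\<^sub>R ?F ((- real n) *\<^sub>R y) \<partial>lborel)" by simp
  also have "\<dots> = schwartz_fourier (delta h n 0) \<xi>"
    unfolding schwartz_fourier_def fourier_def
  proof (rule Bochner_Integration.integral_cong[OF refl])
    fix y
    have "\<xi> \<bullet> ((- real n) *\<^sub>R y) / real n = - (\<xi> \<bullet> y)"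
      using n by (simp only: inner_scaleR_right) simp
    moreover have "sfun (delta h n 0) y = (real n)\<^sup>2 * sfun h ((- real n) *\<^sub>R y)"
      unfolding delta.rep_eq by (simp only: diff_0 scaleR_minus_left scaleR_minus_right)
    ultimately show "(real n)\<^sup>2 *\<^sub>R ?F ((- real n) *\<^sub>R y) = complex_of_real (sfun (delta h n 0) y) * cis (- (\<xi> \<bullet> y))"
      by (simp only: scaleR_conv_of_real of_real_mult mult.assoc)
  qed
  finally have "schwartz_fourier (delta h n 0) \<xi> = (\<integral>x. ?F x \<partial>lborel)" ..
  moreover have "(\<integral>x. ?F x \<partial>lborel) = (CLINT x|lborel. complex_of_real (sfun h x) *
      exp (- \<i> * complex_of_real ((- (1 / real n) *\<^sub>R \<xi>) \<bullet> x)))"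
    by (simp add: cis_conv_exp)
  ultimately show ?thesis using h unfolding mollifier_def by (simp only: not_False_eq_True)
qed

text \<open>The span is taken over the reals, so a complex combination of translates is represented by its
  real part \<open>a\<close> and its imaginary part \<open>b\<close>.\<close>

lemma trig_poly_times_delta:
  assumes "trig_poly P"
  shows "\<exists>a\<in>span (delta h n ` dyadic). \<exists>b\<in>span (delta h n ` dyadic).
    \<forall>\<xi>. P \<xi> * schwartz_fourier (delta h n 0) \<xi> = schwartz_fourier a \<xi> + \<i> * schwartz_fourier b \<xi>"
  using assms
proof (induction P rule: trig_poly.induct)
  case (monomial x c)
  let ?d = "delta h n x"
  have "?d \<in> span (delta h n ` dyadic)" using monomial by (intro span_base) auto
  then have "Re c *\<^sub>R ?d \<in> span (delta h n ` dyadic)" "Im c *\<^sub>R ?d \<in> span (delta h n ` dyadic)"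
    by (auto intro: span_scale)
  moreover have "c * cis (- (\<xi> \<bullet> x)) * schwartz_fourier (delta h n 0) \<xi> =
      schwartz_fourier (Re c *\<^sub>R ?d) \<xi> + \<i> * schwartz_fourier (Im c *\<^sub>R ?d) \<xi>" for \<xi>
  proof -
    have "c * z = complex_of_real (Re c) * z + \<i> * (complex_of_real (Im c) * z)" for z
      by (subst (1) complex_eq[of c]) (simp add: algebra_simps)
    then show ?thesis
      unfolding schwartz_fourier_scaleR schwartz_fourier_delta[of h n x] mult.assoc by blast
  qed
  ultimately show ?case by blast
next
  case (add P Q)
  then obtain a b a' b' where
    "a \<in> span (delta h n ` dyadic)" "b \<in> span (delta h n ` dyadic)"
    "a' \<in> span (delta h n ` dyadic)" "b' \<in> span (delta h n ` dyadic)" and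
    "\<And>\<xi>. P \<xi> * schwartz_fourier (delta h n 0) \<xi> = schwartz_fourier a \<xi> + \<i> * schwartz_fourier b \<xi>"
    "\<And>\<xi>. Q \<xi> * schwartz_fourier (delta h n 0) \<xi> = schwartz_fourier a' \<xi> + \<i> * schwartz_fourier b' \<xi>"
    by metis
  then show ?case
    by (intro bexI[of _ "a + a'"] bexI[of _ "b + b'"])
      (auto intro: span_add simp: schwartz_fourier_add algebra_simps)
qed

text \<open>Wiener's theorem on translates in \<open>L\<^sup>2\<close>. The approximation found on the Fourier side corresponds to
  a complex combination \<open>a + \<i> b\<close>; since \<open>u\<close> is real, dropping \<open>b\<close> does not increase the distance to \<open>u\<close>.\<close>

lemma delta_span_L2_dense:
  assumes h: "mollifier h" and n: "1 \<le> n" and eps: "0 < \<epsilon>"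
  shows "\<exists>a\<in>span (delta h n ` dyadic). (\<integral>x. (sfun (u - a) x)\<^sup>2 \<partial>lborel) < \<epsilon>"
proof -
  let ?H = "schwartz_fourier (delta h n 0)"
  obtain P where P: "trig_poly P" "(\<integral>\<xi>. (norm (schwartz_fourier u \<xi> - P \<xi> * ?H \<xi>))\<^sup>2 \<partial>lborel) < \<epsilon>"
    using trig_poly_weighted_dense[OF continuous_schwartz_fourier[of _ u] integrable_schwartz_fourier_sq
      continuous_schwartz_fourier integrable_schwartz_fourier_sq schwartz_fourier_delta_nonzero[OF h n] eps] by blast
  obtain a b where a: "a \<in> span (delta h n ` dyadic)"
    and ab: "\<And>\<xi>. P \<xi> * ?H \<xi> = schwartz_fourier a \<xi> + \<i> * schwartz_fourier b \<xi>"
    using trig_poly_times_delta[OF P(1)] by blast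
  let ?v = "\<lambda>x. complex_of_real (sfun (u - a) x) - \<i> * complex_of_real (sfun b x)"
  have int: "integrable lborel ?v" using integrable_sfun_complex by simp
  have cont: "continuous_on UNIV ?v" by (intro continuous_intros continuous_sfun)
  obtain B where B: "\<And>x. \<bar>sfun (u - a) x\<bar> \<le> B" using sfun_bounded[of "u - a"] by blast
  obtain C where C: "\<And>x. \<bar>sfun b x\<bar> \<le> C" using sfun_bounded[of b] by blast
  have bnd: "norm (?v x) \<le> B + C" for x
    using norm_triangle_ineq4[of "complex_of_real (sfun (u - a) x)" "\<i> * complex_of_real (sfun b x)"] B[of x] C[of x]
    by (simp add: norm_mult)
  have F: "fourier ?v \<xi> = schwartz_fourier u \<xi> - P \<xi> * ?H \<xi>" for \<xi>
  proof -
    have "fourier ?v \<xi> = schwartz_fourier (u - a) \<xi> - \<i> * schwartz_fourier b \<xi>"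
      using integrable_fourier[OF integrable_sfun_complex]
      by (simp add: schwartz_fourier_def fourier_def left_diff_distrib mult.assoc)
    also have "schwartz_fourier (u - a) \<xi> = schwartz_fourier u \<xi> - schwartz_fourier a \<xi>"
      using schwartz_fourier_add[of "u - a" a \<xi>] by simp
    finally show ?thesis unfolding ab by simp
  qed
  have sq: "(norm (?v x))\<^sup>2 = (sfun (u - a) x)\<^sup>2 + (sfun b x)\<^sup>2" for x
    by (simp add: cmod_power2)
  have "(\<integral>x. (sfun (u - a) x)\<^sup>2 \<partial>lborel) \<le> (\<integral>x. (norm (?v x))\<^sup>2 \<partial>lborel)"
    unfolding sq by (rule integral_mono) (auto intro!: integrable_sfun_sq Bochner_Integration.integrable_add)
  also have "\<dots> \<le> (2 * pi) ^ DIM(real^2) * (\<integral>x. (norm (?v x))\<^sup>2 \<partial>lborel)"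
  proof -
    have "1 \<le> 2 * pi" using pi_gt3 by simp
    then have "1 \<le> (2 * pi) ^ DIM(real^2)" by (rule one_le_power)
    then show ?thesis using mult_right_mono[of 1 "(2 * pi) ^ DIM(real^2)" "\<integral>x. (norm (?v x))\<^sup>2 \<partial>lborel"] by simp
  qed
  also have "\<dots> = (\<integral>\<xi>. (norm (fourier ?v \<xi>))\<^sup>2 \<partial>lborel)"
    by (rule plancherel[OF cont int bnd, symmetric])
  also have "\<dots> < \<epsilon>" unfolding F by (rule P(2))
  finally show ?thesis using a by blast
qed

section \<open>Continuous dependence of translates on the base point\<close>

lemma pds_eq_zero_off_closed:
  assumes S: "closed S" and f: "\<And>x. x \<notin> S \<Longrightarrow> f x = 0"
  shows "x \<notin> S \<Longrightarrow> pds a f x = 0"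
proof (induction a arbitrary: x)
  case Nil
  then show ?case using f by simp
next
  case (Cons i a)
  have "(pds a f has_derivative (\<lambda>_. 0)) (at x)"
    by (rule has_derivative_transform_within_open[of "\<lambda>_. 0" _ _ _ "- S"])
      (use Cons S in \<open>auto simp: open_Compl\<close>)
  then have "frechet_derivative (pds a f) (at x) = (\<lambda>_. 0)" by (rule frechet_derivative_at[symmetric])
  then show ?case by (simp add: pd_def[of i])
qed

lemma compact_support_uniformly_continuous:
  fixes F :: "'a::euclidean_space \<Rightarrow> real"
  assumes F: "continuous_on UNIV F" and supp: "\<And>x. \<rho> < norm x \<Longrightarrow> F x = 0" and e: "0 < e"
  shows "\<exists>d>0. \<forall>p q. dist p q < d \<longrightarrow> \<bar>F p - F q\<bar> < e"
proof -
  have "uniformly_continuous_on (cball 0 (\<rho> + 1)) F"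
    by (intro compact_uniformly_continuous continuous_on_subset[OF F]) auto
  then obtain d where d: "0 < d" "\<forall>p\<in>cball 0 (\<rho> + 1). \<forall>q\<in>cball 0 (\<rho> + 1). dist q p < d \<longrightarrow> dist (F q) (F p) < e"
    unfolding uniformly_continuous_on_def using e by metis
  have "\<bar>F p - F q\<bar> < e" if pq: "dist p q < min d 1" for p q
  proof (cases "p \<in> cball 0 (\<rho> + 1) \<and> q \<in> cball 0 (\<rho> + 1)")
    case True
    then have "dist (F p) (F q) < e" using pq d(2) by (auto simp del: mem_cball)
    then show ?thesis by (simp add: dist_real_def)
  next
    case False
    have "norm p \<le> norm q + dist p q" "norm q \<le> norm p + dist p q"
      using norm_triangle_sub[of p q] norm_triangle_sub[of q p] by (auto simp: dist_norm norm_minus_commute)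
    with False pq have "\<rho> < norm p" "\<rho> < norm q" by auto
    then show ?thesis using supp e by simp
  qed
  then show ?thesis using d(1) by (intro exI[of _ "min d 1"]) auto
qed

lemma seminorm_le:
  assumes "\<And>y. norm y ^ N * \<bar>pds a (sfun u) y\<bar> \<le> B"
  shows "seminorm N a u \<le> B"
  unfolding seminorm_def by (rule cSUP_least) (use assms in auto)

lemma pds_delta_diff:
  "pds a (sfun (delta h n x' - delta h n x)) y =
    (real n)\<^sup>2 * (- real n) ^ length a * (pds a (sfun h) (real n *\<^sub>R (x' - y)) - pds a (sfun h) (real n *\<^sub>R (x - y)))"
proof -
  have s: "smooth (sfun h)" using sfun[of h] by (auto simp: schwartz_fun_def)
  have eq: "sfun (delta h n x' - delta h n x) =
      (\<lambda>y. (real n)\<^sup>2 * sfun h (real n *\<^sub>R (x' - y)) + (- (real n)\<^sup>2) * sfun h (real n *\<^sub>R (x - y)))"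
    by (rule ext) (simp add: sfun_diff delta.rep_eq)
  show ?thesis
    unfolding eq pds_add[OF smooth_cmult[OF smooth_affine[OF s]] smooth_cmult[OF smooth_affine[OF s]]]
      pds_cmult[OF smooth_affine[OF s]] pds_affine[OF s]
    by (simp add: algebra_simps)
qed

text \<open>The derivatives of \<open>\<delta>\<^sub>n\<^sub>,\<^sub>x\<close> are scaled and shifted copies of those of \<open>h\<close>, which are uniformly
  continuous; compact support restricts the growing factor \<open>\<bar>y\<bar>\<^sup>N\<close> to a bounded set.\<close>

lemma seminorm_delta_tendsto:
  assumes h: "compactly_supported (sfun h)" and e: "0 < e"
  shows "\<forall>\<^sub>F x' in at x. seminorm N a (delta h n x' - delta h n x) < e"
proof -
  let ?D = "pds a (sfun h)" and ?S = "closure {x. sfun h x \<noteq> 0}"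
  have s: "smooth (sfun h)" using sfun[of h] by (auto simp: schwartz_fun_def)
  have "bounded ?S" using h by (simp add: compactly_supported_def compact_imp_bounded)
  then obtain \<rho> where \<rho>: "\<And>x. x \<in> ?S \<Longrightarrow> norm x \<le> \<rho>" unfolding bounded_iff by blast
  have off: "sfun h x = 0" if "x \<notin> ?S" for x using that closure_subset[of "{x. sfun h x \<noteq> 0}"] by auto
  have supp: "?D z = 0" if "\<rho> < norm z" for z
  proof -
    have z: "z \<notin> ?S" using \<rho>[of z] that by linarith
    show ?thesis by (rule pds_eq_zero_off_closed[of ?S "sfun h", OF closed_closure off z])
  qed
  have cont: "continuous_on UNIV ?D"
    by (intro continuous_at_imp_continuous_on ballI differentiable_imp_continuous_within smoothD[OF s])
  define \<rho>' where "\<rho>' = max 0 \<rho>"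
  define R where "R = norm x + 1 + \<rho>'"
  define C where "C = (real n)\<^sup>2 * real n ^ length a"
  have R: "0 \<le> R" "0 \<le> C" by (auto simp: R_def \<rho>'_def C_def)
  define e' where "e' = e / (2 * (R ^ N * C + 1))"
  have pos: "0 < R ^ N * C + 1" using R by (simp add: add_nonneg_pos)
  have e': "0 < e'" using e pos by (simp add: e'_def)
  obtain d where d: "0 < d" "\<And>p q. dist p q < d \<Longrightarrow> \<bar>?D p - ?D q\<bar> < e'"
    using compact_support_uniformly_continuous[OF cont supp e'] by blast
  define d' where "d' = min 1 (d / (real n + 1))"
  have d': "0 < d'" using d(1) by (simp add: d'_def)
  have "seminorm N a (delta h n x' - delta h n x) < e" if x': "dist x' x < d'" for x'
  proof -
    have "norm y ^ N * \<bar>pds a (sfun (delta h n x' - delta h n x)) y\<bar> \<le> R ^ N * C * e'" for y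
    proof -
      let ?p = "real n *\<^sub>R (x' - y)" and ?q = "real n *\<^sub>R (x - y)"
      have eq: "\<bar>pds a (sfun (delta h n x' - delta h n x)) y\<bar> = C * \<bar>?D ?p - ?D ?q\<bar>"
        unfolding pds_delta_diff by (simp add: abs_mult power_abs C_def)
      have "dist ?p ?q = real n * dist x' x"
        by (simp add: dist_norm flip: scaleR_right_diff_distrib)
      also have "\<dots> \<le> real n * (d / (real n + 1))"
        using x' by (intro mult_left_mono) (auto simp: d'_def)
      also have "\<dots> < d" using d(1) by (simp add: field_simps)
      finally have close: "\<bar>?D ?p - ?D ?q\<bar> \<le> e'" using d(2) less_imp_le by blast
      show ?thesis
      proof (cases "norm y \<le> R")
        case True
        then have "norm y ^ N * (C * \<bar>?D ?p - ?D ?q\<bar>) \<le> R ^ N * (C * e')"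
          using R close by (intro mult_mono power_mono) auto
        then show ?thesis unfolding eq by (simp add: mult.assoc)
      next
        case False
        then have y: "norm x + 1 + \<rho>' < norm y" by (simp add: R_def)
        have "norm x' \<le> norm x + 1" using norm_triangle_sub[of x' x] x' by (simp add: dist_norm d'_def)
        then have far: "\<rho>' < norm (x' - y)" "\<rho>' < norm (x - y)"
          using norm_triangle_sub[of y x'] norm_triangle_sub[of y x] y by (simp_all add: norm_minus_commute)
        have "?D ?p = ?D ?q"
        proof (cases "n = 0")
          case False
          have "\<rho> < norm ?p" "\<rho> < norm ?q"
          proof -
            have "norm v \<le> norm (real n *\<^sub>R v)" for v :: "real^2"
              using False mult_right_mono[of 1 "real n" "norm v"] by simp
            from this[of "x' - y"] this[of "x - y"] far show "\<rho> < norm ?p" "\<rho> < norm ?q"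
              by (auto simp: \<rho>'_def simp del: norm_scaleR)
          qed
          then show ?thesis using supp by simp
        qed simp
        then show ?thesis unfolding eq using R e' by simp
      qed
    qed
    then have "seminorm N a (delta h n x' - delta h n x) \<le> R ^ N * C * e'" by (rule seminorm_le)
    also have "\<dots> \<le> (R ^ N * C + 1) * e'" using e' by (intro mult_right_mono) auto
    also have "\<dots> = e / 2" using pos by (simp add: e'_def field_simps)
    also have "\<dots> < e" using e by simp
    finally show ?thesis .
  qed
  then show ?thesis unfolding eventually_at using d' by blast
qed

lemma continuous_tempered_delta:
  assumes h: "compactly_supported (sfun h)" and \<phi>: "\<phi> \<in> tempered"
  shows "continuous_on UNIV (\<lambda>x. \<phi> (delta h n x))"
proof (intro continuous_at_imp_continuous_on ballI)
  fix x
  show "isCont (\<lambda>x. \<phi> (delta h n x)) x"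
    unfolding continuous_at tendsto_iff
  proof (intro allI impI)
    fix e :: real assume "0 < e"
    have "open (\<phi> -` ball (\<phi> (delta h n x)) e)"
      using \<phi> open_vimage[OF open_ball] by (auto simp: tempered_def)
    moreover have "delta h n x \<in> \<phi> -` ball (\<phi> (delta h n x)) e" using \<open>0 < e\<close> by simp
    ultimately obtain K d where "0 < d" and
      K: "\<And>g. (\<forall>N a. N \<le> K \<and> length a \<le> K \<longrightarrow> seminorm N a (g - delta h n x) < d) \<Longrightarrow> g \<in> \<phi> -` ball (\<phi> (delta h n x)) e"
      unfolding open_schwartz_def by blast
    have fin: "finite ({..K} \<times> {a :: 2 list. set a \<subseteq> UNIV \<and> length a \<le> K})"
      by (intro finite_cartesian_product finite_lists_length_le) auto
    have "\<forall>\<^sub>F x' in at x. \<forall>(N, a)\<in>{..K} \<times> {a :: 2 list. set a \<subseteq> UNIV \<and> length a \<le> K}.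
        seminorm N a (delta h n x' - delta h n x) < d"
      by (rule eventually_ball_finite[OF fin]) (use seminorm_delta_tendsto[OF h \<open>0 < d\<close>] in auto)
    then show "\<forall>\<^sub>F x' in at x. dist (\<phi> (delta h n x')) (\<phi> (delta h n x)) < e"
    proof eventually_elim
      case (elim x')
      have "delta h n x' \<in> \<phi> -` ball (\<phi> (delta h n x)) e" by (rule K) (use elim in auto)
      then show ?case by (simp add: dist_commute)
    qed
  qed
qed

section \<open>Riemann sums over the dyadic grids\<close>

lemma finite_lattice_box: "finite {x \<in> lattice m. \<forall>i. a \<le> x $ i \<and> x $ i \<le> b}"
proof -
  define A where "A = (\<lambda>j::int. of_int j / 2 ^ m :: real) ` {\<lfloor>a * 2 ^ m\<rfloor> .. \<lceil>b * 2 ^ m\<rceil>}"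
  have "finite A" by (simp add: A_def)
  then have "finite (vec_lambda ` (PiE UNIV (\<lambda>_::2. A)))" by (intro finite_imageI finite_PiE) auto
  moreover have "{x \<in> lattice m. \<forall>i. a \<le> x $ i \<and> x $ i \<le> b} \<subseteq> vec_lambda ` (PiE UNIV (\<lambda>_::2. A))"
  proof
    fix x assume x: "x \<in> {x \<in> lattice m. \<forall>i. a \<le> x $ i \<and> x $ i \<le> b}"
    have "x $ i \<in> A" for i
    proof -
      obtain j :: int where j: "x $ i = of_int j / 2 ^ m" using x by (auto simp: lattice_def)
      moreover have "a \<le> x $ i" "x $ i \<le> b" using x by auto
      ultimately have "a * 2 ^ m \<le> of_int j" "of_int j \<le> b * 2 ^ m"
        by (simp_all add: pos_le_divide_eq pos_divide_le_eq)
      then have "j \<in> {\<lfloor>a * 2 ^ m\<rfloor> .. \<lceil>b * 2 ^ m\<rceil>}" by (simp add: floor_le_iff le_ceiling_iff)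
      then show ?thesis using j by (auto simp: A_def)
    qed
    then have "(\<lambda>i. x $ i) \<in> PiE UNIV (\<lambda>_. A)" by auto
    moreover have "x = vec_lambda (\<lambda>i. x $ i)" by simp
    ultimately show "x \<in> vec_lambda ` (PiE UNIV (\<lambda>_::2. A))" by blast
  qed
  ultimately show ?thesis by (rule finite_subset[rotated])
qed

lemma finite_grid: "finite (grid m)"
proof (rule finite_subset[OF _ finite_lattice_box[of m "- real m" "real m"]])
  show "grid m \<subseteq> {x \<in> lattice m. \<forall>i. - real m \<le> x $ i \<and> x $ i \<le> real m}"
  proof
    fix x assume x: "x \<in> grid m"
    have "\<bar>x $ i\<bar> \<le> real m" for i using x component_le_norm_cart[of x i] by (auto simp: grid_lattice)
    then show "x \<in> {x \<in> lattice m. \<forall>i. - real m \<le> x $ i \<and> x $ i \<le> real m}"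
      using x by (auto simp: grid_lattice abs_le_iff) (smt (verit))
  qed
qed

text \<open>The lower corners of the cells of side \<open>2\<^sup>-\<^sup>m\<close> that tile the cube; points of the upper faces are no
  lower corners, whence the strict inequality.\<close>

definition mesh_tags :: "nat \<Rightarrow> nat \<Rightarrow> (real^2) set" where
  "mesh_tags N m = {l \<in> lattice m. \<forall>i. - real N \<le> l $ i \<and> l $ i < real N}"

definition mesh_cell :: "nat \<Rightarrow> real^2 \<Rightarrow> (real^2) set" where
  "mesh_cell m l = cbox l (\<chi> i. l $ i + 1 / 2 ^ m)"

definition mesh :: "nat \<Rightarrow> nat \<Rightarrow> ((real^2) \<times> (real^2) set) set" where
  "mesh N m = (\<lambda>l. (l, mesh_cell m l)) ` mesh_tags N m"

definition cube :: "nat \<Rightarrow> (real^2) set" where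
  "cube N = cbox (\<chi> i. - real N) (\<chi> i. real N)"

lemma mem_mesh_cell: "x \<in> mesh_cell m l \<longleftrightarrow> (\<forall>i. l $ i \<le> x $ i \<and> x $ i \<le> l $ i + 1 / 2 ^ m)"
  by (simp add: mesh_cell_def mem_box_cart)

lemma mem_cube: "x \<in> cube N \<longleftrightarrow> (\<forall>i. - real N \<le> x $ i \<and> x $ i \<le> real N)"
  by (simp add: cube_def mem_box_cart)

lemma finite_mesh_tags: "finite (mesh_tags N m)"
  by (rule finite_subset[OF _ finite_lattice_box[of m "- real N" "real N"]])
    (auto simp: mesh_tags_def less_imp_le)

lemma lattice_step:
  assumes "l \<in> lattice m" "l $ i < of_int k / 2 ^ m"
  shows "l $ i + 1 / 2 ^ m \<le> of_int k / 2 ^ m"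
proof -
  obtain j :: int where j: "l $ i = of_int j / 2 ^ m" using assms by (auto simp: lattice_def)
  with assms(2) have "j < k" by (simp add: divide_strict_right_mono field_simps)
  then have "of_int (j + 1) / 2 ^ m \<le> (of_int k :: real) / 2 ^ m" by (intro divide_right_mono) auto
  then show ?thesis by (simp add: j add_divide_distrib)
qed

lemma mesh_cell_subset_cube:
  assumes l: "l \<in> mesh_tags N m" shows "mesh_cell m l \<subseteq> cube N"
proof
  fix x assume x: "x \<in> mesh_cell m l"
  have "- real N \<le> x $ i \<and> x $ i \<le> real N" for i
  proof -
    have "l $ i < of_int (int N * 2 ^ m) / 2 ^ m" using l by (simp add: mesh_tags_def)
    then have "l $ i + 1 / 2 ^ m \<le> of_int (int N * 2 ^ m) / 2 ^ m"
      using l by (intro lattice_step) (auto simp: mesh_tags_def)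
    then have up: "l $ i + 1 / 2 ^ m \<le> real N" by simp
    have "- real N \<le> l $ i" using l by (simp add: mesh_tags_def)
    moreover have "l $ i \<le> x $ i" "x $ i \<le> l $ i + 1 / 2 ^ m" using x by (auto simp: mem_mesh_cell)
    ultimately show ?thesis using up by linarith
  qed
  then show "x \<in> cube N" by (simp add: mem_cube)
qed

lemma mesh_cell_disjoint:
  assumes l: "l \<in> lattice m" "l' \<in> lattice m" "l \<noteq> l'"
  shows "interior (mesh_cell m l) \<inter> interior (mesh_cell m l') = {}"
proof -
  have *: False if "p \<in> lattice m" "p' \<in> lattice m" "p $ i < p' $ i"
    "x \<in> interior (mesh_cell m p)" "x \<in> interior (mesh_cell m p')" for p p' x i
  proof -
    obtain k :: int where k: "p' $ i = of_int k / 2 ^ m" using \<open>p' \<in> lattice m\<close> by (auto simp: lattice_def)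
    then have "p $ i + 1 / 2 ^ m \<le> p' $ i" using lattice_step[OF that(1), of i k] that(3) by simp
    moreover have "x $ i < p $ i + 1 / 2 ^ m" "p' $ i < x $ i"
      using that(4,5) by (auto simp: mesh_cell_def interior_cbox mem_box_cart)
    ultimately show False by linarith
  qed
  obtain i where "l $ i \<noteq> l' $ i" using l(3) by (auto simp: vec_eq_iff)
  then consider "l $ i < l' $ i" | "l' $ i < l $ i" by linarith
  then show ?thesis using * l(1,2) by cases blast+
qed

lemma mesh_covers_cube:
  assumes x: "x \<in> cube N" and N: "1 \<le> N" shows "\<exists>l\<in>mesh_tags N m. x \<in> mesh_cell m l"
proof -
  \<comment> \<open>The minimum assigns the points of the upper faces to the last layer of cells.\<close>
  define j where "j i = min \<lfloor>x $ i * 2 ^ m\<rfloor> (int N * 2 ^ m - 1)" for i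
  define l :: "real^2" where "l = (\<chi> i. of_int (j i) / 2 ^ m)"
  have li: "l $ i * 2 ^ m = of_int (j i)" for i by (simp add: l_def)
  have two: "(0::real) < 2 ^ m" by simp
  have bounds: "- real N * 2 ^ m \<le> of_int (j i)" "of_int (j i) < real N * 2 ^ m"
    "of_int (j i) \<le> x $ i * 2 ^ m" "x $ i * 2 ^ m \<le> of_int (j i) + 1" for i
  proof -
    have xi: "- real N \<le> x $ i" "x $ i \<le> real N" using x by (auto simp: mem_cube)
    then have xi': "- real N * 2 ^ m \<le> x $ i * 2 ^ m" "x $ i * 2 ^ m \<le> real N * 2 ^ m"
      by (intro mult_right_mono; simp)+
    have "of_int (- int N * 2 ^ m) \<le> x $ i * 2 ^ m" using xi' by simp
    then have "- int N * 2 ^ m \<le> \<lfloor>x $ i * 2 ^ m\<rfloor>" by (rule le_floor_iff[THEN iffD2])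
    moreover have "- int N * 2 ^ m \<le> int N * 2 ^ m - 1"
    proof -
      have "1 * 1 \<le> int N * 2 ^ m" using N by (intro mult_mono) auto
      then show ?thesis by simp
    qed
    ultimately have "- int N * 2 ^ m \<le> j i" by (simp add: j_def)
    then have "of_int (- int N * 2 ^ m) \<le> (of_int (j i) :: real)" by (rule of_int_le_iff[THEN iffD2])
    then show "- real N * 2 ^ m \<le> of_int (j i)" by simp
    have "j i \<le> int N * 2 ^ m - 1" by (simp add: j_def)
    then have "(of_int (j i) :: real) \<le> of_int (int N * 2 ^ m - 1)" by (rule of_int_le_iff[THEN iffD2])
    then show "of_int (j i) < real N * 2 ^ m" by simp
    show "of_int (j i) \<le> x $ i * 2 ^ m"
      by (rule order_trans[of _ "of_int \<lfloor>x $ i * 2 ^ m\<rfloor>"]) (auto simp: j_def)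
    show "x $ i * 2 ^ m \<le> of_int (j i) + 1"
      using xi'(2) real_of_int_floor_add_one_ge[of "x $ i * 2 ^ m"] by (auto simp: j_def min_def)
  qed
  have "l \<in> mesh_tags N m"
    unfolding mesh_tags_def lattice_def
  proof (intro CollectI conjI allI)
    fix i
    show "\<exists>j::int. l $ i = of_int j / 2 ^ m" by (auto simp: l_def)
    show "- real N \<le> l $ i" using bounds(1)[of i] two unfolding li[symmetric] by (simp only: mult_le_cancel_right_pos)
    show "l $ i < real N" using bounds(2)[of i] two unfolding li[symmetric] by (simp only: mult_less_cancel_right_pos)
  qed
  moreover have "x \<in> mesh_cell m l"
    unfolding mem_mesh_cell
  proof (intro allI conjI)
    fix i
    show "l $ i \<le> x $ i" using bounds(3)[of i] two unfolding li[symmetric] by (simp only: mult_le_cancel_right_pos)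
    have "x $ i * 2 ^ m \<le> (l $ i + 1 / 2 ^ m) * 2 ^ m"
      using bounds(4)[of i] by (simp add: distrib_right li)
    then show "x $ i \<le> l $ i + 1 / 2 ^ m" using two by (simp only: mult_le_cancel_right_pos)
  qed
  ultimately show ?thesis by blast
qed

lemma mesh_tagged_division:
  assumes N: "1 \<le> N" shows "mesh N m tagged_division_of cube N"
proof (rule tagged_division_ofI)
  show "finite (mesh N m)" by (simp add: mesh_def finite_mesh_tags)
  fix x K assume xK: "(x, K) \<in> mesh N m"
  then have x: "x \<in> mesh_tags N m" "K = mesh_cell m x" by (auto simp: mesh_def)
  show "x \<in> K" using x by (simp add: mem_mesh_cell)
  show "K \<subseteq> cube N" using mesh_cell_subset_cube x by blast
  show "\<exists>a b. K = cbox a b" using x by (auto simp: mesh_cell_def)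
  fix x' K' assume "(x', K') \<in> mesh N m" "(x, K) \<noteq> (x', K')"
  then have "x' \<in> mesh_tags N m" "K' = mesh_cell m x'" "x \<noteq> x'" using x by (auto simp: mesh_def)
  then show "interior K \<inter> interior K' = {}"
    using mesh_cell_disjoint[of x m x'] x by (simp add: mesh_tags_def)
next
  show "\<Union> {K. \<exists>x. (x, K) \<in> mesh N m} = cube N"
    using mesh_cell_subset_cube mesh_covers_cube[OF _ N] by (fastforce simp: mesh_def)
qed

lemma dist_mesh_cell:
  assumes "x \<in> mesh_cell m l" shows "dist l x \<le> 2 / 2 ^ m"
proof -
  have "dist l x \<le> (\<Sum>i\<in>UNIV. \<bar>(l - x) $ i\<bar>)" unfolding dist_norm by (rule norm_le_l1_cart)
  also have "\<dots> \<le> (\<Sum>i\<in>(UNIV :: 2 set). 1 / 2 ^ m)"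
  proof (rule sum_mono)
    fix i
    have "l $ i \<le> x $ i" "x $ i \<le> l $ i + 1 / 2 ^ m" using assms by (auto simp: mem_mesh_cell)
    then show "\<bar>(l - x) $ i\<bar> \<le> 1 / 2 ^ m" by simp
  qed
  finally show ?thesis by simp
qed

lemma content_mesh_cell: "measure lborel (mesh_cell m l) = 1 / 2 ^ (2 * m)"
proof -
  have "l \<in> mesh_cell m l" by (simp add: mem_mesh_cell)
  then have "cbox l (\<chi> i. l $ i + 1 / 2 ^ m) \<noteq> {}" by (auto simp: mesh_cell_def)
  then show ?thesis
    unfolding mesh_cell_def
    by (subst content_cbox_cart) (simp_all add: power_mult power2_eq_square power_mult_distrib[symmetric])
qed

lemma eventually_mesh_small: "0 < d \<Longrightarrow> \<forall>\<^sub>F m in sequentially. 2 / 2 ^ m < (d::real)"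
proof -
  assume d: "0 < d"
  have "(\<lambda>m. 2 * (1 / 2 :: real) ^ m) \<longlonglongrightarrow> 2 * 0" by (intro tendsto_intros) auto
  then have "(\<lambda>m. 2 / 2 ^ m :: real) \<longlonglongrightarrow> 0" by (simp add: power_one_over)
  then show ?thesis using d by (rule order_tendstoD)
qed

lemma mesh_fine: "2 / 2 ^ m < d \<Longrightarrow> (\<lambda>x. ball x d) fine mesh N m"
  unfolding fine_def mesh_def
proof (clarsimp)
  fix l x assume "2 / 2 ^ m < d" "x \<in> mesh_cell m l"
  then show "dist l x < d" using dist_mesh_cell[of x m l] by linarith
qed

lemma sum_mesh: "(\<Sum>(l, K)\<in>mesh N m. F l K) = (\<Sum>l\<in>mesh_tags N m. F l (mesh_cell m l))"
  unfolding mesh_def by (subst sum.reindex) (auto simp: inj_on_def)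

text \<open>Riemann integrability is Henstock-Kurzweil integrability with constant gauges, and Henstock's lemma
  passes from the total error to the sum of the absolute local errors.\<close>

lemma riemann_integrable_mesh:
  assumes g: "riemann_integrable g" and N: "1 \<le> N"
  shows "g integrable_on cube N"
    and "0 < e \<Longrightarrow> \<forall>\<^sub>F m in sequentially.
      (\<Sum>l\<in>mesh_tags N m. \<bar>1 / 2 ^ (2 * m) * g l - integral (mesh_cell m l) g\<bar>) \<le> e"
proof -
  obtain I where I: "\<forall>e>0. \<exists>d>0. \<forall>p. p tagged_division_of cube N \<and> (\<lambda>x. ball x d) fine p \<longrightarrow>
      \<bar>(\<Sum>(x, K)\<in>p. measure lborel K * g x) - I\<bar> < e"
    using g[unfolded riemann_integrable_def, THEN spec, THEN spec, of "\<chi> i. - real N" "\<chi> i. real N"]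
    unfolding cube_def by (elim exE)
  have int: "(g has_integral I) (cube N)"
    unfolding cube_def has_integral
  proof (intro allI impI)
    fix e :: real assume "0 < e"
    then obtain d where "0 < d" "\<forall>p. p tagged_division_of cube N \<and> (\<lambda>x. ball x d) fine p \<longrightarrow>
      \<bar>(\<Sum>(x, K)\<in>p. measure lborel K * g x) - I\<bar> < e" using I by blast
    then show "\<exists>\<gamma>. gauge \<gamma> \<and> (\<forall>\<D>. \<D> tagged_division_of cbox (\<chi> i. - real N) (\<chi> i. real N) \<and> \<gamma> fine \<D> \<longrightarrow>
        norm ((\<Sum>(x, k)\<in>\<D>. measure lborel k *\<^sub>R g x) - I) < e)"
      by (intro exI[of _ "\<lambda>x. ball x d"]) (auto simp: cube_def)
  qed
  then show "g integrable_on cube N" by blast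
  assume e: "0 < e"
  then obtain d where d: "0 < d" "\<And>p. p tagged_division_of cube N \<Longrightarrow> (\<lambda>x. ball x d) fine p \<Longrightarrow>
      \<bar>(\<Sum>(x, K)\<in>p. measure lborel K * g x) - I\<bar> < e / 2" using I[rule_format, of "e / 2"] by auto
  show "\<forall>\<^sub>F m in sequentially.
      (\<Sum>l\<in>mesh_tags N m. \<bar>1 / 2 ^ (2 * m) * g l - integral (mesh_cell m l) g\<bar>) \<le> e"
    using eventually_mesh_small[OF d(1)]
  proof eventually_elim
    case (elim m)
    have "(\<Sum>(x, k)\<in>mesh N m. norm (measure lborel k *\<^sub>R g x - integral k g)) \<le> 2 * real DIM(real) * (e / 2)"
    proof (rule Henstock_lemma_part2[where d = "\<lambda>x. ball x d"])
      show "g integrable_on cbox (\<chi> i. - real N) (\<chi> i. real N)" using int unfolding cube_def by blast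
      show "mesh N m tagged_partial_division_of cbox (\<chi> i. - real N) (\<chi> i. real N)"
        using mesh_tagged_division[OF N, of m] by (simp add: cube_def tagged_division_of_def)
      show "norm ((\<Sum>(x, k)\<in>\<D>. measure lborel k *\<^sub>R g x) - integral (cbox (\<chi> i. - real N) (\<chi> i. real N)) g) < e / 2"
        if "\<D> tagged_division_of cbox (\<chi> i. - real N) (\<chi> i. real N)" "(\<lambda>x. ball x d) fine \<D>" for \<D>
        using d(2)[of \<D>] that integral_unique[OF int] by (simp add: cube_def)
    qed (use e d mesh_fine[OF elim] in auto)
    then show ?case by (simp add: sum_mesh content_mesh_cell)
  qed
qed

lemma integral_mesh:
  fixes F :: "real^2 \<Rightarrow> real"
  assumes "F integrable_on cube N" and N: "1 \<le> N"
  shows "integral (cube N) F = (\<Sum>l\<in>mesh_tags N m. integral (mesh_cell m l) F)"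
proof -
  have "integral (cube N) F = (\<Sum>(x, k)\<in>mesh N m. integral k F)"
    using integral_combine_tagged_division_topdown[of F _ _ "mesh N m"] assms mesh_tagged_division[OF N, of m]
    by (simp add: cube_def)
  then show ?thesis by (simp add: sum_mesh)
qed

lemma integrable_on_mesh_cell:
  fixes F :: "real^2 \<Rightarrow> real"
  assumes "F integrable_on cube N" "l \<in> mesh_tags N m"
  shows "F integrable_on mesh_cell m l"
  using integrable_on_subcbox mesh_cell_subset_cube[OF assms(2)] assms(1)
  unfolding cube_def mesh_cell_def by blast

lemma sum_grid_eq_sum_mesh:
  assumes supp: "\<And>x. g x \<noteq> 0 \<Longrightarrow> norm x < real N" and m: "N \<le> m" and F: "\<And>x. g x = 0 \<Longrightarrow> F x = 0"
  shows "sum F (grid m) = sum F (mesh_tags N m)"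
proof (rule sum.mono_neutral_cong)
  show "F x = 0" if "x \<in> mesh_tags N m - grid m" for x
  proof (rule F, rule ccontr)
    assume "g x \<noteq> 0"
    then have "norm x \<le> real m" using supp[of x] m by simp
    then show False using that by (auto simp: mesh_tags_def grid_lattice)
  qed
  show "F x = 0" if "x \<in> grid m - mesh_tags N m" for x
  proof (rule F, rule ccontr)
    assume "g x \<noteq> 0"
    then have "\<bar>x $ i\<bar> < real N" for i using supp[of x] component_le_norm_cart[of x i] by linarith
    then have "x \<in> mesh_tags N m" using that by (auto simp: mesh_tags_def grid_lattice abs_less_iff less_imp_le) (smt (verit))
    then show False using that by simp
  qed
qed (simp_all add: finite_grid finite_mesh_tags)

text \<open>Replacing \<open>w\<close> on each cell by its value at the tag costs its modulus of continuity times the integral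
  of \<open>\<bar>g\<bar>\<close>. After that \<open>w\<close> appears only as a bounded factor of the local errors of \<open>g\<close>, which are small in
  absolute sum.\<close>

lemma
  fixes w g :: "real^2 \<Rightarrow> real"
  assumes supp: "\<And>x. g x \<noteq> 0 \<Longrightarrow> norm x < real N" and N: "1 \<le> N"
    and g: "riemann_integrable g" "integrable lebesgue g" and w: "continuous_on UNIV w"
  shows grid_sum_tendsto: "(\<lambda>m. 1 / 2 ^ (2 * m) * (\<Sum>l\<in>grid m. w l * g l)) \<longlonglongrightarrow> (\<integral>x. w x * g x \<partial>lebesgue)"
    and grid_sum_abs_bounded: "Bseq (\<lambda>m. 1 / 2 ^ (2 * m) * (\<Sum>l\<in>grid m. \<bar>g l\<bar>))"
proof -
  have zero: "g x = 0" if "x \<notin> cube N" for x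
  proof (rule ccontr)
    assume "g x \<noteq> 0"
    then have "\<bar>x $ i\<bar> < real N" for i using supp[of x] component_le_norm_cart[of x i] by linarith
    then have "x \<in> cube N" by (auto simp: mem_cube abs_less_iff less_imp_le) (smt (verit))
    with that show False by simp
  qed
  have lint: "(F has_integral (\<integral>x. F x \<partial>lebesgue)) (cube N)" if "integrable lebesgue F" "\<And>x. g x = 0 \<Longrightarrow> F x = 0" for F :: "real^2 \<Rightarrow> real"
  proof -
    have "(F has_integral (\<integral>x. F x \<partial>lebesgue)) UNIV" by (rule has_integral_integral_lebesgue[OF that(1)])
    moreover have "F = (\<lambda>x. if x \<in> cube N then F x else 0)" using zero that(2) by auto
    ultimately show ?thesis by (metis has_integral_restrict_UNIV)
  qed
  have gint: "g integrable_on cube N" and gabs: "(\<lambda>x. \<bar>g x\<bar>) integrable_on cube N"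
    using lint[OF g(2)] lint[of "\<lambda>x. \<bar>g x\<bar>"] g(2) by auto
  define A where "A = integral (cube N) (\<lambda>x. \<bar>g x\<bar>)"
  have A: "0 \<le> A" unfolding A_def by (rule integral_nonneg[OF gabs]) simp
  have cell: "\<bar>integral (mesh_cell m l) g\<bar> \<le> integral (mesh_cell m l) (\<lambda>x. \<bar>g x\<bar>)" if "l \<in> mesh_tags N m" for l m
    using integral_norm_bound_integral[OF integrable_on_mesh_cell[OF gint that] integrable_on_mesh_cell[OF gabs that]] by simp
  show "Bseq (\<lambda>m. 1 / 2 ^ (2 * m) * (\<Sum>l\<in>grid m. \<bar>g l\<bar>))"
  proof (rule BfunI)
    show "\<forall>\<^sub>F m in sequentially. norm (1 / 2 ^ (2 * m) * (\<Sum>l\<in>grid m. \<bar>g l\<bar>)) \<le> A + 1"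
      using riemann_integrable_mesh(2)[OF g(1) N zero_less_one] eventually_ge_at_top[of N]
    proof eventually_elim
      case (elim m)
      have "1 / 2 ^ (2 * m) * (\<Sum>l\<in>grid m. \<bar>g l\<bar>) = (\<Sum>l\<in>mesh_tags N m. \<bar>1 / 2 ^ (2 * m) * g l\<bar>)"
      proof -
        have "(\<Sum>l\<in>grid m. \<bar>g l\<bar>) = (\<Sum>l\<in>mesh_tags N m. \<bar>g l\<bar>)"
          by (rule sum_grid_eq_sum_mesh[OF supp elim(2)]) auto
        then show ?thesis by (simp add: sum_distrib_left abs_mult)
      qed
      also have "\<dots> \<le> (\<Sum>l\<in>mesh_tags N m. integral (mesh_cell m l) (\<lambda>x. \<bar>g x\<bar>)
          + \<bar>1 / 2 ^ (2 * m) * g l - integral (mesh_cell m l) g\<bar>)"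
        by (intro sum_mono) (use cell in fastforce)
      also have "\<dots> = A + (\<Sum>l\<in>mesh_tags N m. \<bar>1 / 2 ^ (2 * m) * g l - integral (mesh_cell m l) g\<bar>)"
        by (simp add: sum.distrib A_def integral_mesh[OF gabs N, of m])
      finally show ?case using elim(1) by (simp add: sum_nonneg)
    qed
  qed
  have "compact (w ` cube N)"
    unfolding cube_def by (intro compact_continuous_image continuous_on_subset[OF w] compact_cbox) auto
  then have "bounded (w ` cube N)" by (rule compact_imp_bounded)
  then obtain W0 where W0: "\<And>x. x \<in> cube N \<Longrightarrow> \<bar>w x\<bar> \<le> W0"
    unfolding bounded_iff by auto
  define W where "W = max 0 W0"
  have W: "\<And>x. x \<in> cube N \<Longrightarrow> \<bar>w x\<bar> \<le> W" "0 \<le> W" using W0 by (auto simp: W_def le_max_iff_disj)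
  let ?F = "\<lambda>x. w x * g x"
  have Fint: "integrable lebesgue ?F"
  proof (rule Bochner_Integration.integrable_bound)
    show "integrable lebesgue (\<lambda>x. W * g x)" using g(2) by simp
    have "w \<in> borel_measurable lebesgue"
      using borel_measurable_continuous_onI[OF w] by (intro measurable_completion) simp
    then show "?F \<in> borel_measurable lebesgue" using g(2) by measurable
    have "\<bar>w x * g x\<bar> \<le> \<bar>W * g x\<bar>" for x
      using W(1)[of x] W(2) zero[of x] by (cases "x \<in> cube N") (auto simp: abs_mult intro!: mult_right_mono)
    then show "AE x in lebesgue. norm (?F x) \<le> norm (W * g x)" by simp
  qed
  have FJ: "(?F has_integral (\<integral>x. ?F x \<partial>lebesgue)) (cube N)" by (rule lint[OF Fint]) simp
  then have Fi: "?F integrable_on cube N" by blast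
  show "(\<lambda>m. 1 / 2 ^ (2 * m) * (\<Sum>l\<in>grid m. w l * g l)) \<longlonglongrightarrow> (\<integral>x. w x * g x \<partial>lebesgue)"
  proof (rule tendstoI)
    fix e :: real assume e: "0 < e"
    define \<omega> where "\<omega> = e / (2 * (A + 1))"
    define e1 where "e1 = e / (2 * (W + 1))"
    have pos: "0 < \<omega>" "0 < e1" using e A W(2) by (auto simp: \<omega>_def e1_def)
    have small: "\<omega> * A + W * e1 < e"
    proof -
      have "\<omega> * A < \<omega> * (A + 1)" using pos by simp
      also have "\<dots> = e / 2" using A by (simp add: \<omega>_def field_simps)
      finally have 1: "\<omega> * A < e / 2" .
      have "W * e1 \<le> (W + 1) * e1" using pos by simp
      also have "\<dots> = e / 2" using W(2) by (simp add: e1_def field_simps)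
      finally show ?thesis using 1 by linarith
    qed
    have "uniformly_continuous_on (cube N) w"
      unfolding cube_def by (intro compact_uniformly_continuous continuous_on_subset[OF w]) auto
    then obtain d where d: "0 < d" "\<And>x y. x \<in> cube N \<Longrightarrow> y \<in> cube N \<Longrightarrow> dist y x < d \<Longrightarrow> dist (w y) (w x) < \<omega>"
      unfolding uniformly_continuous_on_def using pos(1) by metis
    show "\<forall>\<^sub>F m in sequentially. dist (1 / 2 ^ (2 * m) * (\<Sum>l\<in>grid m. w l * g l)) (\<integral>x. w x * g x \<partial>lebesgue) < e"
      using riemann_integrable_mesh(2)[OF g(1) N pos(2)] eventually_ge_at_top[of N] eventually_mesh_small[OF d(1)]
    proof eventually_elim
      case (elim m)
      let ?K = "mesh_cell m"
      have one: "\<bar>1 / 2 ^ (2 * m) * (w l * g l) - integral (?K l) ?F\<bar> \<le>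
          W * \<bar>1 / 2 ^ (2 * m) * g l - integral (?K l) g\<bar> + \<omega> * integral (?K l) (\<lambda>x. \<bar>g x\<bar>)"
        if l: "l \<in> mesh_tags N m" for l
      proof -
        have lc: "l \<in> cube N" using mesh_cell_subset_cube[OF l] by (auto simp: mem_mesh_cell)
        have i1: "g integrable_on ?K l" "(\<lambda>x. \<bar>g x\<bar>) integrable_on ?K l" "?F integrable_on ?K l"
          using integrable_on_mesh_cell[OF _ l] gint gabs Fi by auto
        have "\<bar>integral (?K l) (\<lambda>x. w l * g x - w x * g x)\<bar> \<le> integral (?K l) (\<lambda>x. \<omega> * \<bar>g x\<bar>)"
        proof (rule integral_norm_bound_integral[where 'a = real, unfolded real_norm_def])
          show "(\<lambda>x. w l * g x - w x * g x) integrable_on ?K l"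
            by (intro integrable_diff integrable_on_mult_right i1)
          show "(\<lambda>x. \<omega> * \<bar>g x\<bar>) integrable_on ?K l" by (intro integrable_on_mult_right i1)
          show "\<bar>w l * g x - w x * g x\<bar> \<le> \<omega> * \<bar>g x\<bar>" if x: "x \<in> ?K l" for x
          proof -
            have "dist l x < d" using dist_mesh_cell[OF x] elim(3) by linarith
            then have "dist (w l) (w x) < \<omega>" using d(2) x lc mesh_cell_subset_cube[OF l] by blast
            then have "\<bar>w l - w x\<bar> * \<bar>g x\<bar> \<le> \<omega> * \<bar>g x\<bar>" by (intro mult_right_mono) (auto simp: dist_real_def)
            then show ?thesis by (simp add: abs_mult[symmetric] left_diff_distrib)
          qed
        qed
        moreover have "integral (?K l) (\<lambda>x. w l * g x - w x * g x) = w l * integral (?K l) g - integral (?K l) ?F"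
          by (simp add: integral_diff integrable_on_mult_right i1)
        ultimately have b2: "\<bar>w l * integral (?K l) g - integral (?K l) ?F\<bar> \<le> \<omega> * integral (?K l) (\<lambda>x. \<bar>g x\<bar>)"
          by simp
        have "\<bar>w l * (1 / 2 ^ (2 * m) * g l - integral (?K l) g)\<bar> \<le> W * \<bar>1 / 2 ^ (2 * m) * g l - integral (?K l) g\<bar>"
          unfolding abs_mult by (intro mult_right_mono W lc) auto
        moreover have "1 / 2 ^ (2 * m) * (w l * g l) - integral (?K l) ?F =
            w l * (1 / 2 ^ (2 * m) * g l - integral (?K l) g) + (w l * integral (?K l) g - integral (?K l) ?F)"
          by (simp add: algebra_simps)
        ultimately show ?thesis using b2 by linarith
      qed
      have "1 / 2 ^ (2 * m) * (\<Sum>l\<in>grid m. w l * g l) - (\<integral>x. w x * g x \<partial>lebesgue) =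
          (\<Sum>l\<in>mesh_tags N m. 1 / 2 ^ (2 * m) * (w l * g l) - integral (?K l) ?F)"
      proof -
        have "sum ?F (grid m) = sum ?F (mesh_tags N m)"
          by (rule sum_grid_eq_sum_mesh[OF supp elim(2)]) auto
        then show ?thesis
          using integral_mesh[OF Fi N, of m] integral_unique[OF FJ] by (simp add: sum_distrib_left sum_subtractf)
      qed
      then have "dist (1 / 2 ^ (2 * m) * (\<Sum>l\<in>grid m. w l * g l)) (\<integral>x. w x * g x \<partial>lebesgue) \<le>
          (\<Sum>l\<in>mesh_tags N m. \<bar>1 / 2 ^ (2 * m) * (w l * g l) - integral (?K l) ?F\<bar>)"
        unfolding dist_real_def by (simp only: sum_abs)
      also have "\<dots> \<le> (\<Sum>l\<in>mesh_tags N m. W * \<bar>1 / 2 ^ (2 * m) * g l - integral (?K l) g\<bar> + \<omega> * integral (?K l) (\<lambda>x. \<bar>g x\<bar>))"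
        by (intro sum_mono one)
      also have "\<dots> = W * (\<Sum>l\<in>mesh_tags N m. \<bar>1 / 2 ^ (2 * m) * g l - integral (?K l) g\<bar>) + \<omega> * A"
        by (simp only: sum.distrib A_def integral_mesh[OF gabs N, of m] sum_distrib_left)
      also have "\<dots> \<le> W * e1 + \<omega> * A" using elim(1) W(2) by (intro add_right_mono mult_left_mono)
      finally show ?case using small by linarith
    qed
  qed
qed

section \<open>Levy's upward theorem for approximating subalgebras\<close>

locale increasing_subalgebras = prob_space +
  fixes F :: "nat \<Rightarrow> 'a measure"
  assumes subalg: "\<And>m. subalgebra M (F m)"
    and increasing: "\<And>m m'. m \<le> m' \<Longrightarrow> sets (F m) \<subseteq> sets (F m')"
begin

lemma space_F: "space (F m) = space M" and sets_F: "sets (F m) \<subseteq> sets M"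
  using subalg[of m] by (auto simp: subalgebra_def)

lemma sigma_finite_F: "sigma_finite_subalgebra M (F m)"
  by (rule finite_measure_subalgebra_is_sigma_finite)
    (simp add: finite_measure_subalgebra_def finite_measure_subalgebra_axioms_def finite_measure_axioms subalg)

lemma measurable_F_mono:
  assumes "u \<in> measurable (F k) N" "k \<le> l" shows "u \<in> measurable (F l) N"
  using assms(1) increasing[OF assms(2)] by (auto simp: measurable_def space_F)

text \<open>These sets are the events that belong, up to null sets, to the \<open>\<sigma>\<close>-algebra generated by all \<open>F m\<close>.
  They are closed under complements, countable unions and null modifications, so it suffices to
  check the property on a generator.\<close>

definition approximable :: "'a set \<Rightarrow> bool" where
  "approximable A \<longleftrightarrow> A \<in> sets M \<and> (\<forall>e>0. \<exists>m. \<exists>B\<in>sets (F m). prob (sym_diff A B) < e)"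

lemma approximable_F: "A \<in> sets (F m) \<Longrightarrow> approximable A"
  using sets_F unfolding approximable_def by (intro conjI allI impI exI[of _ m] bexI[of _ A]) auto

lemma approximable_Un:
  assumes A: "approximable A" and B: "approximable B"
  shows "approximable (A \<union> B)"
  unfolding approximable_def
proof (intro conjI allI impI)
  have AM: "A \<in> sets M" "B \<in> sets M" using assms by (auto simp: approximable_def)
  then show "A \<union> B \<in> sets M" by auto
  fix e :: real assume e: "0 < e"
  then have "0 < e / 2" by simp
  obtain i A' where A': "A' \<in> sets (F i)" "prob (sym_diff A A') < e / 2"
    using A \<open>0 < e / 2\<close> unfolding approximable_def by blast
  obtain j B' where B': "B' \<in> sets (F j)" "prob (sym_diff B B') < e / 2"
    using B \<open>0 < e / 2\<close> unfolding approximable_def by blast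
  have in': "A' \<in> sets (F (max i j))" "B' \<in> sets (F (max i j))"
    using A' B' increasing[of i "max i j"] increasing[of j "max i j"] by auto
  have m: "A' \<in> sets M" "B' \<in> sets M" using in' sets_F by auto
  have "prob (sym_diff (A \<union> B) (A' \<union> B')) \<le> prob (sym_diff A A' \<union> sym_diff B B')"
    by (rule finite_measure_mono) (use AM m in auto)
  also have "\<dots> \<le> prob (sym_diff A A') + prob (sym_diff B B')"
    by (rule measure_Un_le) (use AM m in auto)
  also have "\<dots> < e" using A' B' by linarith
  finally show "\<exists>m. \<exists>C\<in>sets (F m). prob (sym_diff (A \<union> B) C) < e" using in' by blast
qed

lemma approximable_compl:
  assumes "approximable A" shows "approximable (space M - A)"
  unfolding approximable_def
proof (intro conjI allI impI)
  have A: "A \<in> sets M" using assms by (auto simp: approximable_def)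
  then show "space M - A \<in> sets M" by auto
  fix e :: real assume "0 < e"
  then obtain m B where B: "B \<in> sets (F m)" "prob (sym_diff A B) < e"
    using assms unfolding approximable_def by blast
  have "sym_diff (space M - A) (space M - B) = sym_diff A B"
    using A B(1) sets_F sets.sets_into_space by blast
  moreover have "space M - B \<in> sets (F m)" using B(1) by (metis sets.compl_sets space_F)
  ultimately show "\<exists>m. \<exists>C\<in>sets (F m). prob (sym_diff (space M - A) C) < e" using B(2) by metis
qed

text \<open>Finite unions exhaust the countable one by continuity from below.\<close>

lemma approximable_countable_Un:
  assumes A: "\<And>i::nat. approximable (A i)" shows "approximable (\<Union>i. A i)"
  unfolding approximable_def
proof (intro conjI allI impI)
  have AM: "A i \<in> sets M" for i using A by (auto simp: approximable_def)
  then show "(\<Union>i. A i) \<in> sets M" by auto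
  fix e :: real assume e: "0 < e"
  then have "0 < e / 2" by simp
  define C where "C n = (\<Union>i\<le>n. A i)" for n
  have CM: "C n \<in> sets M" for n using AM by (auto simp: C_def)
  have UC: "(\<Union>n. C n) = (\<Union>i. A i)" by (auto simp: C_def)
  have C: "approximable (C n)" for n
  proof (induction n)
    case 0 then show ?case using A by (simp add: C_def)
  next
    case (Suc n)
    have "C (Suc n) = C n \<union> A (Suc n)" by (auto simp: C_def le_Suc_eq)
    then show ?case using Suc A approximable_Un by simp
  qed
  have "(\<lambda>n. prob (C n)) \<longlonglongrightarrow> prob (\<Union>n. C n)"
    by (rule finite_Lim_measure_incseq) (use CM in \<open>auto simp: C_def incseq_def intro: order_trans\<close>)
  then obtain n where n: "prob (\<Union>i. A i) - prob (C n) < e / 2"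
    using \<open>0 < e / 2\<close> unfolding UC LIMSEQ_iff by (metis abs_minus_commute abs_less_iff order_refl real_norm_def minus_diff_eq)
  obtain m B where B: "B \<in> sets (F m)" "prob (sym_diff (C n) B) < e / 2"
    using C[of n] \<open>0 < e / 2\<close> unfolding approximable_def by blast
  have BM: "B \<in> sets M" using B sets_F by auto
  have sub: "C n \<subseteq> (\<Union>i. A i)" by (auto simp: C_def)
  have "prob (sym_diff (\<Union>i. A i) B) \<le> prob (((\<Union>i. A i) - C n) \<union> sym_diff (C n) B)"
    by (rule finite_measure_mono) (use AM CM BM sub in auto)
  also have "\<dots> \<le> prob ((\<Union>i. A i) - C n) + prob (sym_diff (C n) B)"
    by (rule measure_Un_le) (use AM CM BM in auto)
  also have "prob ((\<Union>i. A i) - C n) = prob (\<Union>i. A i) - prob (C n)"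
    by (rule finite_measure_Diff) (use AM CM sub in auto)
  finally have "prob (sym_diff (\<Union>i. A i) B) < e" using n B(2) by linarith
  then show "\<exists>m. \<exists>B\<in>sets (F m). prob (sym_diff (\<Union>i. A i) B) < e" using B(1) by blast
qed

lemma approximable_sigma_sets:
  assumes "A \<in> sigma_sets (space M) G" "\<And>B. B \<in> G \<Longrightarrow> approximable B"
  shows "approximable A"
  using assms
proof induction
  case Empty
  show ?case by (rule approximable_F[of _ 0]) simp
next
  case (Compl A) then show ?case using approximable_compl by simp
next
  case (Union A) then show ?case using approximable_countable_Un by simp
qed auto

lemma approximable_AE_eq:
  assumes B: "approximable B" and A: "A \<in> sets M" and eq: "AE x in M. x \<in> A \<longleftrightarrow> x \<in> B"
  shows "approximable A"
  unfolding approximable_def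
proof (intro conjI allI impI A)
  fix e :: real assume "0 < e"
  then obtain m C where C: "C \<in> sets (F m)" "prob (sym_diff B C) < e"
    using B unfolding approximable_def by blast
  have "prob (sym_diff A C) = prob (sym_diff B C)"
    by (rule finite_measure_eq_AE) (use eq A B C sets_F in \<open>auto simp: approximable_def\<close>)
  then show "\<exists>m. \<exists>B\<in>sets (F m). prob (sym_diff A B) < e" using C by metis
qed

lemma L1_approximation:
  fixes f :: "'a \<Rightarrow> real"
  assumes all: "\<And>A. A \<in> sets M \<Longrightarrow> approximable A" and f: "integrable M f" and e: "0 < e"
  shows "\<exists>m. \<exists>g\<in>borel_measurable (F m). integrable M g \<and> (\<integral>x. \<bar>f x - g x\<bar> \<partial>M) < e"
  using f e
proof (induction f arbitrary: e rule: integrable_induct)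
  case (base A c)
  have pos: "0 < e / (\<bar>c\<bar> + 1)" using base by simp
  obtain m B where B: "B \<in> sets (F m)" "prob (sym_diff A B) < e / (\<bar>c\<bar> + 1)"
    using all[OF base(1)] pos unfolding approximable_def by blast
  have BM [measurable]: "B \<in> sets M" using B sets_F by auto
  have [measurable]: "A \<in> sets M" by fact
  have eq: "\<bar>indicator A x *\<^sub>R c - indicator B x * c\<bar> = \<bar>c\<bar> * indicator (sym_diff A B) x" for x
    by (auto simp: indicator_def)
  have "(\<integral>x. \<bar>indicator A x *\<^sub>R c - indicator B x * c\<bar> \<partial>M) = \<bar>c\<bar> * prob (sym_diff A B)"
    unfolding eq by simp
  also have "\<dots> \<le> (\<bar>c\<bar> + 1) * prob (sym_diff A B)" by (intro mult_right_mono) auto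
  also have "\<dots> < (\<bar>c\<bar> + 1) * (e / (\<bar>c\<bar> + 1))" using B(2) by (intro mult_strict_left_mono) auto
  also have "\<dots> = e" by simp
  finally have "(\<integral>x. \<bar>indicator A x *\<^sub>R c - indicator B x * c\<bar> \<partial>M) < e" .
  moreover have "(\<lambda>x. indicator B x * c) \<in> borel_measurable (F m)" using B(1) by measurable
  moreover have "integrable M (\<lambda>x. indicator B x * c)" by (auto intro!: integrable_real_indicator simp: emeasure_eq_measure)
  ultimately show ?case by blast
next
  case (add f g)
  have "0 < e / 2" using add by simp
  obtain i f' where f': "f' \<in> borel_measurable (F i)" "integrable M f'" "(\<integral>x. \<bar>f x - f' x\<bar> \<partial>M) < e / 2"
    using add(3)[OF \<open>0 < e / 2\<close>] by blast
  obtain j g' where g': "g' \<in> borel_measurable (F j)" "integrable M g'" "(\<integral>x. \<bar>g x - g' x\<bar> \<partial>M) < e / 2"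
    using add(4)[OF \<open>0 < e / 2\<close>] by blast
  have "(\<lambda>x. f' x + g' x) \<in> borel_measurable (F (max i j))"
    using measurable_F_mono[OF f'(1), of "max i j"] measurable_F_mono[OF g'(1), of "max i j"] by simp
  moreover have "integrable M (\<lambda>x. f' x + g' x)" using f' g' by simp
  moreover have "(\<integral>x. \<bar>(f x + g x) - (f' x + g' x)\<bar> \<partial>M) \<le> (\<integral>x. \<bar>f x - f' x\<bar> + \<bar>g x - g' x\<bar> \<partial>M)"
    by (rule integral_mono) (use add f' g' in auto)
  moreover have "(\<integral>x. \<bar>f x - f' x\<bar> + \<bar>g x - g' x\<bar> \<partial>M) = (\<integral>x. \<bar>f x - f' x\<bar> \<partial>M) + (\<integral>x. \<bar>g x - g' x\<bar> \<partial>M)"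
    by (rule Bochner_Integration.integral_add) (use add f' g' in auto)
  ultimately show ?case using f'(3) g'(3) by (intro exI[of _ "max i j"] bexI[of _ "\<lambda>x. f' x + g' x"]) auto
next
  case (lim f s)
  have bound: "norm (s i x) \<le> 2 * norm (f x)" if "x \<in> space M" for i x
    by (rule lim) (rule that)
  have IH: "\<exists>m. \<exists>g\<in>borel_measurable (F m). integrable M g \<and> (\<integral>x. \<bar>s i x - g x\<bar> \<partial>M) < e'" if "0 < e'" for i e'
    by (rule lim) (rule that)
  have "0 < e / 2" using lim by simp
  have "(\<lambda>i. \<integral>x. \<bar>s i x - f x\<bar> \<partial>M) \<longlonglongrightarrow> (\<integral>x. 0 \<partial>M)"
  proof (rule integral_dominated_convergence[where w = "\<lambda>x. 3 * \<bar>f x\<bar>"])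
    have "(\<lambda>i. \<bar>s i x - f x\<bar>) \<longlonglongrightarrow> \<bar>f x - f x\<bar>" if "x \<in> space M" for x
      by (intro tendsto_intros lim that)
    then show "AE x in M. (\<lambda>i. \<bar>s i x - f x\<bar>) \<longlonglongrightarrow> 0" by simp
    show "AE x in M. norm \<bar>s i x - f x\<bar> \<le> 3 * \<bar>f x\<bar>" for i
    proof (rule AE_I2)
      fix x assume "x \<in> space M"
      then show "norm \<bar>s i x - f x\<bar> \<le> 3 * \<bar>f x\<bar>" using bound[of x i] by simp
    qed
  qed (use lim in auto)
  then obtain i where i: "(\<integral>x. \<bar>s i x - f x\<bar> \<partial>M) < e / 2"
    using \<open>0 < e / 2\<close> by (metis (mono_tags, lifting) Bochner_Integration.integral_zero eventually_at_top_linorder order_refl order_tendstoD(2))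
  obtain m g where g: "g \<in> borel_measurable (F m)" "integrable M g" "(\<integral>x. \<bar>s i x - g x\<bar> \<partial>M) < e / 2"
    using IH[OF \<open>0 < e / 2\<close>] by blast
  have "(\<integral>x. \<bar>f x - g x\<bar> \<partial>M) \<le> (\<integral>x. \<bar>s i x - f x\<bar> + \<bar>s i x - g x\<bar> \<partial>M)"
    by (rule integral_mono) (use lim g in auto)
  also have "\<dots> = (\<integral>x. \<bar>s i x - f x\<bar> \<partial>M) + (\<integral>x. \<bar>s i x - g x\<bar> \<partial>M)"
    by (rule Bochner_Integration.integral_add) (use lim g in auto)
  also have "\<dots> < e" using i g(3) by linarith
  finally show ?case using g by blast
qed

text \<open>If \<open>g\<close> is \<open>F k\<close>-measurable and close to \<open>f\<close>, then for \<open>m \<ge> k\<close> conditioning changes \<open>f\<close> as much as it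
  changes \<open>f - g\<close>, and conditional expectation is a contraction of \<open>L\<^sup>1\<close>.\<close>

lemma levy_upward_L1:
  assumes all: "\<And>A. A \<in> sets M \<Longrightarrow> approximable A" and f: "integrable M f"
  shows "(\<lambda>m. \<integral>x. \<bar>real_cond_exp M (F m) f x - f x\<bar> \<partial>M) \<longlonglongrightarrow> 0"
proof (rule tendstoI)
  fix e :: real assume e: "0 < e"
  obtain k g where g: "g \<in> borel_measurable (F k)" "integrable M g" "(\<integral>x. \<bar>f x - g x\<bar> \<partial>M) < e / 2"
    using L1_approximation[OF all f, of "e / 2"] e by auto
  show "\<forall>\<^sub>F m in sequentially. dist (\<integral>x. \<bar>real_cond_exp M (F m) f x - f x\<bar> \<partial>M) 0 < e"
    using eventually_ge_at_top[of k]
  proof eventually_elim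
    case (elim m)
    interpret Fm: sigma_finite_subalgebra M "F m" by (rule sigma_finite_F)
    have gm: "g \<in> borel_measurable (F m)"
      by (rule measurable_F_mono[OF g(1) elim])
    let ?E = "real_cond_exp M (F m)"
    have 1: "AE x in M. ?E g x = g x" by (rule Fm.real_cond_exp_F_meas[OF g(2) gm])
    have 2: "AE x in M. ?E (\<lambda>x. f x - g x) x = ?E f x - ?E g x" by (rule Fm.real_cond_exp_diff[OF f g(2)])
    have 3: "AE x in M. ?E (\<lambda>x. f x - g x) x \<le> ?E (\<lambda>x. \<bar>f x - g x\<bar>) x"
      by (rule Fm.real_cond_exp_mono) (use f g in auto)
    have 4: "AE x in M. ?E (\<lambda>x. - \<bar>f x - g x\<bar>) x \<le> ?E (\<lambda>x. f x - g x) x"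
      by (rule Fm.real_cond_exp_mono) (use f g in auto)
    have 5: "AE x in M. ?E (\<lambda>x. (- 1) * \<bar>f x - g x\<bar>) x = (- 1) * ?E (\<lambda>x. \<bar>f x - g x\<bar>) x"
      by (rule Fm.real_cond_exp_cmult) (use f g in auto)
    have "AE x in M. \<bar>?E f x - f x\<bar> \<le> ?E (\<lambda>x. \<bar>f x - g x\<bar>) x + \<bar>f x - g x\<bar>"
      using 1 2 3 4 5 by eventually_elim auto
    then have "(\<integral>x. \<bar>?E f x - f x\<bar> \<partial>M) \<le> (\<integral>x. ?E (\<lambda>x. \<bar>f x - g x\<bar>) x + \<bar>f x - g x\<bar> \<partial>M)"
      by (intro integral_mono_AE) (use f g Fm.real_cond_exp_int in auto)
    also have "\<dots> = (\<integral>x. ?E (\<lambda>x. \<bar>f x - g x\<bar>) x \<partial>M) + (\<integral>x. \<bar>f x - g x\<bar> \<partial>M)"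
      by (rule Bochner_Integration.integral_add) (use f g Fm.real_cond_exp_int in auto)
    also have "(\<integral>x. ?E (\<lambda>x. \<bar>f x - g x\<bar>) x \<partial>M) = (\<integral>x. \<bar>f x - g x\<bar> \<partial>M)"
      by (rule Fm.real_cond_exp_int) (use f g in auto)
    finally show ?case using g(3) by simp
  qed
qed

end

text \<open>By the triangle inequality this reduces to convexity of \<open>t \<mapsto> t powr q\<close> on \<open>t \<ge> 0\<close>, where the end
  point \<open>0\<close> is treated by \<open>s powr q \<le> s\<close> for \<open>0 < s < 1\<close>.\<close>

lemma convex_abs_powr:
  assumes q: "1 \<le> (q::real)" shows "convex_on UNIV (\<lambda>x::real. \<bar>x\<bar> powr q)"
proof (rule convex_onI)
  fix t x y :: real assume t: "0 < t" "t < 1"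
  have shrink: "(s * b) powr q \<le> s * b powr q" if "0 \<le> b" "0 < s" "s < 1" for s b
  proof -
    have "s powr q \<le> s powr 1" using that q by (intro powr_mono') auto
    then show ?thesis using that by (simp add: powr_mult mult_right_mono)
  qed
  have "((1 - t) * a + t * b) powr q \<le> (1 - t) * a powr q + t * b powr q" if "0 \<le> a" "0 \<le> b" for a b
  proof (cases "a = 0 \<or> b = 0")
    case True
    then show ?thesis using shrink[of a "1 - t"] shrink[of b t] t that q by auto
  next
    case False
    then show ?thesis using convex_onD[OF powr_convex[OF q], of t a b] t that by simp
  qed
  from this[of "\<bar>x\<bar>" "\<bar>y\<bar>"]
  have "((1 - t) * \<bar>x\<bar> + t * \<bar>y\<bar>) powr q \<le> (1 - t) * \<bar>x\<bar> powr q + t * \<bar>y\<bar> powr q" by simp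
  moreover have "\<bar>(1 - t) *\<^sub>R x + t *\<^sub>R y\<bar> \<le> (1 - t) * \<bar>x\<bar> + t * \<bar>y\<bar>"
    using abs_triangle_ineq[of "(1 - t) * x" "t * y"] t by (simp add: abs_mult)
  then have "\<bar>(1 - t) *\<^sub>R x + t *\<^sub>R y\<bar> powr q \<le> ((1 - t) * \<bar>x\<bar> + t * \<bar>y\<bar>) powr q"
    using q by (intro powr_mono2) auto
  ultimately show "\<bar>(1 - t) *\<^sub>R x + t *\<^sub>R y\<bar> powr q \<le> (1 - t) * \<bar>x\<bar> powr q + t * \<bar>y\<bar> powr q" by linarith
qed simp

lemma (in sigma_finite_subalgebra) cond_exp_Lq_contraction:
  assumes fin: "finite_measure M" and q: "1 \<le> q" and f: "integrable M f" and fq: "integrable M (\<lambda>x. \<bar>f x\<bar> powr q)"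
  shows "integrable M (\<lambda>x. \<bar>real_cond_exp M F f x\<bar> powr q)"
    and "(\<integral>x. \<bar>real_cond_exp M F f x\<bar> powr q \<partial>M) \<le> (\<integral>x. \<bar>f x\<bar> powr q \<partial>M)"
proof -
  have meas: "(\<lambda>x::real. \<bar>x\<bar> powr q) \<in> borel_measurable borel" by measurable
  show int: "integrable M (\<lambda>x. \<bar>real_cond_exp M F f x\<bar> powr q)"
    by (rule integrable_convex_cond_exp[of f UNIV, OF f _ _ fq convex_abs_powr[OF q] meas]) auto
  have "AE x in M. \<bar>real_cond_exp M F f x\<bar> powr q \<le> real_cond_exp M F (\<lambda>x. \<bar>f x\<bar> powr q) x"
    by (rule real_cond_exp_jensens_inequality(2)[of f UNIV, OF f _ _ fq convex_abs_powr[OF q] meas]) auto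
  then have "(\<integral>x. \<bar>real_cond_exp M F f x\<bar> powr q \<partial>M) \<le> (\<integral>x. real_cond_exp M F (\<lambda>x. \<bar>f x\<bar> powr q) x \<partial>M)"
    by (intro integral_mono_AE int real_cond_exp_int(1)[OF fq])
  also have "\<dots> = (\<integral>x. \<bar>f x\<bar> powr q \<partial>M)" by (rule real_cond_exp_int(2)[OF fq])
  finally show "(\<integral>x. \<bar>real_cond_exp M F f x\<bar> powr q \<partial>M) \<le> (\<integral>x. \<bar>f x\<bar> powr q \<partial>M)" .
qed

section \<open>Convergence of products in Lebesgue spaces\<close>

text \<open>The three terms dominate for \<open>D \<le> \<delta>\<close>, for \<open>\<delta> < D \<le> K\<close> and for \<open>D > K\<close>. Convergence in probability makes
  the middle one small for fixed \<open>\<delta>\<close> and \<open>K\<close>, and a bound in \<open>L\<^sup>p\<close> makes the last one small for large \<open>K\<close>.\<close>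

lemma powr_three_regimes:
  fixes D :: real
  assumes D: "0 \<le> D" and r: "0 < r" "r < p" and \<delta>: "0 < \<delta>" "\<delta> \<le> 1" and K: "1 \<le> K"
  shows "D powr r \<le> \<delta> powr r + K powr r / \<delta> * min D 1 + K powr (r - p) * D powr p"
proof -
  have nn: "0 \<le> \<delta> powr r" "0 \<le> K powr r / \<delta> * min D 1" "0 \<le> K powr (r - p) * D powr p"
    using D \<delta> by auto
  consider "D \<le> \<delta>" | "\<delta> < D" "D \<le> K" | "K < D" by linarith
  then show ?thesis
  proof cases
    case 1
    then have "D powr r \<le> \<delta> powr r" using D r by (intro powr_mono2) auto
    then show ?thesis using nn by linarith
  next
    case 2
    then have "D powr r \<le> K powr r" using D r by (intro powr_mono2) auto
    also have "\<dots> = K powr r / \<delta> * \<delta>" using \<delta> by simp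
    also have "\<dots> \<le> K powr r / \<delta> * min D 1" using 2 \<delta> by (intro mult_left_mono) auto
    finally show ?thesis using nn by linarith
  next
    case 3
    have "D powr r = D powr (r - p) * D powr p" by (simp flip: powr_add)
    also have "\<dots> \<le> K powr (r - p) * D powr p"
      using 3 K r by (intro mult_right_mono powr_mono2') auto
    finally show ?thesis using nn by linarith
  qed
qed

lemma powr_le_one_plus:
  fixes D :: real
  assumes "0 \<le> D" "0 < r" "r \<le> p"
  shows "D powr r \<le> 1 + D powr p"
proof (cases "D \<le> 1")
  case True
  then have "D powr r \<le> 1" using assms by (intro powr_le1) auto
  then show ?thesis by (simp add: add_increasing2)
next
  case False
  then have "D powr r \<le> D powr p" using assms by (intro powr_mono) auto
  then show ?thesis by simp
qed

lemma (in prob_space) integrable_powr_smaller: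
  fixes D :: "'a \<Rightarrow> real"
  assumes [measurable]: "D \<in> borel_measurable M" and D: "\<And>x. 0 \<le> D x" and r: "0 < r" "r \<le> p"
    and int: "integrable M (\<lambda>x. D x powr p)"
  shows "integrable M (\<lambda>x. D x powr r)"
  by (rule Bochner_Integration.integrable_bound[of _ "\<lambda>x. 1 + D x powr p"])
    (use int powr_le_one_plus[OF D r] in auto)

text \<open>Convergence in probability is expressed by the expectation of \<open>min D 1\<close>.\<close>

lemma (in prob_space) Lr_tendsto_zero:
  fixes D :: "nat \<Rightarrow> 'a \<Rightarrow> real"
  assumes meas [measurable]: "\<And>m. D m \<in> borel_measurable M" and D: "\<And>m x. 0 \<le> D m x"
    and r: "0 < r" "r < p"
    and int: "\<And>m. integrable M (\<lambda>x. D m x powr p)" and bnd: "\<And>m. (\<integral>x. D m x powr p \<partial>M) \<le> B"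
    and lim: "(\<lambda>m. \<integral>x. min (D m x) 1 \<partial>M) \<longlonglongrightarrow> 0"
  shows "(\<lambda>m. \<integral>x. D m x powr r \<partial>M) \<longlonglongrightarrow> 0"
proof (rule tendstoI)
  fix e :: real assume e: "0 < e"
  \<comment> \<open>Each of the three terms is made at most \<open>e/4\<close>.\<close>
  define \<delta> where "\<delta> = min 1 ((e / 4) powr (1 / r))"
  have \<delta>: "0 < \<delta>" "\<delta> \<le> 1" using e by (auto simp: \<delta>_def)
  have \<delta>r: "\<delta> powr r \<le> e / 4"
  proof -
    have "\<delta> powr r \<le> ((e / 4) powr (1 / r)) powr r" using \<delta> r by (intro powr_mono2) (auto simp: \<delta>_def)
    also have "\<dots> = e / 4" using e r by (simp add: powr_powr)
    finally show ?thesis .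
  qed
  have "((\<lambda>K. K powr (r - p) * B) \<longlongrightarrow> 0 * B) at_top"
    using r by (intro tendsto_intros tendsto_neg_powr filterlim_ident) auto
  then have "\<forall>\<^sub>F K in at_top. K powr (r - p) * B < e / 4" using e by (intro order_tendstoD) auto
  then have "\<forall>\<^sub>F K in at_top. 1 \<le> K \<and> K powr (r - p) * B < e / 4"
    using eventually_ge_at_top[of 1] by eventually_elim auto
  then obtain K :: real where K: "1 \<le> K" "K powr (r - p) * B < e / 4"
    unfolding eventually_at_top_linorder by blast
  have "(\<lambda>m. K powr r / \<delta> * (\<integral>x. min (D m x) 1 \<partial>M)) \<longlonglongrightarrow> K powr r / \<delta> * 0"
    by (intro tendsto_intros lim)
  then have "\<forall>\<^sub>F m in sequentially. K powr r / \<delta> * (\<integral>x. min (D m x) 1 \<partial>M) < e / 4"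
    using e by (intro order_tendstoD) auto
  then show "\<forall>\<^sub>F m in sequentially. dist (\<integral>x. D m x powr r \<partial>M) 0 < e"
  proof eventually_elim
    case (elim m)
    have im: "integrable M (\<lambda>x. min (D m x) 1)"
      by (rule integrable_const_bound[of _ 1]) (use D in auto)
    have "(\<integral>x. D m x powr r \<partial>M) \<le> (\<integral>x. \<delta> powr r + K powr r / \<delta> * min (D m x) 1 + K powr (r - p) * D m x powr p \<partial>M)"
      by (rule integral_mono)
        (use im int integrable_powr_smaller[OF meas D r(1) less_imp_le[OF r(2)] int] powr_three_regimes[OF D r \<delta> K(1)] in auto)
    also have "\<dots> = \<delta> powr r + K powr r / \<delta> * (\<integral>x. min (D m x) 1 \<partial>M) + K powr (r - p) * (\<integral>x. D m x powr p \<partial>M)"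
      using im int[of m] by (simp add: prob_space)
    also have "\<dots> \<le> \<delta> powr r + K powr r / \<delta> * (\<integral>x. min (D m x) 1 \<partial>M) + K powr (r - p) * B"
      by (intro add_left_mono mult_left_mono bnd) auto
    also have "\<dots> < e" using \<delta>r elim K(2) e by linarith
    finally have "(\<integral>x. D m x powr r \<partial>M) < e" .
    moreover have "0 \<le> (\<integral>x. D m x powr r \<partial>M)" by simp
    ultimately show ?case by simp
  qed
qed

text \<open>A form of Young's inequality without constants, obtained by comparing \<open>w powr p\<close> with
  \<open>\<bar>x\<bar> powr (q - p)\<close>.\<close>

lemma powr_mult_split:
  fixes x w :: real
  assumes p: "0 < p" "p < q" and w: "0 \<le> w"
  shows "\<bar>x * w\<bar> powr p \<le> \<bar>x\<bar> powr q + w powr (p * q / (q - p))"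
proof (cases "x = 0 \<or> w = 0")
  case True
  then show ?thesis by auto
next
  case False
  then have x: "0 < \<bar>x\<bar>" and w: "0 < w" using w by auto
  have eq: "\<bar>x * w\<bar> powr p = \<bar>x\<bar> powr p * w powr p" using w by (simp add: abs_mult powr_mult)
  show ?thesis
  proof (cases "w powr p \<le> \<bar>x\<bar> powr (q - p)")
    case True
    then have "\<bar>x\<bar> powr p * w powr p \<le> \<bar>x\<bar> powr p * \<bar>x\<bar> powr (q - p)" by (intro mult_left_mono) auto
    also have "\<dots> = \<bar>x\<bar> powr q" by (simp flip: powr_add)
    finally show ?thesis unfolding eq by (simp add: add_increasing2)
  next
    case False
    have "\<bar>x\<bar> powr p = (\<bar>x\<bar> powr (q - p)) powr (p / (q - p))" using p by (simp add: powr_powr)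
    also have "\<dots> \<le> (w powr p) powr (p / (q - p))" using False p by (intro powr_mono2) auto
    finally have "\<bar>x\<bar> powr p * w powr p \<le> w powr (p * (p / (q - p))) * w powr p"
      by (intro mult_right_mono) (auto simp: powr_powr)
    also have "\<dots> = w powr (p * q / (q - p))"
    proof -
      have "p * (p / (q - p)) + p = p * q / (q - p)" using p by (simp add: field_simps)
      then show ?thesis by (simp flip: powr_add)
    qed
    finally show ?thesis unfolding eq by (simp add: add_increasing)
  qed
qed

lemma powr_diff_le:
  fixes a b :: real
  assumes p: "0 < p"
  shows "\<bar>a - b\<bar> powr p \<le> 2 powr p * (\<bar>a\<bar> powr p + \<bar>b\<bar> powr p)"
proof -
  have "\<bar>a - b\<bar> powr p \<le> (2 * max \<bar>a\<bar> \<bar>b\<bar>) powr p" using p by (intro powr_mono2) auto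
  also have "\<dots> = 2 powr p * max \<bar>a\<bar> \<bar>b\<bar> powr p" by (rule powr_mult)
  also have "\<dots> \<le> 2 powr p * (\<bar>a\<bar> powr p + \<bar>b\<bar> powr p)" by (intro mult_left_mono) (auto simp: max_def)
  finally show ?thesis .
qed

text \<open>Fatou's lemma.\<close>

lemma (in prob_space) moment_of_limit:
  fixes W :: "nat \<Rightarrow> 'a \<Rightarrow> real"
  assumes [measurable]: "\<And>m. W m \<in> borel_measurable M" "U \<in> borel_measurable M" and W: "\<And>m x. 0 \<le> W m x"
    and lim: "\<And>x. x \<in> space M \<Longrightarrow> (\<lambda>m. W m x) \<longlonglongrightarrow> U x" and p: "0 < p"
    and int: "\<And>m. integrable M (\<lambda>x. W m x powr p)" and bnd: "\<And>m. (\<integral>x. W m x powr p \<partial>M) \<le> B"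
  shows "integrable M (\<lambda>x. U x powr p)"
proof (rule integrableI_bounded)
  have "(\<integral>\<^sup>+x. ennreal (norm (U x powr p)) \<partial>M) = (\<integral>\<^sup>+x. liminf (\<lambda>m. ennreal (W m x powr p)) \<partial>M)"
  proof (rule nn_integral_cong)
    fix x assume x: "x \<in> space M"
    have "(\<lambda>m. W m x powr p) \<longlonglongrightarrow> U x powr p"
      by (rule tendsto_powr'[OF lim[OF x] tendsto_const]) (use p W in auto)
    then have "(\<lambda>m. ennreal (W m x powr p)) \<longlonglongrightarrow> ennreal (U x powr p)" by (rule tendsto_ennrealI)
    from lim_imp_Liminf[OF trivial_limit_sequentially this]
    show "ennreal (norm (U x powr p)) = liminf (\<lambda>m. ennreal (W m x powr p))" by simp
  qed
  also have "\<dots> \<le> liminf (\<lambda>m. \<integral>\<^sup>+x. ennreal (W m x powr p) \<partial>M)"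
    by (rule nn_integral_liminf) measurable
  also have "\<dots> \<le> liminf (\<lambda>m::nat. ennreal B)"
  proof (rule Liminf_mono, rule always_eventually, rule allI)
    fix m
    have "(\<integral>\<^sup>+x. ennreal (W m x powr p) \<partial>M) = ennreal (\<integral>x. W m x powr p \<partial>M)"
      by (rule nn_integral_eq_integral[OF int]) simp
    then show "(\<integral>\<^sup>+x. ennreal (W m x powr p) \<partial>M) \<le> ennreal B" using bnd[of m] by (simp add: ennreal_leI)
  qed
  also have "\<dots> < \<infinity>" by (simp add: Liminf_const)
  finally show "(\<integral>\<^sup>+x. ennreal (norm (U x powr p)) \<partial>M) < \<infinity>" .
qed measurable

text \<open>With \<open>p\<close> halfway between \<open>r\<close> and \<open>q\<close>, the bound in \<open>L\<^sup>q\<close> for \<open>X\<close> and the moments of all orders for \<open>W\<close>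
  bound the products in \<open>L\<^sup>p\<close>, so convergence in probability is enough. The error is
  \<open>(X - f) W + f (W - U)\<close>: the second summand tends to zero pointwise, and in the first one \<open>W\<close> exceeds a
  large level \<open>L\<close> only with small probability.\<close>

lemma (in prob_space)
  fixes X W :: "nat \<Rightarrow> 'a \<Rightarrow> real" and f U :: "'a \<Rightarrow> real"
  assumes meas [measurable]: "\<And>m. X m \<in> borel_measurable M" "\<And>m. W m \<in> borel_measurable M"
      "f \<in> borel_measurable M" "U \<in> borel_measurable M"
    and r: "1 \<le> r" "r < q"
    and X: "\<And>m. integrable M (\<lambda>x. \<bar>X m x\<bar> powr q)" "\<And>m. (\<integral>x. \<bar>X m x\<bar> powr q \<partial>M) \<le> A"
    and f: "integrable M (\<lambda>x. \<bar>f x\<bar> powr q)"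
    and Xf: "\<And>m. integrable M (X m)" "integrable M f" "(\<lambda>m. \<integral>x. \<bar>X m x - f x\<bar> \<partial>M) \<longlonglongrightarrow> 0"
    and W: "\<And>m x. 0 \<le> W m x" and lim: "\<And>x. x \<in> space M \<Longrightarrow> (\<lambda>m. W m x) \<longlonglongrightarrow> U x" and U: "\<And>x. 0 \<le> U x"
    and mom: "\<And>p. 1 \<le> p \<Longrightarrow> \<exists>B. \<forall>m. integrable M (\<lambda>x. W m x powr p) \<and> (\<integral>x. W m x powr p \<partial>M) \<le> B"
  shows product_Lr_integrable: "integrable M (\<lambda>x. \<bar>X m x * W m x\<bar> powr r)"
    and product_limit_Lr_integrable: "integrable M (\<lambda>x. \<bar>f x * U x\<bar> powr r)"
    and product_Lr_tendsto: "(\<lambda>m. \<integral>x. \<bar>X m x * W m x - f x * U x\<bar> powr r \<partial>M) \<longlonglongrightarrow> 0"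
proof -
  define p where "p = (r + q) / 2"
  have p: "1 \<le> p" "r < p" "p < q" using r by (auto simp: p_def)
  define s where "s = p * q / (q - p)"
  have s: "1 \<le> s"
  proof -
    have "q - p \<le> p * q" using p mult_right_mono[of 1 p q] by linarith
    then show ?thesis using p by (simp add: s_def)
  qed
  obtain B where B: "\<And>m. integrable M (\<lambda>x. W m x powr s)" "\<And>m. (\<integral>x. W m x powr s \<partial>M) \<le> B"
    using mom[OF s] by blast
  obtain B1 where B1: "\<And>m. integrable M (\<lambda>x. W m x powr 1)" "\<And>m. (\<integral>x. W m x powr 1 \<partial>M) \<le> B1"
    using mom[of 1] by auto
  have Us: "integrable M (\<lambda>x. U x powr s)"
    by (rule moment_of_limit[OF _ _ W lim _ B]) (use s in auto)
  have split: "\<bar>x * w\<bar> powr p \<le> \<bar>x\<bar> powr q + w powr s" if "0 \<le> w" for x w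
    unfolding s_def by (rule powr_mult_split) (use p that in auto)
  have XWp: "integrable M (\<lambda>x. \<bar>X m x * W m x\<bar> powr p)" "(\<integral>x. \<bar>X m x * W m x\<bar> powr p \<partial>M) \<le> A + B" for m
  proof -
    have b: "integrable M (\<lambda>x. \<bar>X m x\<bar> powr q + W m x powr s)" using X B by simp
    show i: "integrable M (\<lambda>x. \<bar>X m x * W m x\<bar> powr p)"
      by (rule Bochner_Integration.integrable_bound[OF b]) (use split[OF W] in auto)
    have "(\<integral>x. \<bar>X m x * W m x\<bar> powr p \<partial>M) \<le> (\<integral>x. \<bar>X m x\<bar> powr q + W m x powr s \<partial>M)"
      by (rule integral_mono[OF i b]) (rule split[OF W])
    also have "\<dots> \<le> A + B" using X B by (simp add: add_mono)
    finally show "(\<integral>x. \<bar>X m x * W m x\<bar> powr p \<partial>M) \<le> A + B" .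
  qed
  have fUp: "integrable M (\<lambda>x. \<bar>f x * U x\<bar> powr p)"
    by (rule Bochner_Integration.integrable_bound[of _ "\<lambda>x. \<bar>f x\<bar> powr q + U x powr s"])
      (use f Us split[OF U] in auto)
  have rp: "0 < r" "r \<le> p" using r p by auto
  show "integrable M (\<lambda>x. \<bar>X m x * W m x\<bar> powr r)"
    by (rule integrable_powr_smaller[OF _ _ rp XWp(1)]) auto
  show "integrable M (\<lambda>x. \<bar>f x * U x\<bar> powr r)"
    by (rule integrable_powr_smaller[OF _ _ rp fUp]) auto
  define D where "D m x = \<bar>X m x * W m x - f x * U x\<bar>" for m x
  have [measurable]: "D m \<in> borel_measurable M" for m unfolding D_def by measurable
  have Dsum: "integrable M (\<lambda>x. 2 powr p * (\<bar>X m x * W m x\<bar> powr p + \<bar>f x * U x\<bar> powr p))" for m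
    using XWp fUp by simp
  have Dle: "D m x powr p \<le> 2 powr p * (\<bar>X m x * W m x\<bar> powr p + \<bar>f x * U x\<bar> powr p)" for m x
    unfolding D_def by (rule powr_diff_le) (use p in auto)
  have Dp: "integrable M (\<lambda>x. D m x powr p)" for m
    by (rule Bochner_Integration.integrable_bound[OF Dsum]) (use Dle in auto)
  have Dbnd: "(\<integral>x. D m x powr p \<partial>M) \<le> 2 powr p * (A + B + (\<integral>x. \<bar>f x * U x\<bar> powr p \<partial>M))" for m
  proof -
    have "(\<integral>x. D m x powr p \<partial>M) \<le> (\<integral>x. 2 powr p * (\<bar>X m x * W m x\<bar> powr p + \<bar>f x * U x\<bar> powr p) \<partial>M)"
      by (rule integral_mono[OF Dp Dsum Dle])
    also have "\<dots> \<le> 2 powr p * (A + B + (\<integral>x. \<bar>f x * U x\<bar> powr p \<partial>M))"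
      using XWp[of m] fUp by (simp add: mult_left_mono)
    finally show ?thesis .
  qed
  have bdd: "integrable M (\<lambda>x. min \<bar>F x\<bar> 1)" if "F \<in> borel_measurable M" for F :: "'a \<Rightarrow> real"
    by (rule integrable_const_bound[of _ 1]) (use that in auto)
  have tail: "(\<lambda>m. \<integral>x. min \<bar>f x * (W m x - U x)\<bar> 1 \<partial>M) \<longlonglongrightarrow> (\<integral>x. 0 \<partial>M)"
  proof (rule integral_dominated_convergence[where w = "\<lambda>_. 1"])
    have "(\<lambda>m. min \<bar>f x * (W m x - U x)\<bar> 1) \<longlonglongrightarrow> min \<bar>f x * (U x - U x)\<bar> 1" if "x \<in> space M" for x
      by (intro tendsto_intros lim that)
    then show "AE x in M. (\<lambda>m. min \<bar>f x * (W m x - U x)\<bar> 1) \<longlonglongrightarrow> 0" by simp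
  qed auto
  have Dmin: "(\<lambda>m. \<integral>x. min (D m x) 1 \<partial>M) \<longlonglongrightarrow> 0"
  proof (rule tendstoI)
    fix e :: real assume e: "0 < e"
    define b where "b = \<bar>B1\<bar> + 1"
    define L where "L = 3 * b / e"
    have b: "0 < b" "B1 \<le> b" by (auto simp: b_def)
    then have L: "0 < L" using e by (simp add: L_def)
    have "(\<lambda>m. L * (\<integral>x. \<bar>X m x - f x\<bar> \<partial>M)) \<longlonglongrightarrow> L * 0" by (intro tendsto_intros Xf)
    then have ev1: "\<forall>\<^sub>F m in sequentially. L * (\<integral>x. \<bar>X m x - f x\<bar> \<partial>M) < e / 3"
      using e by (intro order_tendstoD) auto
    have ev2: "\<forall>\<^sub>F m in sequentially. (\<integral>x. min \<bar>f x * (W m x - U x)\<bar> 1 \<partial>M) < e / 3"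
      using tail e by (intro order_tendstoD) auto
    show "\<forall>\<^sub>F m in sequentially. dist (\<integral>x. min (D m x) 1 \<partial>M) 0 < e"
      using ev1 ev2
    proof eventually_elim
      case (elim m)
      have le: "min (D m x) 1 \<le> L * \<bar>X m x - f x\<bar> + W m x powr 1 / L + min \<bar>f x * (W m x - U x)\<bar> 1" for x
      proof -
        have "D m x = \<bar>(X m x - f x) * W m x + f x * (W m x - U x)\<bar>" unfolding D_def by (simp add: algebra_simps)
        then have "D m x \<le> \<bar>X m x - f x\<bar> * W m x + \<bar>f x * (W m x - U x)\<bar>"
          using abs_triangle_ineq[of "(X m x - f x) * W m x" "f x * (W m x - U x)"] W[of m x] by (simp add: abs_mult)
        moreover have "min (\<bar>X m x - f x\<bar> * W m x) 1 \<le> L * \<bar>X m x - f x\<bar> + W m x / L"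
        proof (cases "W m x \<le> L")
          case True
          then have "\<bar>X m x - f x\<bar> * W m x \<le> \<bar>X m x - f x\<bar> * L" by (intro mult_left_mono) auto
          moreover have "0 \<le> W m x / L" using W L by simp
          ultimately show ?thesis by (simp add: mult.commute)
        next
          case False
          then have "1 \<le> W m x / L" using L by simp
          moreover have "0 \<le> L * \<bar>X m x - f x\<bar>" using L by simp
          ultimately show ?thesis by linarith
        qed
        moreover have "0 \<le> \<bar>X m x - f x\<bar> * W m x" using W by simp
        moreover have "W m x powr 1 = W m x" using W by simp
        moreover have "min d 1 \<le> min a 1 + min b 1" if "d \<le> a + b" "0 \<le> a" "0 \<le> b" for a b d :: real
          using that by (auto simp: min_def)
        ultimately show ?thesis by fastforce
      qed
      have "(\<integral>x. min (D m x) 1 \<partial>M) \<le>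
          (\<integral>x. L * \<bar>X m x - f x\<bar> + W m x powr 1 / L + min \<bar>f x * (W m x - U x)\<bar> 1 \<partial>M)"
      proof (rule integral_mono[OF _ _ le])
        show "integrable M (\<lambda>x. min (D m x) 1)" using bdd[of "D m"] by (simp add: D_def)
        show "integrable M (\<lambda>x. L * \<bar>X m x - f x\<bar> + W m x powr 1 / L + min \<bar>f x * (W m x - U x)\<bar> 1)"
          using Xf B1 bdd by (intro Bochner_Integration.integrable_add integrable_mult_right integrable_divide
              integrable_abs Bochner_Integration.integrable_diff) auto
      qed
      also have "\<dots> = L * (\<integral>x. \<bar>X m x - f x\<bar> \<partial>M) + (\<integral>x. W m x powr 1 \<partial>M) / L + (\<integral>x. min \<bar>f x * (W m x - U x)\<bar> 1 \<partial>M)"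
      proof -
        have i: "integrable M (\<lambda>x. L * \<bar>X m x - f x\<bar>)" "integrable M (\<lambda>x. W m x powr 1 / L)"
            "integrable M (\<lambda>x. min \<bar>f x * (W m x - U x)\<bar> 1)"
          using Xf(1)[of m] Xf(2) B1(1)[of m] by (auto intro!: bdd)
        show ?thesis
          unfolding Bochner_Integration.integral_add[OF Bochner_Integration.integrable_add[OF i(1,2)] i(3)]
            Bochner_Integration.integral_add[OF i(1,2)] by simp
      qed
      also have "(\<integral>x. W m x powr 1 \<partial>M) / L \<le> e / 3"
      proof -
        have "(\<integral>x. W m x powr 1 \<partial>M) / L \<le> b / L"
          using B1(2)[of m] b(2) L by (intro divide_right_mono) auto
        also have "\<dots> = e / 3" using e b(1) by (simp add: L_def)
        finally show ?thesis .
      qed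
      finally have "(\<integral>x. min (D m x) 1 \<partial>M) < e" using elim by linarith
      moreover have "0 \<le> (\<integral>x. min (D m x) 1 \<partial>M)" by (rule Bochner_Integration.integral_nonneg) (simp add: D_def)
      ultimately show ?case by simp
    qed
  qed
  have "(\<lambda>m. \<integral>x. D m x powr r \<partial>M) \<longlonglongrightarrow> 0"
    by (rule Lr_tendsto_zero[OF _ _ _ _ Dp Dbnd Dmin]) (use rp p in \<open>auto simp: D_def\<close>)
  then show "(\<lambda>m. \<integral>x. \<bar>X m x * W m x - f x * U x\<bar> powr r \<partial>M) \<longlonglongrightarrow> 0" by (simp add: D_def)
qed

section \<open>Cylinder algebras\<close>

lemma delta_in_Hsp: "l \<in> grid m \<Longrightarrow> delta h n l \<in> Hsp h m n"
  unfolding Hsp_def by (intro span_base imageI)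

lemma Hsp_mono: "m \<le> m' \<Longrightarrow> Hsp h m n \<subseteq> Hsp h m' n"
  unfolding Hsp_def by (intro span_mono image_mono grid_mono)

lemma coords_res: "coords h m n (res h m n \<phi>) = (\<lambda>l\<in>grid m. \<phi> (delta h n l))"
  by (auto simp: coords_def res_def delta_in_Hsp)

lemma res_res: "m \<le> m' \<Longrightarrow> res h m n (res h m' n \<phi>) = res h m n \<phi>"
  using Hsp_mono[of m m' h n] by (auto simp: res_def fun_eq_iff)

lemma space_dual_borel: "space (dual_borel h m n) = alg_dual (Hsp h m n)"
  by (simp add: dual_borel_def)

lemma res_alg_dual:
  assumes "linear \<phi>" shows "res h m n \<phi> \<in> alg_dual (Hsp h m n)"
proof -
  have "subspace (Hsp h m n)" unfolding Hsp_def by (rule subspace_span)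
  then show ?thesis
    using linear_add[OF assms] linear_scale[OF assms]
    by (auto simp: alg_dual_def res_def subspace_add subspace_scale)
qed

lemma res_alg_dual_mono:
  assumes z: "z \<in> alg_dual (Hsp h m' n)" and m: "m \<le> m'"
  shows "res h m n z \<in> alg_dual (Hsp h m n)"
proof -
  have "subspace (Hsp h m n)" unfolding Hsp_def by (rule subspace_span)
  then show ?thesis
    using z subsetD[OF Hsp_mono[OF m, of h n]] by (auto simp: alg_dual_def res_def subspace_add subspace_scale)
qed

lemma coords_res_mono:
  assumes m: "m \<le> m'" shows "coords h m n (res h m n z) = (\<lambda>l\<in>grid m. coords h m' n z l)"
  unfolding coords_def
proof (rule restrict_ext)
  fix l assume "l \<in> grid m"
  then show "res h m n z (delta h n l) = (\<lambda>l\<in>grid m'. z (delta h n l)) l"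
    using grid_mono[OF m] delta_in_Hsp[of l m h n] by (auto simp: res_def)
qed

lemma measurable_coords: "coords h m n \<in> measurable (dual_borel h m n) (PiM (grid m) (\<lambda>_. borel))"
  unfolding dual_borel_def by (rule measurable_vimage_algebra1) (auto simp: coords_def space_PiM)

lemma measurable_coordinate:
  assumes "l \<in> grid m" shows "(\<lambda>z. coords h m n z l) \<in> borel_measurable (dual_borel h m n)"
  using measurable_compose[OF measurable_coords measurable_component_singleton[OF assms]] by simp

lemma measurable_res_mono:
  assumes m: "m \<le> m'" shows "res h m n \<in> measurable (dual_borel h m' n) (dual_borel h m n)"
  unfolding dual_borel_def[of h m n]
proof (rule measurable_vimage_algebra2)
  show "res h m n \<in> space (dual_borel h m' n) \<rightarrow> alg_dual (Hsp h m n)"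
    using res_alg_dual_mono[OF _ m] by (auto simp: space_dual_borel)
  show "(\<lambda>z. coords h m n (res h m n z)) \<in> measurable (dual_borel h m' n) (PiM (grid m) (\<lambda>_. borel))"
    unfolding coords_res_mono[OF m]
    by (intro measurable_restrict measurable_coordinate) (use grid_mono[OF m] in auto)
qed

context gaussian_field_measure
begin

lemma measurable_res: "res h m n \<in> measurable \<mu> (dual_borel h m n)"
  unfolding dual_borel_def
proof (rule measurable_vimage_algebra2)
  show "res h m n \<in> space \<mu> \<rightarrow> alg_dual (Hsp h m n)" using res_alg_dual linear_mu by auto
  show "(\<lambda>\<phi>. coords h m n (res h m n \<phi>)) \<in> measurable \<mu> (PiM (grid m) (\<lambda>_. borel))"
    unfolding coords_res by (intro measurable_restrict measurable_evaluation)
qed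

lemma space_cyl: "space (cyl_algebra \<mu> h m n) = space \<mu>"
  by (simp add: cyl_algebra_def)

lemma measurable_res_cyl: "res h m n \<in> measurable (cyl_algebra \<mu> h m n) (dual_borel h m n)"
  unfolding cyl_algebra_def
  by (rule measurable_vimage_algebra1) (use res_alg_dual linear_mu in \<open>auto simp: space_dual_borel\<close>)

lemma sets_cyl: "sets (cyl_algebra \<mu> h m n) = {res h m n -` A \<inter> space \<mu> |A. A \<in> sets (dual_borel h m n)}"
  unfolding cyl_algebra_def
  by (rule sets_vimage_algebra2) (use res_alg_dual linear_mu in \<open>auto simp: space_dual_borel\<close>)

lemma subalgebra_cyl: "subalgebra \<mu> (cyl_algebra \<mu> h m n)"
  using measurable_sets[OF measurable_res] by (auto simp: subalgebra_def space_cyl sets_cyl)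

lemma cyl_mono:
  assumes m: "m \<le> m'" shows "sets (cyl_algebra \<mu> h m n) \<subseteq> sets (cyl_algebra \<mu> h m' n)"
proof
  fix C assume "C \<in> sets (cyl_algebra \<mu> h m n)"
  then obtain A where A: "A \<in> sets (dual_borel h m n)" "C = res h m n -` A \<inter> space \<mu>" by (auto simp: sets_cyl)
  let ?A' = "res h m n -` A \<inter> space (dual_borel h m' n)"
  have "C = res h m' n -` ?A' \<inter> space \<mu>"
    using A(2) res_alg_dual[OF linear_mu] by (auto simp: res_res[OF m] space_dual_borel)
  moreover have "?A' \<in> sets (dual_borel h m' n)" by (rule measurable_sets[OF measurable_res_mono[OF m] A(1)])
  ultimately show "C \<in> sets (cyl_algebra \<mu> h m' n)" unfolding sets_cyl by blast
qed

sublocale cyl: increasing_subalgebras \<mu> "\<lambda>m. cyl_algebra \<mu> h m n" for h n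
  by unfold_locales (rule subalgebra_cyl, erule cyl_mono)

lemma measurable_cyl_delta:
  assumes "l \<in> grid m" shows "(\<lambda>\<phi>. \<phi> (delta h n l)) \<in> borel_measurable (cyl_algebra \<mu> h m n)"
proof -
  have "(\<lambda>\<phi>. coords h m n (res h m n \<phi>) l) \<in> borel_measurable (cyl_algebra \<mu> h m n)"
    by (rule measurable_compose[OF measurable_res_cyl measurable_coordinate[OF assms]])
  then show ?thesis using assms by (simp add: coords_res)
qed

lemma measurable_cyl_span:
  assumes "a \<in> span (delta h n ` dyadic)"
  shows "\<exists>m. (\<lambda>\<phi>. \<phi> a) \<in> borel_measurable (cyl_algebra \<mu> h m n)"
  using assms
proof (induction rule: span_induct_alt)
  case base
  have "(\<lambda>\<phi>. \<phi> 0) \<in> borel_measurable (cyl_algebra \<mu> h 0 n) \<longleftrightarrow>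
      (\<lambda>_. 0 :: real) \<in> borel_measurable (cyl_algebra \<mu> h 0 n)"
    by (rule measurable_cong) (use linear_0[OF linear_mu] in \<open>auto simp: space_cyl\<close>)
  then show ?case by auto
next
  case (step c x y)
  obtain i l where l: "x = delta h n l" "l \<in> grid i" using step(1) by (auto simp: dyadic_grid)
  obtain j where j: "(\<lambda>\<phi>. \<phi> y) \<in> borel_measurable (cyl_algebra \<mu> h j n)" using step(2) by blast
  let ?C = "cyl_algebra \<mu> h (max i j) n"
  have [measurable]: "(\<lambda>\<phi>. \<phi> x) \<in> borel_measurable ?C" "(\<lambda>\<phi>. \<phi> y) \<in> borel_measurable ?C"
    using cyl.measurable_F_mono[OF j, of "max i j"] cyl.measurable_F_mono[OF measurable_cyl_delta[OF l(2)], of "max i j" h n] l(1)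
    by simp_all
  have "(\<lambda>\<phi>. \<phi> (c *\<^sub>R x + y)) \<in> borel_measurable ?C \<longleftrightarrow> (\<lambda>\<phi>. c * \<phi> x + \<phi> y) \<in> borel_measurable ?C"
    by (rule measurable_cong)
      (use linear_add[OF linear_mu] linear_scale[OF linear_mu] in \<open>auto simp: space_cyl\<close>)
  then show ?case by (intro exI[of _ "max i j"]) simp
qed

text \<open>The variance of \<open>\<phi>(u - a)\<close> is at most the squared \<open>L\<^sup>2\<close> norm of \<open>u - a\<close> in the plane, which can be made
  arbitrarily small.\<close>

lemma evaluation_limit_of_cylindrical:
  assumes h: "mollifier h" and n: "1 \<le> n"
  shows "\<exists>a. (\<forall>k. a k \<in> span (delta h n ` dyadic)) \<and> (AE \<phi> in \<mu>. (\<lambda>k. \<phi> (a k)) \<longlonglongrightarrow> \<phi> u)"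
proof -
  have "\<exists>a\<in>span (delta h n ` dyadic). (\<integral>x. (sfun (u - a) x)\<^sup>2 \<partial>lborel) < 1 / real (Suc k)" for k
    by (rule delta_span_L2_dense[OF h n]) simp
  then obtain a where a: "\<And>k. a k \<in> span (delta h n ` dyadic)"
    "\<And>k. (\<integral>x. (sfun (u - a k) x)\<^sup>2 \<partial>lborel) < 1 / real (Suc k)" by metis
  have int: "integrable \<mu> (\<lambda>\<phi>. (\<phi> (u - a k))\<^sup>2)" for k by (rule integrable_evaluation_sq)
  have "(\<lambda>k. \<integral>\<phi>. norm ((\<phi> (u - a k))\<^sup>2) \<partial>\<mu>) \<longlonglongrightarrow> 0"
  proof (rule tendsto_sandwich[OF _ _ tendsto_const])
    show "(\<lambda>k. 1 / real (Suc k)) \<longlonglongrightarrow> 0" using LIMSEQ_inverse_real_of_nat by (simp add: inverse_eq_divide)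
    have "(\<integral>\<phi>. norm ((\<phi> (u - a k))\<^sup>2) \<partial>\<mu>) \<le> 1 / real (Suc k)" for k
      using cov_le_L2[of "u - a k"] a(2)[of k] by (simp add: integral_evaluation_sq)
    then show "\<forall>\<^sub>F k in sequentially. (\<integral>\<phi>. norm ((\<phi> (u - a k))\<^sup>2) \<partial>\<mu>) \<le> 1 / real (Suc k)" by simp
  qed simp
  from tendsto_L1_AE_subseq[OF int this] obtain r :: "nat \<Rightarrow> nat" where
    ae: "AE \<phi> in \<mu>. (\<lambda>k. (\<phi> (u - a (r k)))\<^sup>2) \<longlonglongrightarrow> 0" by blast
  have "AE \<phi> in \<mu>. (\<lambda>k. \<phi> (a (r k))) \<longlonglongrightarrow> \<phi> u"
    using ae AE_space
  proof eventually_elim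
    case (elim \<phi>)
    have "(\<lambda>k. sqrt ((\<phi> (u - a (r k)))\<^sup>2)) \<longlonglongrightarrow> sqrt 0" by (intro tendsto_intros elim)
    then have "(\<lambda>k. \<phi> (u - a (r k))) \<longlonglongrightarrow> 0" by (simp add: tendsto_rabs_zero_iff)
    then have "(\<lambda>k. \<phi> u - \<phi> (a (r k))) \<longlonglongrightarrow> 0" by (simp add: linear_diff[OF linear_mu[OF elim(2)]])
    from tendsto_diff[OF tendsto_const[of "\<phi> u"] this] show ?case by simp
  qed
  then show ?thesis using a(1) by (intro exI[of _ "\<lambda>k. a (r k)"]) auto
qed

text \<open>A generating event constrains a single evaluation. As an almost sure limit of cylindrical
  functions this evaluation agrees almost surely with a function measurable for the \<open>\<sigma>\<close>-algebra
  generated by the cylinder algebras.\<close>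

lemma all_sets_approximable:
  assumes h: "mollifier h" and n: "1 \<le> n" and A: "A \<in> sets \<mu>"
  shows "cyl.approximable h n A"
proof -
  let ?G = "{{\<phi> \<in> tempered. \<phi> f \<in> B} |f B. B \<in> sets (borel :: real measure)}"
  have gen: "cyl.approximable h n C" if C: "C \<in> ?G" for C
  proof -
    from C obtain f B where C: "C = {\<phi> \<in> tempered. \<phi> f \<in> B}" and B: "B \<in> sets (borel :: real measure)" by blast
    obtain a where a: "\<And>k. a k \<in> span (delta h n ` dyadic)" "AE \<phi> in \<mu>. (\<lambda>k. \<phi> (a k)) \<longlonglongrightarrow> \<phi> f"
      using evaluation_limit_of_cylindrical[OF h n, of f] by blast
    define N where "N = sigma (space \<mu>) (\<Union>m. sets (cyl_algebra \<mu> h m n))"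
    have sub: "(\<Union>m. sets (cyl_algebra \<mu> h m n)) \<subseteq> Pow (space \<mu>)"
    proof (rule UN_least, rule subsetI, rule PowI)
      fix m D assume "D \<in> sets (cyl_algebra \<mu> h m n)"
      from sets.sets_into_space[OF this] show "D \<subseteq> space \<mu>" by (simp only: space_cyl)
    qed
    have spN: "space N = space \<mu>" unfolding N_def using sub by (rule space_measure_of)
    have sN: "sets N = sigma_sets (space \<mu>) (\<Union>m. sets (cyl_algebra \<mu> h m n))"
      unfolding N_def using sub by (rule sets_measure_of)
    have [measurable]: "(\<lambda>\<phi>. \<phi> (a k)) \<in> borel_measurable N" for k
    proof -
      obtain m where m: "(\<lambda>\<phi>. \<phi> (a k)) \<in> borel_measurable (cyl_algebra \<mu> h m n)" using measurable_cyl_span[OF a(1)] by blast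
      show ?thesis
      proof (rule measurableI)
        fix S :: "real set" assume "S \<in> sets borel"
        from measurable_sets[OF m this] have "(\<lambda>\<phi>. \<phi> (a k)) -` S \<inter> space N \<in> (\<Union>m. sets (cyl_algebra \<mu> h m n))"
          by (auto simp: space_cyl spN)
        then show "(\<lambda>\<phi>. \<phi> (a k)) -` S \<inter> space N \<in> sets N" unfolding sN by (rule sigma_sets.Basic)
      qed simp
    qed
    define Y where "Y \<phi> = lim (\<lambda>k. \<phi> (a k))" for \<phi> :: "schwartz \<Rightarrow> real"
    have "Y \<in> borel_measurable N" unfolding Y_def by measurable
    from measurable_sets[OF this B] have "Y -` B \<inter> space \<mu> \<in> sigma_sets (space \<mu>) (\<Union>m. sets (cyl_algebra \<mu> h m n))"
      by (simp add: spN sN)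
    then have Yap: "cyl.approximable h n (Y -` B \<inter> space \<mu>)"
      by (rule cyl.approximable_sigma_sets) (auto intro: cyl.approximable_F)
    show ?thesis
    proof (rule cyl.approximable_AE_eq[OF Yap])
      show "C \<in> sets \<mu>" using \<open>C \<in> ?G\<close> unfolding sets_mu_generated by (rule sigma_sets.Basic)
      show "AE \<phi> in \<mu>. \<phi> \<in> C \<longleftrightarrow> \<phi> \<in> Y -` B \<inter> space \<mu>"
        using a(2) AE_space by eventually_elim (auto simp: C Y_def limI space_mu)
    qed
  qed
  show ?thesis
    using A unfolding sets_mu_generated space_mu[symmetric]
    by (rule cyl.approximable_sigma_sets) (use gen in \<open>auto simp: space_mu\<close>)
qed

end

section \<open>Interactions and their exponentials\<close>

lemma monomial_dominated:
  fixes A \<eta> :: real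
  assumes A: "0 \<le> A" and \<eta>: "0 < \<eta>" and i: "i < k"
  shows "\<exists>T\<ge>0. \<forall>t\<ge>0. A * t ^ i \<le> \<eta> * t ^ k + T"
proof -
  define R where "R = max 1 (A / \<eta>)"
  have R: "1 \<le> R" "A \<le> \<eta> * R" using \<eta> by (auto simp: R_def max_def field_simps)
  have "A * t ^ i \<le> \<eta> * t ^ k + A * R ^ i" if t: "0 \<le> t" for t
  proof (cases "t \<le> R")
    case True
    then have "A * t ^ i \<le> A * R ^ i" using A t by (intro mult_left_mono power_mono) auto
    moreover have "0 \<le> \<eta> * t ^ k" using \<eta> t by simp
    ultimately show ?thesis by linarith
  next
    case False
    then have "A \<le> \<eta> * t" using R(2) \<eta> by (smt (verit) mult_left_mono)
    then have "A * t ^ i \<le> (\<eta> * t) * t ^ i" using t by (intro mult_right_mono) auto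
    also have "\<dots> = \<eta> * t ^ Suc i" by simp
    also have "\<dots> \<le> \<eta> * t ^ k" using False R(1) i \<eta> by (intro mult_left_mono power_increasing) auto
    finally show ?thesis using A R(1) by (simp add: add_increasing2)
  qed
  moreover have "0 \<le> A * R ^ i" using A R(1) by simp
  ultimately show ?thesis by blast
qed

text \<open>For an even order the leading monomial \<open>z ^ k\<close> dominates the lower ones, uniformly as long as the
  variance stays bounded.\<close>

lemma wick_bounded_below:
  assumes k: "even k" and c0: "0 \<le> c0"
  shows "\<exists>C\<ge>0. \<forall>c z. 0 \<le> c \<and> c \<le> c0 \<longrightarrow> - C \<le> wick k c z"
proof -
  define a :: "nat \<Rightarrow> real" where "a j = ((- 1) ^ j * fact k) / (fact (k - 2 * j) * fact j * 2 ^ j)" for j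
  have a0: "a 0 = 1" by (simp add: a_def)
  define J where "J = {1..k div 2}"
  have wick: "wick k c z = z ^ k + (\<Sum>j\<in>J. a j * c ^ j * z ^ (k - 2 * j))" for c z :: real
  proof -
    have "{0..k div 2} = insert 0 J" "0 \<notin> J" "finite J" by (auto simp: J_def)
    then show ?thesis by (simp add: wick_def a_def[symmetric] a0)
  qed
  \<comment> \<open>With this factor the lower monomials together use up at most one copy of \<open>z ^ k\<close>.\<close>
  define \<eta> where "\<eta> = 1 / (real (card J) + 1)"
  have \<eta>: "0 < \<eta>" "real (card J) * \<eta> \<le> 1" by (auto simp: \<eta>_def field_simps)
  have "\<exists>T\<ge>0. \<forall>t\<ge>0. (\<bar>a j\<bar> * c0 ^ j) * t ^ (k - 2 * j) \<le> \<eta> * t ^ k + T" if "j \<in> J" for j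
    by (rule monomial_dominated) (use c0 \<eta> that in \<open>auto simp: J_def\<close>)
  then obtain T where T: "\<And>j. j \<in> J \<Longrightarrow> 0 \<le> T j"
    "\<And>j t. j \<in> J \<Longrightarrow> 0 \<le> t \<Longrightarrow> (\<bar>a j\<bar> * c0 ^ j) * t ^ (k - 2 * j) \<le> \<eta> * t ^ k + T j" by metis
  have "- (\<Sum>j\<in>J. T j) \<le> wick k c z" if c: "0 \<le> c" "c \<le> c0" for c z
  proof -
    have "\<bar>\<Sum>j\<in>J. a j * c ^ j * z ^ (k - 2 * j)\<bar> \<le> (\<Sum>j\<in>J. \<eta> * \<bar>z\<bar> ^ k + T j)"
    proof (rule order_trans[OF sum_abs sum_mono])
      fix j assume j: "j \<in> J"
      have "\<bar>a j * c ^ j * z ^ (k - 2 * j)\<bar> = (\<bar>a j\<bar> * c ^ j) * \<bar>z\<bar> ^ (k - 2 * j)"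
        using c by (simp add: abs_mult power_abs)
      also have "\<dots> \<le> (\<bar>a j\<bar> * c0 ^ j) * \<bar>z\<bar> ^ (k - 2 * j)"
        using c by (intro mult_right_mono mult_left_mono power_mono) auto
      also have "\<dots> \<le> \<eta> * \<bar>z\<bar> ^ k + T j" by (rule T(2)[OF j]) simp
      finally show "\<bar>a j * c ^ j * z ^ (k - 2 * j)\<bar> \<le> \<eta> * \<bar>z\<bar> ^ k + T j" .
    qed
    also have "\<dots> = (real (card J) * \<eta>) * \<bar>z\<bar> ^ k + (\<Sum>j\<in>J. T j)" by (simp add: sum.distrib)
    also have "\<dots> \<le> 1 * \<bar>z\<bar> ^ k + (\<Sum>j\<in>J. T j)" using \<eta>(2) by (intro add_right_mono mult_right_mono) auto
    also have "\<bar>z\<bar> ^ k = z ^ k" using k by (simp add: power_even_abs)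
    finally show ?thesis unfolding wick by linarith
  qed
  moreover have "0 \<le> (\<Sum>j\<in>J. T j)" by (rule sum_nonneg) (rule T(1))
  ultimately show ?thesis by blast
qed

lemma wick_0: "wick 0 c z = 1" and wick_1: "wick 1 c z = z"
  by (simp_all add: wick_def)

lemma continuous_on_wick:
  assumes "continuous_on A c" "continuous_on A z"
  shows "continuous_on A (\<lambda>x. wick k (c x) (z x))"
  unfolding wick_def by (intro continuous_intros assms)

lemma measurable_wick [measurable]:
  "z \<in> borel_measurable M \<Longrightarrow> (\<lambda>x. wick k c (z x)) \<in> borel_measurable M"
  unfolding wick_def by measurable

lemma interaction_fin_res:
  "interaction_fin h k g n m (res h m n \<phi>) = 1 / 2 ^ (2 * m) *
     (\<Sum>l\<in>grid m. wick k (cov (delta h n l) (delta h n l)) (\<phi> (delta h n l)) * g l)"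
  unfolding interaction_fin_def coords_res by simp

lemma measurable_interaction_fin: "interaction_fin h k g n m \<in> borel_measurable (dual_borel h m n)"
proof -
  have "(\<lambda>z. 1 / 2 ^ (2 * m) *
     (\<Sum>l\<in>grid m. wick k (cov (delta h n l) (delta h n l)) (coords h m n z l) * g l)) \<in> borel_measurable (dual_borel h m n)"
    by (intro borel_measurable_times borel_measurable_sum borel_measurable_const measurable_wick measurable_coordinate)
  then show ?thesis unfolding interaction_fin_def[abs_def] .
qed

context gaussian_field_measure
begin

lemma characteristic_tendsto:
  assumes Y [measurable]: "\<And>k. Y k \<in> borel_measurable \<mu>" "Z \<in> borel_measurable \<mu>"
    and lim: "\<And>\<phi>. \<phi> \<in> space \<mu> \<Longrightarrow> (\<lambda>k. Y k \<phi>) \<longlonglongrightarrow> (Z \<phi> :: real)"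
  shows "(\<lambda>k. CLINT \<phi>|\<mu>. iexp (Y k \<phi>)) \<longlonglongrightarrow> (CLINT \<phi>|\<mu>. iexp (Z \<phi>))"
proof (rule integral_dominated_convergence[where w = "\<lambda>_. 1"])
  have "(\<lambda>k. iexp (Y k \<phi>)) \<longlonglongrightarrow> iexp (Z \<phi>)" if "\<phi> \<in> space \<mu>" for \<phi>
    by (intro tendsto_intros lim that)
  then show "AE \<phi> in \<mu>. (\<lambda>k. iexp (Y k \<phi>)) \<longlonglongrightarrow> iexp (Z \<phi>)" by simp
qed auto

text \<open>The covariance is minus twice the logarithm of a characteristic function, which is continuous by
  dominated convergence.\<close>

lemma continuous_cov_delta:
  assumes h: "compactly_supported (sfun h)"
  shows "continuous_on UNIV (\<lambda>x. cov (delta h n x) (delta h n x))"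
proof (intro continuous_at_imp_continuous_on ballI)
  fix x
  let ?c = "\<lambda>x. cov (delta h n x) (delta h n x)"
  show "isCont ?c x"
    unfolding continuous_at_sequentially o_def
  proof (intro allI impI)
    fix X assume X: "X \<longlonglongrightarrow> x"
    have lim: "(\<lambda>k. \<phi> (delta h n (X k))) \<longlonglongrightarrow> \<phi> (delta h n x)" if "\<phi> \<in> space \<mu>" for \<phi>
    proof -
      have "continuous_on UNIV (\<lambda>x. \<phi> (delta h n x))"
        using that by (intro continuous_tempered_delta[OF h]) (simp add: space_mu)
      from continuous_on_tendsto_compose[OF this X] show ?thesis by simp
    qed
    have "(\<lambda>k. CLINT \<phi>|\<mu>. iexp (\<phi> (delta h n (X k)))) \<longlonglongrightarrow> (CLINT \<phi>|\<mu>. iexp (\<phi> (delta h n x)))"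
      by (rule characteristic_tendsto[OF measurable_evaluation measurable_evaluation lim])
    then have "(\<lambda>k. complex_of_real (exp (- ?c (X k) / 2))) \<longlonglongrightarrow> complex_of_real (exp (- ?c x / 2))"
      by (simp only: characteristic_function)
    then have "(\<lambda>k. exp (- ?c (X k) / 2)) \<longlonglongrightarrow> exp (- ?c x / 2)" by (simp only: tendsto_of_real_iff)
    then have "(\<lambda>k. ln (exp (- ?c (X k) / 2))) \<longlonglongrightarrow> ln (exp (- ?c x / 2))" by (rule tendsto_ln) simp
    then have "(\<lambda>k. - ?c (X k) / 2) \<longlonglongrightarrow> - ?c x / 2" by (simp only: ln_exp)
    from tendsto_mult_left[OF this, of "-2"] show "(\<lambda>k. ?c (X k)) \<longlonglongrightarrow> ?c x" by simp
  qed
qed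

text \<open>At a small argument \<open>t > 0\<close> the characteristic function of the limit is close to one, whereas that
  of a centred Gaussian variable with large variance would be close to zero.\<close>

lemma cov_bounded_if_convergent:
  assumes lim: "\<And>\<phi>. \<phi> \<in> space \<mu> \<Longrightarrow> (\<lambda>m. \<phi> (F m)) \<longlonglongrightarrow> Z \<phi>"
  shows "\<exists>C. \<forall>m. cov (F m) (F m) \<le> C"
proof -
  have [measurable]: "Z \<in> borel_measurable \<mu>"
    by (rule borel_measurable_LIMSEQ_real[OF lim]) auto
  have "(\<lambda>j. CLINT \<phi>|\<mu>. iexp (1 / real (Suc j) * Z \<phi>)) \<longlonglongrightarrow> (CLINT \<phi>|\<mu>. iexp 0)"
  proof (rule characteristic_tendsto)
    fix \<phi>
    have "(\<lambda>j. 1 / real (Suc j)) \<longlonglongrightarrow> 0" using LIMSEQ_inverse_real_of_nat by (simp add: inverse_eq_divide)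
    from tendsto_mult_right[OF this, of "Z \<phi>"] show "(\<lambda>j. 1 / real (Suc j) * Z \<phi>) \<longlonglongrightarrow> 0" by simp
  qed auto
  from tendsto_norm[OF this]
  have "(\<lambda>j. norm (CLINT \<phi>|\<mu>. iexp (1 / real (Suc j) * Z \<phi>))) \<longlonglongrightarrow> 1" by (simp add: prob_space)
  then have "\<forall>\<^sub>F j in sequentially. 1 / 2 < norm (CLINT \<phi>|\<mu>. iexp (1 / real (Suc j) * Z \<phi>))"
    by (rule order_tendstoD) simp
  then obtain j where j: "1 / 2 < norm (CLINT \<phi>|\<mu>. iexp (1 / real (Suc j) * Z \<phi>))"
    by (auto simp: eventually_sequentially)
  define t where "t = 1 / real (Suc j)"
  have t: "0 < t" by (simp add: t_def)
  have "(\<lambda>m. CLINT \<phi>|\<mu>. iexp (\<phi> (t *\<^sub>R F m))) \<longlonglongrightarrow> (CLINT \<phi>|\<mu>. iexp (t * Z \<phi>))"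
  proof (rule characteristic_tendsto)
    fix \<phi> assume \<phi>: "\<phi> \<in> space \<mu>"
    show "(\<lambda>m. \<phi> (t *\<^sub>R F m)) \<longlonglongrightarrow> t * Z \<phi>"
      using tendsto_mult_left[OF lim[OF \<phi>], of t] by (simp add: linear_scale[OF linear_mu[OF \<phi>]])
  qed auto
  from tendsto_norm[OF this]
  have "(\<lambda>m. exp (- (t\<^sup>2 * cov (F m) (F m)) / 2)) \<longlonglongrightarrow> norm (CLINT \<phi>|\<mu>. iexp (t * Z \<phi>))"
    by (simp add: characteristic_function cov_scaleR)
  then have ev: "\<forall>\<^sub>F m in sequentially. 1 / 2 < exp (- (t\<^sup>2 * cov (F m) (F m)) / 2)"
    by (rule order_tendstoD) (use j in \<open>simp add: t_def\<close>)
  have "Bseq (\<lambda>m. cov (F m) (F m))"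
  proof (rule BfunI)
    show "\<forall>\<^sub>F m in sequentially. norm (cov (F m) (F m)) \<le> 2 * ln 2 / t\<^sup>2"
      using ev
    proof eventually_elim
      case (elim m)
      have "ln (1 / 2) < ln (exp (- (t\<^sup>2 * cov (F m) (F m)) / 2))" using elim by (subst ln_less_cancel_iff) auto
      then have "t\<^sup>2 * cov (F m) (F m) \<le> 2 * ln 2" by (simp add: ln_div)
      then show ?case using t cov_nonneg[of "F m"] by (simp add: field_simps)
    qed
  qed
  then obtain C where "\<forall>m. norm (cov (F m) (F m)) \<le> C" by (rule BseqE)
  then show ?thesis by (auto simp: abs_le_iff)
qed

lemma interaction_fin_tendsto:
  assumes h: "compactly_supported (sfun h)" and supp: "\<And>x. g x \<noteq> 0 \<Longrightarrow> norm x < real N" and N: "1 \<le> N"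
    and g: "riemann_integrable g" "integrable lebesgue g" and \<phi>: "\<phi> \<in> space \<mu>"
  shows "(\<lambda>m. interaction_fin h k g n m (res h m n \<phi>)) \<longlonglongrightarrow> interaction h k g n \<phi>"
proof -
  have "continuous_on UNIV (\<lambda>x. wick k (cov (delta h n x) (delta h n x)) (\<phi> (delta h n x)))"
    using \<phi> by (intro continuous_on_wick continuous_cov_delta continuous_tempered_delta h) (simp add: space_mu)
  from grid_sum_tendsto[OF supp N g this] show ?thesis unfolding interaction_fin_res interaction_def .
qed

lemma measurable_interaction_fin_res: "(\<lambda>\<phi>. interaction_fin h k g n m (res h m n \<phi>)) \<in> borel_measurable \<mu>"
  by (rule measurable_compose[OF measurable_res measurable_interaction_fin])

text \<open>For \<open>k = 1\<close> the interaction is linear in the distribution, thus centred Gaussian with variance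
  bounded in \<open>m\<close>, and exponential moments of Gaussian variables depend on the variance only. In the
  other cases the integrand of the interaction is at least a constant multiple of \<open>- \<bar>g\<bar>\<close>, and
  the Riemann sums of \<open>\<bar>g\<bar>\<close> are bounded.\<close>

lemma exp_interaction_fin_moments:
  assumes h: "compactly_supported (sfun h)" and supp: "\<And>x. g x \<noteq> 0 \<Longrightarrow> norm x < real N" and N: "1 \<le> N"
    and g: "riemann_integrable g" "integrable lebesgue g"
    and k: "k \<le> 1 \<or> (even k \<and> (\<forall>x. 0 \<le> g x)) \<or> (\<forall>x. g x = 0)"
    and p: "0 \<le> p"
  shows "\<exists>B. \<forall>m. integrable \<mu> (\<lambda>\<phi>. exp (- interaction_fin h k g n m (res h m n \<phi>)) powr p) \<and>
    (\<integral>\<phi>. exp (- interaction_fin h k g n m (res h m n \<phi>)) powr p \<partial>\<mu>) \<le> B"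
proof (cases "k = 1")
  case True
  define F where "F m = (1 / 2 ^ (2 * m)) *\<^sub>R (\<Sum>l\<in>grid m. g l *\<^sub>R delta h n l)" for m
  have F: "interaction_fin h k g n m (res h m n \<phi>) = \<phi> (F m)" if "\<phi> \<in> space \<mu>" for \<phi> m
    unfolding F_def interaction_fin_res linear_scale[OF linear_mu[OF that]] linear_sum[OF linear_mu[OF that]] True wick_1
    by (simp add: mult.commute)
  have "\<exists>C. \<forall>m. cov (F m) (F m) \<le> C"
    using interaction_fin_tendsto[OF h supp N g, of _ k n] by (intro cov_bounded_if_convergent) (simp add: F)
  then obtain C where C: "\<And>m. cov (F m) (F m) \<le> C" by blast
  have eq: "exp (- interaction_fin h k g n m (res h m n \<phi>)) powr p = exp (\<phi> ((- p) *\<^sub>R F m))"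
    if "\<phi> \<in> space \<mu>" for \<phi> m
    unfolding F[OF that] linear_scale[OF linear_mu[OF that]] by (simp add: powr_def)
  have "integrable \<mu> (\<lambda>\<phi>. exp (- interaction_fin h k g n m (res h m n \<phi>)) powr p) \<and>
    (\<integral>\<phi>. exp (- interaction_fin h k g n m (res h m n \<phi>)) powr p \<partial>\<mu>) \<le> exp (p\<^sup>2 * C / 2)" for m
  proof
    show "integrable \<mu> (\<lambda>\<phi>. exp (- interaction_fin h k g n m (res h m n \<phi>)) powr p)"
      using integrable_exp_evaluation by (subst Bochner_Integration.integrable_cong[OF refl eq]) auto
    have "(\<integral>\<phi>. exp (- interaction_fin h k g n m (res h m n \<phi>)) powr p \<partial>\<mu>) = (\<integral>\<phi>. exp (\<phi> ((- p) *\<^sub>R F m)) \<partial>\<mu>)"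
      by (rule Bochner_Integration.integral_cong[OF refl eq])
    also have "\<dots> = exp (p\<^sup>2 * cov (F m) (F m) / 2)"
      unfolding integral_exp_evaluation cov_scaleR by simp
    also have "\<dots> \<le> exp (p\<^sup>2 * C / 2)" using mult_left_mono[OF C[of m], of "p\<^sup>2"] by simp
    finally show "(\<integral>\<phi>. exp (- interaction_fin h k g n m (res h m n \<phi>)) powr p \<partial>\<mu>) \<le> exp (p\<^sup>2 * C / 2)" .
  qed
  then show ?thesis by blast
next
  case False
  have "\<exists>C\<ge>0. \<forall>x z. - C * \<bar>g x\<bar> \<le> wick k (cov (delta h n x) (delta h n x)) z * g x"
  proof -
    have "compact ((\<lambda>x. cov (delta h n x) (delta h n x)) ` cball 0 (real N))"
      by (intro compact_continuous_image continuous_on_subset[OF continuous_cov_delta[OF h]]) auto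
    then have "bounded ((\<lambda>x. cov (delta h n x) (delta h n x)) ` cball 0 (real N))" by (rule compact_imp_bounded)
    then obtain c0 where "\<forall>c\<in>(\<lambda>x. cov (delta h n x) (delta h n x)) ` cball 0 (real N). norm c \<le> c0"
      unfolding bounded_iff by blast
    then have c0: "\<bar>cov (delta h n x) (delta h n x)\<bar> \<le> c0" if "x \<in> cball 0 (real N)" for x
      using that by (auto simp del: mem_cball_0)
    have c0': "0 \<le> c0" using c0[of 0] by simp
    consider "k = 0" | "even k" "\<And>x. 0 \<le> g x" | "\<And>x. g x = 0" using k False by force
    then show ?thesis
    proof cases
      case 1
      then show ?thesis by (intro exI[of _ 1]) (auto simp: wick_0)
    next
      case 2
      obtain C where C: "0 \<le> C" "\<And>c z. 0 \<le> c \<Longrightarrow> c \<le> c0 \<Longrightarrow> - C \<le> wick k c z"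
        using wick_bounded_below[OF 2(1) c0'] by blast
      have "- C * \<bar>g x\<bar> \<le> wick k (cov (delta h n x) (delta h n x)) z * g x" for x z
      proof (cases "g x = 0")
        case False
        then have "norm x \<le> real N" using supp[of x] by simp
        then have "- C \<le> wick k (cov (delta h n x) (delta h n x)) z"
          using c0[of x] by (intro C(2) cov_nonneg) auto
        then show ?thesis using 2(2)[of x] mult_right_mono by fastforce
      qed simp
      then show ?thesis using C(1) by blast
    next
      case 3
      then show ?thesis by (intro exI[of _ 0]) simp
    qed
  qed
  then obtain C where C: "0 \<le> C" "\<And>x z. - C * \<bar>g x\<bar> \<le> wick k (cov (delta h n x) (delta h n x)) z * g x" by blast
  obtain B where B: "\<forall>m. norm (1 / 2 ^ (2 * m) * (\<Sum>l\<in>grid m. \<bar>g l\<bar>)) \<le> B"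
    using grid_sum_abs_bounded[OF supp N g continuous_on_const[of UNIV "0 :: real"]] by (rule BseqE)
  have low: "- (C * B) \<le> interaction_fin h k g n m (res h m n \<phi>)" for m \<phi>
  proof -
    have "- (C * B) \<le> - (C * (1 / 2 ^ (2 * m) * (\<Sum>l\<in>grid m. \<bar>g l\<bar>)))"
      using B[rule_format, of m] C(1) by (intro le_imp_neg_le mult_left_mono) auto
    also have "\<dots> = 1 / 2 ^ (2 * m) * (\<Sum>l\<in>grid m. - C * \<bar>g l\<bar>)" by (simp add: sum_negf sum_distrib_left)
    also have "\<dots> \<le> interaction_fin h k g n m (res h m n \<phi>)"
      unfolding interaction_fin_res by (intro mult_left_mono sum_mono C(2)) auto
    finally show ?thesis .
  qed
  have le: "exp (- interaction_fin h k g n m (res h m n \<phi>)) powr p \<le> exp (C * B) powr p" for m \<phi>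
    by (intro powr_mono2 p) (use low[of m \<phi>] in auto)
  note [measurable] = measurable_interaction_fin_res
  have int: "integrable \<mu> (\<lambda>\<phi>. exp (- interaction_fin h k g n m (res h m n \<phi>)) powr p)" for m
    by (rule integrable_const_bound[of _ "exp (C * B) powr p"]) (use le in auto)
  have "(\<integral>\<phi>. exp (- interaction_fin h k g n m (res h m n \<phi>)) powr p \<partial>\<mu>) \<le> (\<integral>\<phi>. exp (C * B) powr p \<partial>\<mu>)" for m
    by (rule integral_mono[OF int _ le]) simp
  then show ?thesis using int by (intro exI[of _ "exp (C * B) powr p"]) (simp add: prob_space)
qed

end

section \<open>Limits of co-Cauchy sequences\<close>

lemma Lp_norm_tendsto_0_iff:
  assumes r: "0 < r"
  shows "(\<lambda>m. Lp_norm r (M m) (D m)) \<longlonglongrightarrow> 0 \<longleftrightarrow> (\<lambda>m. \<integral>x. \<bar>D m x\<bar> powr r \<partial>M m) \<longlonglongrightarrow> 0"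
proof
  assume "(\<lambda>m. Lp_norm r (M m) (D m)) \<longlonglongrightarrow> 0"
  then have "(\<lambda>m. Lp_norm r (M m) (D m) powr r) \<longlonglongrightarrow> 0 powr r"
    by (rule tendsto_powr'[OF _ tendsto_const]) (use r in \<open>auto simp: Lp_norm_def\<close>)
  then show "(\<lambda>m. \<integral>x. \<bar>D m x\<bar> powr r \<partial>M m) \<longlonglongrightarrow> 0"
    using r by (simp add: Lp_norm_def powr_powr)
next
  assume "(\<lambda>m. \<integral>x. \<bar>D m x\<bar> powr r \<partial>M m) \<longlonglongrightarrow> 0"
  then have "(\<lambda>m. (\<integral>x. \<bar>D m x\<bar> powr r \<partial>M m) powr (1 / r)) \<longlonglongrightarrow> 0 powr (1 / r)"
    by (rule tendsto_powr'[OF _ tendsto_const]) (use r in auto)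
  then show "(\<lambda>m. Lp_norm r (M m) (D m)) \<longlonglongrightarrow> 0" using r by (simp add: Lp_norm_def)
qed

lemma Lp_fun_diff:
  assumes r: "0 < r" and a: "a \<in> Lp_fun r M" and b: "b \<in> Lp_fun r M"
  shows "(\<lambda>x. a x - b x) \<in> Lp_fun r M"
proof -
  have [measurable]: "a \<in> borel_measurable M" "b \<in> borel_measurable M" using a b by (auto simp: Lp_fun_def)
  have "integrable M (\<lambda>x. \<bar>a x - b x\<bar> powr r)"
    by (rule Bochner_Integration.integrable_bound[of _ "\<lambda>x. 2 powr r * (\<bar>a x\<bar> powr r + \<bar>b x\<bar> powr r)"])
      (use a b powr_diff_le[OF r] in \<open>auto simp: Lp_fun_def\<close>)
  then show ?thesis by (simp add: Lp_fun_def)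
qed

text \<open>Integrals of \<open>r\<close>-th powers serve as a distance; the constant is immaterial for limits.\<close>

lemma Lp_quasi_triangle:
  assumes r: "0 < r" and a: "a \<in> Lp_fun r M" and b: "b \<in> Lp_fun r M" and c: "c \<in> Lp_fun r M"
  shows "(\<integral>x. \<bar>a x - b x\<bar> powr r \<partial>M) \<le>
    2 powr r * ((\<integral>x. \<bar>a x - c x\<bar> powr r \<partial>M) + (\<integral>x. \<bar>b x - c x\<bar> powr r \<partial>M))"
proof -
  have i: "integrable M (\<lambda>x. \<bar>a x - b x\<bar> powr r)" "integrable M (\<lambda>x. \<bar>a x - c x\<bar> powr r)" "integrable M (\<lambda>x. \<bar>b x - c x\<bar> powr r)"
    using Lp_fun_diff[OF r a b] Lp_fun_diff[OF r a c] Lp_fun_diff[OF r b c] by (auto simp: Lp_fun_def)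
  have "(\<integral>x. \<bar>a x - b x\<bar> powr r \<partial>M) \<le> (\<integral>x. 2 powr r * (\<bar>a x - c x\<bar> powr r + \<bar>b x - c x\<bar> powr r) \<partial>M)"
  proof (rule integral_mono)
    fix x
    show "\<bar>a x - b x\<bar> powr r \<le> 2 powr r * (\<bar>a x - c x\<bar> powr r + \<bar>b x - c x\<bar> powr r)"
      using powr_diff_le[OF r, of "a x - c x" "b x - c x"] by simp
  qed (use i in auto)
  then show ?thesis using i by simp
qed

lemma Lp_limit_unique:
  assumes r: "0 < r" and mem: "\<And>m. a m \<in> Lp_fun r M" "\<And>m. b m \<in> Lp_fun r M" "F \<in> Lp_fun r M" "G \<in> Lp_fun r M"
    and aF: "(\<lambda>m. \<integral>x. \<bar>a m x - F x\<bar> powr r \<partial>M) \<longlonglongrightarrow> 0"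
    and bG: "(\<lambda>m. \<integral>x. \<bar>b m x - G x\<bar> powr r \<partial>M) \<longlonglongrightarrow> 0"
    and ab: "(\<lambda>m. \<integral>x. \<bar>a m x - b m x\<bar> powr r \<partial>M) \<longlonglongrightarrow> 0"
  shows "AE x in M. F x = G x"
proof -
  let ?I = "\<integral>x. \<bar>F x - G x\<bar> powr r \<partial>M"
  let ?d = "\<lambda>u v. \<integral>x. \<bar>u x - v x\<bar> powr r \<partial>M"
  have sym: "?d u v = ?d v u" for u v :: "'a \<Rightarrow> real" by (simp add: abs_minus_commute)
  have bound: "?I \<le> 2 powr r * (?d (a m) F + 2 powr r * (?d (a m) (b m) + ?d (b m) G))" for m
  proof -
    have "?I \<le> 2 powr r * (?d F (a m) + ?d G (a m))" by (rule Lp_quasi_triangle[OF r mem(3,4,1)])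
    also have "?d G (a m) \<le> 2 powr r * (?d G (b m) + ?d (a m) (b m))" by (rule Lp_quasi_triangle[OF r mem(4,1,2)])
    finally show ?thesis using sym[of F "a m"] sym[of G "b m"] by (simp add: add.commute)
  qed
  have "(\<lambda>m. 2 powr r * (?d (a m) F + 2 powr r * (?d (a m) (b m) + ?d (b m) G))) \<longlonglongrightarrow> 2 powr r * (0 + 2 powr r * (0 + 0))"
    by (intro tendsto_intros aF bG ab)
  then have "?I \<le> 2 powr r * (0 + 2 powr r * (0 + 0))" by (rule LIMSEQ_le_const) (use bound in blast)
  moreover have "0 \<le> ?I" by simp
  ultimately have "?I = 0" by simp
  then have "AE x in M. \<bar>F x - G x\<bar> powr r = 0"
    using Lp_fun_diff[OF r mem(3,4)] by (subst (asm) integral_nonneg_eq_0_iff_AE) (auto simp: Lp_fun_def)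
  then show ?thesis by eventually_elim simp
qed

lemma compact_support_integrable:
  assumes g: "g \<in> Lp_fun s lebesgue" and s: "1 \<le> s" and supp: "\<And>x. g x \<noteq> 0 \<Longrightarrow> norm x < N"
  shows "integrable lebesgue (g :: real^2 \<Rightarrow> real)"
proof (rule Bochner_Integration.integrable_bound)
  have "cball (0 :: real^2) N \<in> lmeasurable" by (rule lmeasurable_cball)
  then have "integrable lebesgue (indicator (cball (0 :: real^2) N) :: _ \<Rightarrow> real)"
    by (simp add: fmeasurable_def)
  then show "integrable lebesgue (\<lambda>x. indicator (cball 0 N) x + \<bar>g x\<bar> powr s)" using g by (simp add: Lp_fun_def)
  show "g \<in> borel_measurable lebesgue" using g by (simp add: Lp_fun_def)
  have "\<bar>g x\<bar> \<le> indicator (cball 0 N) x + \<bar>g x\<bar> powr s" for x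
    using powr_le_one_plus[of "\<bar>g x\<bar>" 1 s] s supp[of x] by (cases "g x = 0") auto
  then show "AE x in lebesgue. norm (g x) \<le> norm (indicator (cball 0 N) x + \<bar>g x\<bar> powr s)"
    by (intro AE_I2) (auto intro: order_trans[OF _ abs_ge_self])
qed

context gaussian_field_measure
begin

lemma measurable_mu_fin: "borel_measurable (mu_fin \<mu> h m n) = borel_measurable (dual_borel h m n)"
  by (rule measurable_cong_sets) (simp_all add: mu_fin_def)

lemma integral_mu_fin:
  fixes F :: "(schwartz \<Rightarrow> real) \<Rightarrow> real"
  assumes "F \<in> borel_measurable (dual_borel h m n)"
  shows "(\<integral>z. F z \<partial>mu_fin \<mu> h m n) = (\<integral>\<phi>. F (res h m n \<phi>) \<partial>\<mu>)"
  unfolding mu_fin_def by (rule integral_distr[OF measurable_res assms])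

lemma Lp_norm_mu_fin:
  assumes [measurable]: "F \<in> borel_measurable (dual_borel h m n)"
  shows "Lp_norm r (mu_fin \<mu> h m n) F = Lp_norm r \<mu> (\<lambda>\<phi>. F (res h m n \<phi>))"
  unfolding Lp_norm_def by (subst integral_mu_fin) auto

lemma Lp_fun_mu_fin:
  assumes F [measurable]: "F \<in> borel_measurable (dual_borel h m n)"
  shows "F \<in> Lp_fun r (mu_fin \<mu> h m n) \<longleftrightarrow> (\<lambda>\<phi>. F (res h m n \<phi>)) \<in> Lp_fun r \<mu>"
proof -
  have "integrable (mu_fin \<mu> h m n) (\<lambda>z. \<bar>F z\<bar> powr r) \<longleftrightarrow> integrable \<mu> (\<lambda>\<phi>. \<bar>F (res h m n \<phi>)\<bar> powr r)"
    unfolding mu_fin_def by (rule integrable_distr_eq[OF measurable_res]) measurable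
  then show ?thesis
    using F measurable_compose[OF measurable_res F] by (simp add: Lp_fun_def measurable_mu_fin)
qed

text \<open>Restricting twice is restricting once, so pulling a difference \<open>u m \<circ> res - u m'\<close> back to the
  distributions gives a difference of two members of a convergent sequence. Equivalent sequences have
  pullbacks with the same limit, which therefore depends on the class only.\<close>

lemma co_limit_of_pullbacks:
  assumes r: "1 \<le> r" and u: "\<And>m. u m \<in> borel_measurable (dual_borel h m n)"
    and mem: "\<And>m. (\<lambda>\<phi>. u m (res h m n \<phi>)) \<in> Lp_fun r \<mu>" "G \<in> Lp_fun r \<mu>"
    and lim: "(\<lambda>m. \<integral>\<phi>. \<bar>u m (res h m n \<phi>) - G \<phi>\<bar> powr r \<partial>\<mu>) \<longlonglongrightarrow> 0"
  shows "co_class r \<mu> h n u \<in> co_space r \<mu> h n"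
    and "co_lim r \<mu> h n (co_class r \<mu> h n u) = Lp_class r \<mu> G"
proof -
  have r0: "0 < r" using r by simp
  let ?p = "\<lambda>u m \<phi>. u m (res h m n \<phi>)"
  have cauchy: "u \<in> co_cauchy r \<mu> h n"
    unfolding co_cauchy_def
  proof (intro CollectI conjI allI impI)
    show "u m \<in> Lp_fun r (mu_fin \<mu> h m n)" for m using mem(1) by (simp add: Lp_fun_mu_fin[OF u])
    fix e :: real assume e: "0 < e"
    have "\<forall>\<^sub>F m in sequentially. (\<integral>\<phi>. \<bar>?p u m \<phi> - G \<phi>\<bar> powr r \<partial>\<mu>) < e powr r / (2 * 2 powr r)"
      using lim by (rule order_tendstoD) (use e in simp)
    then obtain M where M: "\<And>m. M \<le> m \<Longrightarrow> (\<integral>\<phi>. \<bar>?p u m \<phi> - G \<phi>\<bar> powr r \<partial>\<mu>) < e powr r / (2 * 2 powr r)"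
      by (auto simp: eventually_sequentially)
    show "\<exists>M. \<forall>m m'. M \<le> m \<and> m \<le> m' \<longrightarrow> Lp_norm r (mu_fin \<mu> h m' n) (\<lambda>z. u m (res h m n z) - u m' z) < e"
    proof (intro exI[of _ M] allI impI)
      fix m m' assume m: "M \<le> m \<and> m \<le> m'"
      then have mm: "m \<le> m'" by simp
      have diff: "(\<lambda>z. u m (res h m n z) - u m' z) \<in> borel_measurable (dual_borel h m' n)"
        by (intro borel_measurable_diff u measurable_compose[OF measurable_res_mono[OF mm] u])
      have "Lp_norm r (mu_fin \<mu> h m' n) (\<lambda>z. u m (res h m n z) - u m' z) =
          (\<integral>\<phi>. \<bar>?p u m \<phi> - ?p u m' \<phi>\<bar> powr r \<partial>\<mu>) powr (1 / r)"
        unfolding Lp_norm_mu_fin[OF diff] res_res[OF mm] by (rule Lp_norm_def)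
      also have "\<dots> < (e powr r) powr (1 / r)"
      proof (rule powr_less_mono2)
        have "(\<integral>\<phi>. \<bar>?p u m \<phi> - ?p u m' \<phi>\<bar> powr r \<partial>\<mu>) \<le>
            2 powr r * ((\<integral>\<phi>. \<bar>?p u m \<phi> - G \<phi>\<bar> powr r \<partial>\<mu>) + (\<integral>\<phi>. \<bar>?p u m' \<phi> - G \<phi>\<bar> powr r \<partial>\<mu>))"
          by (rule Lp_quasi_triangle[OF r0 mem(1) mem(1) mem(2)])
        also have "\<dots> < 2 powr r * (e powr r / (2 * 2 powr r) + e powr r / (2 * 2 powr r))"
          using M[of m] M[of m'] m by (intro mult_strict_left_mono add_strict_mono) auto
        also have "\<dots> = e powr r" by simp
        finally show "(\<integral>\<phi>. \<bar>?p u m \<phi> - ?p u m' \<phi>\<bar> powr r \<partial>\<mu>) < e powr r" .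
      qed (use r0 in auto)
      also have "\<dots> = e" using r0 e by (simp add: powr_powr)
      finally show "Lp_norm r (mu_fin \<mu> h m' n) (\<lambda>z. u m (res h m n z) - u m' z) < e" .
    qed
  qed
  then show "co_class r \<mu> h n u \<in> co_space r \<mu> h n"
    unfolding co_class_def co_space_def by (rule quotientI)
  have refl: "u \<in> co_class r \<mu> h n u"
    using cauchy r0 by (simp add: co_class_def co_rel_def Lp_norm_def)
  have conv: "Lp_tendsto r \<mu> (\<lambda>m \<phi>. u m (res h m n \<phi>)) F" if F: "F \<in> Lp_class r \<mu> G" for F
  proof -
    have "AE \<phi> in \<mu>. F \<phi> = G \<phi>" and FL: "F \<in> Lp_fun r \<mu>" using F by (auto simp: Lp_class_def)
    then have "(\<integral>\<phi>. \<bar>?p u m \<phi> - F \<phi>\<bar> powr r \<partial>\<mu>) = (\<integral>\<phi>. \<bar>?p u m \<phi> - G \<phi>\<bar> powr r \<partial>\<mu>)" for m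
      using Lp_fun_diff[OF r0 mem(1) FL] Lp_fun_diff[OF r0 mem] by (intro integral_cong_AE) (auto simp: Lp_fun_def)
    then show ?thesis
      using lim mem(1) FL by (simp add: Lp_tendsto_def Lp_norm_tendsto_0_iff[OF r0])
  qed
  have uniq: "F \<in> Lp_class r \<mu> G" if v: "v \<in> co_class r \<mu> h n u" "Lp_tendsto r \<mu> (\<lambda>m \<phi>. v m (res h m n \<phi>)) F" for v F
  proof -
    have vc: "v \<in> co_cauchy r \<mu> h n" and uv: "(\<lambda>m. Lp_norm r (mu_fin \<mu> h m n) (\<lambda>z. u m z - v m z)) \<longlonglongrightarrow> 0"
      using v(1) by (auto simp: co_class_def co_rel_def)
    have vm: "v m \<in> borel_measurable (dual_borel h m n)" for m
      using vc by (auto simp: co_cauchy_def Lp_fun_def measurable_mu_fin)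
    have vL: "?p v m \<in> Lp_fun r \<mu>" for m
      using vc Lp_fun_mu_fin[OF vm] by (simp add: co_cauchy_def)
    have FL: "F \<in> Lp_fun r \<mu>" and vF: "(\<lambda>m. \<integral>\<phi>. \<bar>?p v m \<phi> - F \<phi>\<bar> powr r \<partial>\<mu>) \<longlonglongrightarrow> 0"
      using v(2) by (simp_all add: Lp_tendsto_def Lp_norm_tendsto_0_iff[OF r0])
    have "(\<lambda>m. Lp_norm r \<mu> (\<lambda>\<phi>. ?p u m \<phi> - ?p v m \<phi>)) \<longlonglongrightarrow> 0"
      using uv u vm by (simp add: Lp_norm_mu_fin borel_measurable_diff)
    then have "(\<lambda>m. \<integral>\<phi>. \<bar>?p u m \<phi> - ?p v m \<phi>\<bar> powr r \<partial>\<mu>) \<longlonglongrightarrow> 0"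
      by (simp only: Lp_norm_tendsto_0_iff[OF r0])
    from Lp_limit_unique[OF r0 mem(1) vL mem(2) FL lim vF this]
    have "AE \<phi> in \<mu>. G \<phi> = F \<phi>" .
    then have "AE \<phi> in \<mu>. F \<phi> = G \<phi>" by eventually_elim simp
    with FL show ?thesis by (simp add: Lp_class_def)
  qed
  show "co_lim r \<mu> h n (co_class r \<mu> h n u) = Lp_class r \<mu> G"
    unfolding co_lim_def using refl conv uniq by blast
qed

end

theorem theorem5p3:
  fixes \<mu> :: "(schwartz \<Rightarrow> real) measure"
    and h :: schwartz
    and g :: "real^2 \<Rightarrow> real"
    and k n :: nat
    and s q :: real
    and V f :: "(schwartz \<Rightarrow> real) \<Rightarrow> real"
    and fm :: "nat \<Rightarrow> (schwartz \<Rightarrow> real) \<Rightarrow> real"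
  assumes "gaussian_field \<mu>"
    and "mollifier h"
    and "compactly_supported g" and "riemann_integrable g"
    and "1 < s" and "g \<in> Lp_fun s lebesgue"
    and "k \<le> 1 \<or> (even k \<and> (\<forall>x. 0 \<le> g x)) \<or> (\<forall>x. g x = 0)"
    and "Lp_tendsto 2 \<mu> (\<lambda>i. interaction h k g i) V"
    and "\<And>p. 1 \<le> p \<Longrightarrow> (\<lambda>\<phi>. exp (- V \<phi>)) \<in> Lp_fun p \<mu>"
    and "1 \<le> n"
    and "1 < q" and "f \<in> Lp_fun q \<mu>"
    and "\<And>m. fm m \<in> pullback_inv \<mu> h m n (cond_exp_fin \<mu> h n m f)"
  shows "(\<forall>r. 1 \<le> r \<and> r < q \<longrightarrow>
            (\<lambda>\<phi>. f \<phi> * exp (- interaction h k g n \<phi>)) \<in> Lp_fun r \<mu> \<and>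
            co_class r \<mu> h n (\<lambda>m z. fm m z * exp (- interaction_fin h k g n m z)) \<in> co_space r \<mu> h n \<and>
            co_lim r \<mu> h n (co_class r \<mu> h n (\<lambda>m z. fm m z * exp (- interaction_fin h k g n m z))) =
              Lp_class r \<mu> (\<lambda>\<phi>. f \<phi> * exp (- interaction h k g n \<phi>)))
       \<and> (\<lambda>m. \<integral>z. fm m z * exp (- interaction_fin h k g n m z) \<partial>mu_fin \<mu> h m n)
           \<longlonglongrightarrow> (\<integral>\<phi>. f \<phi> * exp (- interaction h k g n \<phi>) \<partial>\<mu>)"
proof -
  interpret gaussian_field_measure \<mu> by standard fact
  have h: "compactly_supported (sfun h)" using assms(2) by (simp add: mollifier_def)
  have "bounded (closure {x. g x \<noteq> 0})" using assms(3) by (simp add: compactly_supported_def compact_imp_bounded)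
  then obtain R where R: "\<And>x. x \<in> closure {x. g x \<noteq> 0} \<Longrightarrow> norm x \<le> R" unfolding bounded_iff by blast
  obtain N :: nat where N: "max 1 (R + 1) \<le> real N" using real_arch_simple by blast
  have N1: "1 \<le> N" using N by simp
  have supp: "norm x < real N" if "g x \<noteq> 0" for x
    using R[of x] closure_subset[of "{x. g x \<noteq> 0}"] that N by fastforce
  have gint: "integrable lebesgue g"
    by (rule compact_support_integrable[OF assms(6) _ supp]) (use assms(5) in auto)
  define X where "X m \<phi> = fm m (res h m n \<phi>)" for m \<phi>
  define W where "W m \<phi> = exp (- interaction_fin h k g n m (res h m n \<phi>))" for m \<phi>
  define U where "U \<phi> = exp (- interaction h k g n \<phi>)" for \<phi>
  define u where "u m z = fm m z * exp (- interaction_fin h k g n m z)" for m z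
  have fm_meas: "fm m \<in> borel_measurable (dual_borel h m n)" for m
    using assms(13)[of m] by (simp add: pullback_inv_def measurable_mu_fin)
  have XE: "AE \<phi> in \<mu>. X m \<phi> = real_cond_exp \<mu> (cyl_algebra \<mu> h m n) f \<phi>" for m
    using assms(13)[of m] by (simp add: pullback_inv_def cond_exp_fin_def X_def)
  have [measurable]: "X m \<in> borel_measurable \<mu>" for m
    unfolding X_def by (rule measurable_compose[OF measurable_res fm_meas])
  have [measurable]: "W m \<in> borel_measurable \<mu>" for m
    unfolding W_def using measurable_interaction_fin_res by measurable
  have Vlim: "(\<lambda>m. interaction_fin h k g n m (res h m n \<phi>)) \<longlonglongrightarrow> interaction h k g n \<phi>" if "\<phi> \<in> space \<mu>" for \<phi>
    by (rule interaction_fin_tendsto[OF h supp N1 assms(4) gint that])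
  have "interaction h k g n \<in> borel_measurable \<mu>"
    by (rule borel_measurable_LIMSEQ_real[OF Vlim measurable_interaction_fin_res])
  then have [measurable]: "U \<in> borel_measurable \<mu>" unfolding U_def by measurable
  have Wlim: "(\<lambda>m. W m \<phi>) \<longlonglongrightarrow> U \<phi>" if "\<phi> \<in> space \<mu>" for \<phi>
    unfolding W_def U_def by (intro tendsto_intros Vlim that)
  have f_meas [measurable]: "f \<in> borel_measurable \<mu>" and fq: "integrable \<mu> (\<lambda>\<phi>. \<bar>f \<phi>\<bar> powr q)"
    using assms(12) by (auto simp: Lp_fun_def)
  have "integrable \<mu> (\<lambda>\<phi>. \<bar>f \<phi>\<bar> powr 1)"
    by (rule integrable_powr_smaller[OF _ _ _ _ fq]) (use assms(11) in auto)
  then have f1: "integrable \<mu> f" by (subst integrable_abs_iff[symmetric]) auto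
  have Xq: "integrable \<mu> (\<lambda>\<phi>. \<bar>X m \<phi>\<bar> powr q)" "(\<integral>\<phi>. \<bar>X m \<phi>\<bar> powr q \<partial>\<mu>) \<le> (\<integral>\<phi>. \<bar>f \<phi>\<bar> powr q \<partial>\<mu>)"
    and X1: "integrable \<mu> (X m)" for m
  proof -
    interpret C: sigma_finite_subalgebra \<mu> "cyl_algebra \<mu> h m n" by (rule cyl.sigma_finite_F)
    let ?E = "real_cond_exp \<mu> (cyl_algebra \<mu> h m n) f"
    have q1: "1 \<le> q" using assms(11) by simp
    have ae: "AE \<phi> in \<mu>. \<bar>X m \<phi>\<bar> powr q = \<bar>?E \<phi>\<bar> powr q" using XE[of m] by eventually_elim simp
    note con = C.cond_exp_Lq_contraction[OF finite_measure_axioms q1 f1 fq]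
    show "integrable \<mu> (\<lambda>\<phi>. \<bar>X m \<phi>\<bar> powr q)"
      using con(1) by (subst integrable_cong_AE[OF _ _ ae]) auto
    show "(\<integral>\<phi>. \<bar>X m \<phi>\<bar> powr q \<partial>\<mu>) \<le> (\<integral>\<phi>. \<bar>f \<phi>\<bar> powr q \<partial>\<mu>)"
      using con(2) by (subst integral_cong_AE[OF _ _ ae]) auto
    show "integrable \<mu> (X m)"
      using C.real_cond_exp_int(1)[OF f1] by (subst integrable_cong_AE[OF _ _ XE[of m]]) auto
  qed
  have "(\<lambda>m. \<integral>\<phi>. \<bar>real_cond_exp \<mu> (cyl_algebra \<mu> h m n) f \<phi> - f \<phi>\<bar> \<partial>\<mu>) \<longlonglongrightarrow> 0"
    by (rule cyl.levy_upward_L1[OF all_sets_approximable[OF assms(2) assms(10)] f1])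
  moreover have "(\<integral>\<phi>. \<bar>X m \<phi> - f \<phi>\<bar> \<partial>\<mu>) = (\<integral>\<phi>. \<bar>real_cond_exp \<mu> (cyl_algebra \<mu> h m n) f \<phi> - f \<phi>\<bar> \<partial>\<mu>)" for m
    by (rule integral_cong_AE) (use XE[of m] in \<open>auto elim: eventually_mono\<close>)
  ultimately have Xf: "(\<lambda>m. \<integral>\<phi>. \<bar>X m \<phi> - f \<phi>\<bar> \<partial>\<mu>) \<longlonglongrightarrow> 0" by simp
  have mom: "\<exists>B. \<forall>m. integrable \<mu> (\<lambda>\<phi>. W m \<phi> powr p) \<and> (\<integral>\<phi>. W m \<phi> powr p \<partial>\<mu>) \<le> B" if "1 \<le> p" for p
    unfolding W_def by (rule exp_interaction_fin_moments[OF h supp N1 assms(4) gint assms(7)]) (use that in auto)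
  have u_meas: "u m \<in> borel_measurable (dual_borel h m n)" for m
    unfolding u_def using fm_meas measurable_interaction_fin by measurable
  have u_res: "u m (res h m n \<phi>) = X m \<phi> * W m \<phi>" for m \<phi> by (simp add: u_def X_def W_def)
  have main: "(\<lambda>\<phi>. u m (res h m n \<phi>)) \<in> Lp_fun r \<mu>" "(\<lambda>\<phi>. f \<phi> * U \<phi>) \<in> Lp_fun r \<mu>"
      "(\<lambda>m. \<integral>\<phi>. \<bar>u m (res h m n \<phi>) - f \<phi> * U \<phi>\<bar> powr r \<partial>\<mu>) \<longlonglongrightarrow> 0"
    if r: "1 \<le> r" "r < q" for r m
  proof -
    have W0: "0 \<le> W m \<phi>" and U0: "0 \<le> U \<phi>" for m \<phi> by (simp_all add: W_def U_def)
    note prod = product_Lr_integrable[of X W f U, OF _ _ _ _ r Xq fq X1 f1 Xf W0 Wlim U0 mom]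
      product_limit_Lr_integrable[of X W f U, OF _ _ _ _ r Xq fq X1 f1 Xf W0 Wlim U0 mom]
      product_Lr_tendsto[of X W f U, OF _ _ _ _ r Xq fq X1 f1 Xf W0 Wlim U0 mom]
    show "(\<lambda>\<phi>. u m (res h m n \<phi>)) \<in> Lp_fun r \<mu>" "(\<lambda>\<phi>. f \<phi> * U \<phi>) \<in> Lp_fun r \<mu>"
      "(\<lambda>m. \<integral>\<phi>. \<bar>u m (res h m n \<phi>) - f \<phi> * U \<phi>\<bar> powr r \<partial>\<mu>) \<longlonglongrightarrow> 0"
      unfolding u_res Lp_fun_def using prod by auto
  qed
  have "(\<lambda>\<phi>. f \<phi> * U \<phi>) \<in> Lp_fun r \<mu> \<and> co_class r \<mu> h n u \<in> co_space r \<mu> h n \<and>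
      co_lim r \<mu> h n (co_class r \<mu> h n u) = Lp_class r \<mu> (\<lambda>\<phi>. f \<phi> * U \<phi>)" if r: "1 \<le> r" "r < q" for r
    using co_limit_of_pullbacks[OF r(1) u_meas main(1)[OF r] main(2,3)[OF r]] main(2)[OF r] by blast
  moreover have "(\<lambda>m. \<integral>z. u m z \<partial>mu_fin \<mu> h m n) \<longlonglongrightarrow> (\<integral>\<phi>. f \<phi> * U \<phi> \<partial>\<mu>)"
  proof -
    have one: "(1::real) \<le> 1" "1 < q" using assms(11) by auto
    have int: "integrable \<mu> (\<lambda>\<phi>. u m (res h m n \<phi>))" "integrable \<mu> (\<lambda>\<phi>. f \<phi> * U \<phi>)" for m
      using main(1)[OF one, of m] main(2)[OF one] by (auto simp: Lp_fun_def integrable_abs_iff)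
    have "(\<lambda>m. (\<integral>\<phi>. u m (res h m n \<phi>) \<partial>\<mu>) - (\<integral>\<phi>. f \<phi> * U \<phi> \<partial>\<mu>)) \<longlonglongrightarrow> 0"
    proof (rule Lim_null_comparison[OF _ main(3)[OF one]], rule always_eventually, rule allI)
      fix m
      have "norm ((\<integral>\<phi>. u m (res h m n \<phi>) \<partial>\<mu>) - (\<integral>\<phi>. f \<phi> * U \<phi> \<partial>\<mu>)) = norm (\<integral>\<phi>. u m (res h m n \<phi>) - f \<phi> * U \<phi> \<partial>\<mu>)"
        using int by simp
      also have "\<dots> \<le> (\<integral>\<phi>. norm (u m (res h m n \<phi>) - f \<phi> * U \<phi>) \<partial>\<mu>)" by (rule integral_norm_bound)
      finally show "norm ((\<integral>\<phi>. u m (res h m n \<phi>) \<partial>\<mu>) - (\<integral>\<phi>. f \<phi> * U \<phi> \<partial>\<mu>)) \<le>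
          (\<integral>\<phi>. \<bar>u m (res h m n \<phi>) - f \<phi> * U \<phi>\<bar> powr 1 \<partial>\<mu>)" by simp
    qed
    then show ?thesis unfolding integral_mu_fin[OF u_meas] by (rule LIM_zero_cancel)
  qed
  ultimately show ?thesis unfolding u_def U_def by blast
qed

end
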